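(* For any finite graph $\Gamma$, the group $\overline{\mathcal{T}}(A_\Gamma)$ is residually torsion-free nilpotent.
   Context: $\Gamma$ is a finite simple graph; $A_\Gamma$ is the group generated by the vertices of $\Gamma$ with relations $[v,w]=1$ for $v,w$ adjacent. $\overline{\mathcal{T}}(A_\Gamma)$ is the kernel of the natural map $\mathrm{Out}(A_\Gamma)\to\mathrm{Aut}(H_1(A_\Gamma))$; equivalently it is the image in $\mathrm{Out}(A_\Gamma)$ of the group of automorphisms of $A_\Gamma$ acting trivially on $H_1(A_\Gamma)$. A group is residually torsion-free nilpotent if every nontrivial element has nontrivial image under some homomorphism onto a torsion-free nilpotent group. *)

theory Defs
  imports "HOL-Algebra.Algebra" "Graph_Theory.Pair_Digraph"
begin

section \<open>Groups given by generators and relators\<close>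

text \<open>A letter \<open>(s, True)\<close> stands for the generator \<open>s\<close> and \<open>(s, False)\<close> for its formal inverse.\<close>

type_synonym 's word = "('s \<times> bool) list"

definition words :: "'s set \<Rightarrow> 's word set"
  where "words S = lists (S \<times> UNIV)"

inductive word_eq :: "'s set \<Rightarrow> 's word set \<Rightarrow> 's word \<Rightarrow> 's word \<Rightarrow> bool"
  for S :: "'s set" and R :: "'s word set"
  where
    refl: "u \<in> words S \<Longrightarrow> word_eq S R u u"
  | sym: "word_eq S R u v \<Longrightarrow> word_eq S R v u"
  | trans: "word_eq S R u v \<Longrightarrow> word_eq S R v w \<Longrightarrow> word_eq S R u w"
  | cancel: "u \<in> words S \<Longrightarrow> v \<in> words S \<Longrightarrow> s \<in> S \<Longrightarrow>
      word_eq S R (u @ [(s, b), (s, \<not> b)] @ v) (u @ v)"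
  | relator: "u \<in> words S \<Longrightarrow> v \<in> words S \<Longrightarrow> r \<in> R \<Longrightarrow> r \<in> words S \<Longrightarrow>
      word_eq S R (u @ r @ v) (u @ v)"

definition word_rel :: "'s set \<Rightarrow> 's word set \<Rightarrow> ('s word \<times> 's word) set"
  where "word_rel S R = {(u, v). word_eq S R u v}"

definition presented_group :: "'s set \<Rightarrow> 's word set \<Rightarrow> 's word set monoid"
  where "presented_group S R =
    \<lparr>carrier = words S // word_rel S R,
     monoid.mult = \<lambda>A B. \<Union>a\<in>A. \<Union>b\<in>B. word_rel S R `` {a @ b},
     one = word_rel S R `` {[]}\<rparr>"

lemma word_eq_words: "word_eq S R u v \<Longrightarrow> u \<in> words S \<and> v \<in> words S"
  by (induction rule: word_eq.induct) (auto simp: words_def)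

lemma word_eq_context:
  assumes "word_eq S R u v" "p \<in> words S" "q \<in> words S"
  shows "word_eq S R (p @ u @ q) (p @ v @ q)"
  using assms
proof (induction rule: word_eq.induct)
  case (refl u)
  then show ?case by (intro word_eq.refl) (auto simp: words_def)
next
  case (cancel u v s b)
  then show ?case
    using word_eq.cancel[of "p @ u" S "v @ q" s R b] by (auto simp: words_def)
next
  case (relator u v r)
  then show ?case
    using word_eq.relator[of "p @ u" S "v @ q" r R] by (auto simp: words_def)
qed (blast intro: word_eq.sym word_eq.trans)+

lemma word_eq_append:
  assumes "word_eq S R u u'" "word_eq S R v v'"
  shows "word_eq S R (u @ v) (u' @ v')"
proof -
  have "word_eq S R (u @ v) (u' @ v)"
    using word_eq_context[OF assms(1), of "[]" v] word_eq_words[OF assms(2)]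
    by (simp add: words_def)
  moreover have "word_eq S R (u' @ v) (u' @ v')"
    using word_eq_context[OF assms(2), of u' "[]"] word_eq_words[OF assms(1)]
    by (simp add: words_def)
  ultimately show ?thesis by (rule word_eq.trans)
qed

lemma equiv_word_rel: "equiv (words S) (word_rel S R)"
proof (rule equivI)
  show "word_rel S R \<subseteq> words S \<times> words S"
    using word_eq_words by (fastforce simp: word_rel_def)
  show "refl_on (words S) (word_rel S R)"
    by (auto simp: refl_on_def word_rel_def intro: word_eq.refl)
  show "Relation.sym (word_rel S R)"
    by (auto simp: Relation.sym_def word_rel_def intro: word_eq.sym)
  show "Relation.trans (word_rel S R)"
    by (auto simp: Relation.trans_def word_rel_def intro: word_eq.trans)
qed

lemma word_rel_class_eq:
  "u \<in> words S \<Longrightarrow> v \<in> words S \<Longrightarrow>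
   word_rel S R `` {u} = word_rel S R `` {v} \<longleftrightarrow> word_eq S R u v"
  using eq_equiv_class_iff[OF equiv_word_rel] by (fastforce simp: word_rel_def)

lemma presented_group_mult:
  assumes "u \<in> words S" "v \<in> words S"
  shows "(word_rel S R `` {u}) \<otimes>\<^bsub>presented_group S R\<^esub> (word_rel S R `` {v})
    = word_rel S R `` {u @ v}"
proof -
  have eq: "word_rel S R `` {a @ b} = word_rel S R `` {u @ v}"
    if "a \<in> word_rel S R `` {u}" "b \<in> word_rel S R `` {v}" for a b
  proof -
    have "word_eq S R (u @ v) (a @ b)"
      using that by (intro word_eq_append) (simp_all add: word_rel_def)
    then show ?thesis
      using word_eq_words word_rel_class_eq by metis
  qed
  have self: "u \<in> word_rel S R `` {u}" "v \<in> word_rel S R `` {v}"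
    using assms by (simp_all add: word_rel_def word_eq.refl)
  have "(word_rel S R `` {u}) \<otimes>\<^bsub>presented_group S R\<^esub> (word_rel S R `` {v})
      = (\<Union>a\<in>word_rel S R `` {u}. \<Union>b\<in>word_rel S R `` {v}. word_rel S R `` {a @ b})"
    by (simp add: presented_group_def)
  also have "\<dots> = (\<Union>a\<in>word_rel S R `` {u}. \<Union>b\<in>word_rel S R `` {v}. word_rel S R `` {u @ v})"
    by (intro SUP_cong HOL.refl eq)
  also have "\<dots> = word_rel S R `` {u @ v}"
    using self by blast
  finally show ?thesis .
qed

lemma presented_group_carrierE:
  assumes "x \<in> carrier (presented_group S R)"
  obtains u where "u \<in> words S" "x = word_rel S R `` {u}"
  using assms by (auto simp: presented_group_def elim: quotientE)

lemma word_class_in_carrier: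
  "u \<in> words S \<Longrightarrow> word_rel S R `` {u} \<in> carrier (presented_group S R)"
  by (auto simp: presented_group_def intro: quotientI)

lemma presented_group_one: "\<one>\<^bsub>presented_group S R\<^esub> = word_rel S R `` {[]}"
  by (simp add: presented_group_def)

lemma word_left_inverse:
  "u \<in> words S \<Longrightarrow> \<exists>u'\<in>words S. word_eq S R (u' @ u) []"
proof (induction u)
  case Nil
  then show ?case by (intro bexI[of _ "[]"]) (auto simp: words_def intro: word_eq.refl)
next
  case (Cons a u)
  obtain s b where a: "a = (s, b)" by force
  with Cons have s: "s \<in> S" and u: "u \<in> words S" by (auto simp: words_def)
  with Cons obtain u' where u': "u' \<in> words S" "word_eq S R (u' @ u) []" by auto
  have "word_eq S R (u' @ [(s, \<not> b), (s, \<not> \<not> b)] @ u) (u' @ u)"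
    using u' u s by (intro word_eq.cancel)
  with u' have "word_eq S R ((u' @ [(s, \<not> b)]) @ (a # u)) []"
    using a by (auto intro: word_eq.trans)
  moreover have "u' @ [(s, \<not> b)] \<in> words S" using u' s by (auto simp: words_def)
  ultimately show ?case by blast
qed

lemma group_presented_group: "group (presented_group S R)"
proof (rule groupI)
  let ?G = "presented_group S R"
  have nil: "[] \<in> words S" by (simp add: words_def)
  have app: "u \<in> words S \<Longrightarrow> v \<in> words S \<Longrightarrow> u @ v \<in> words S" for u v :: "'a word"
    by (auto simp: words_def)
  show "x \<otimes>\<^bsub>?G\<^esub> y \<in> carrier ?G" if "x \<in> carrier ?G" "y \<in> carrier ?G" for x y
    using that
    by (elim presented_group_carrierE) (simp add: presented_group_mult app word_class_in_carrier)
  show "\<one>\<^bsub>?G\<^esub> \<in> carrier ?G"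
    by (simp add: presented_group_one nil word_class_in_carrier)
  show "x \<otimes>\<^bsub>?G\<^esub> y \<otimes>\<^bsub>?G\<^esub> z = x \<otimes>\<^bsub>?G\<^esub> (y \<otimes>\<^bsub>?G\<^esub> z)"
    if "x \<in> carrier ?G" "y \<in> carrier ?G" "z \<in> carrier ?G" for x y z
    using that by (elim presented_group_carrierE) (simp add: presented_group_mult app)
  show "\<one>\<^bsub>?G\<^esub> \<otimes>\<^bsub>?G\<^esub> x = x" if "x \<in> carrier ?G" for x
    using that
    by (elim presented_group_carrierE) (simp add: presented_group_one presented_group_mult nil)
  show "\<exists>y\<in>carrier ?G. y \<otimes>\<^bsub>?G\<^esub> x = \<one>\<^bsub>?G\<^esub>" if x: "x \<in> carrier ?G" for x
  proof -
    obtain u where u: "u \<in> words S" "x = word_rel S R `` {u}"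
      using x by (rule presented_group_carrierE)
    obtain u' where u': "u' \<in> words S" "word_eq S R (u' @ u) []"
      using word_left_inverse[OF u(1)] by blast
    have "(word_rel S R `` {u'}) \<otimes>\<^bsub>?G\<^esub> x = \<one>\<^bsub>?G\<^esub>"
      using u u' nil app by (simp add: presented_group_mult presented_group_one word_rel_class_eq)
    then show ?thesis using u'(1) word_class_in_carrier by blast
  qed
qed


section \<open>Right-angled Artin groups\<close>

text \<open>A finite simple graph is a \<^locale>\<open>pair_graph\<close>: a finite, loop-free digraph with symmetric
  arc set, so that \<open>(v, w) \<in> parcs \<Gamma>\<close> says that \<open>v\<close> and \<open>w\<close> are adjacent.\<close>

definition commutator_word :: "'s \<Rightarrow> 's \<Rightarrow> 's word"
  where "commutator_word v w = [(v, True), (w, True), (v, False), (w, False)]"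

definition RAAG :: "'v pair_pre_digraph \<Rightarrow> 'v word set monoid"
  where "RAAG \<Gamma> = presented_group (pverts \<Gamma>) {commutator_word v w |v w. (v, w) \<in> parcs \<Gamma>}"

lemma group_RAAG: "group (RAAG \<Gamma>)"
  by (simp add: RAAG_def group_presented_group)


section \<open>Outer automorphisms and their action on first homology\<close>

definition conjugation :: "('a, 'b) monoid_scheme \<Rightarrow> 'a \<Rightarrow> 'a \<Rightarrow> 'a"
  where "conjugation G g = (\<lambda>x\<in>carrier G. g \<otimes>\<^bsub>G\<^esub> x \<otimes>\<^bsub>G\<^esub> inv\<^bsub>G\<^esub> g)"

definition Inn :: "('a, 'b) monoid_scheme \<Rightarrow> ('a \<Rightarrow> 'a) set"
  where "Inn G = conjugation G ` carrier G"

definition OutGroup :: "('a, 'b) monoid_scheme \<Rightarrow> ('a \<Rightarrow> 'a) set monoid"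
  where "OutGroup G = AutoGroup G Mod Inn G"

lemma AutoGroup_simps [simp]:
  "carrier (AutoGroup G) = auto G"
  "\<one>\<^bsub>AutoGroup G\<^esub> = (\<lambda>x\<in>carrier G. x)"
  by (simp_all add: AutoGroup_def BijGroup_def)

lemma AutoGroup_mult:
  "\<phi> \<in> auto G \<Longrightarrow> \<psi> \<in> auto G \<Longrightarrow> \<phi> \<otimes>\<^bsub>AutoGroup G\<^esub> \<psi> = compose (carrier G) \<phi> \<psi>"
  by (simp add: AutoGroup_def BijGroup_def auto_def)

lemma autoD:
  assumes "\<phi> \<in> auto G"
  shows "\<phi> \<in> hom G G" "\<phi> \<in> extensional (carrier G)" "inj_on \<phi> (carrier G)"
    "\<phi> ` carrier G = carrier G"
  using assms by (auto simp: auto_def Bij_def bij_betw_def)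

lemma (in group) conjugation_auto:
  assumes g: "g \<in> carrier G"
  shows "conjugation G g \<in> auto G"
proof -
  have cancel: "inv g \<otimes> (g \<otimes> z) = z" "g \<otimes> (inv g \<otimes> z) = z" if "z \<in> carrier G" for z
    using g that by (simp_all flip: m_assoc)
  have hom: "conjugation G g \<in> hom G G"
    by (rule homI) (use g in \<open>simp_all add: conjugation_def m_assoc cancel\<close>)
  have "bij_betw (conjugation G g) (carrier G) (carrier G)"
    by (rule bij_betw_byWitness[where f' = "conjugation G (inv g)"])
      (use g in \<open>auto simp: conjugation_def m_assoc cancel\<close>)
  with hom show ?thesis by (simp add: auto_def Bij_def conjugation_def)
qed

lemma (in group) conjugation_hom: "conjugation G \<in> hom G (AutoGroup G)"
proof (rule homI)
  fix g h assume "g \<in> carrier G" "h \<in> carrier G"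
  then show "conjugation G (g \<otimes> h) = conjugation G g \<otimes>\<^bsub>AutoGroup G\<^esub> conjugation G h"
    unfolding AutoGroup_mult[OF conjugation_auto conjugation_auto, OF \<open>g \<in> carrier G\<close> \<open>h \<in> carrier G\<close>]
    by (intro ext) (simp add: compose_def conjugation_def m_assoc inv_mult_group)
qed (simp add: conjugation_auto)

lemma (in group) Inn_normal: "Inn G \<lhd> AutoGroup G"
proof -
  interpret A: group "AutoGroup G" by (rule AutoGroup)
  interpret c: group_hom G "AutoGroup G" "conjugation G"
    by unfold_locales (rule conjugation_hom)
  have "\<phi> \<otimes>\<^bsub>AutoGroup G\<^esub> conjugation G g \<otimes>\<^bsub>AutoGroup G\<^esub> inv\<^bsub>AutoGroup G\<^esub> \<phi>
      = conjugation G (\<phi> g)"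
    if \<phi>: "\<phi> \<in> auto G" and g: "g \<in> carrier G" for \<phi> g
  proof -
    interpret \<phi>: group_hom G G \<phi>
      by unfold_locales (rule autoD(1)[OF \<phi>])
    have "\<phi> \<otimes>\<^bsub>AutoGroup G\<^esub> conjugation G g = conjugation G (\<phi> g) \<otimes>\<^bsub>AutoGroup G\<^esub> \<phi>"
      unfolding AutoGroup_mult[OF \<phi> conjugation_auto[OF g]]
        AutoGroup_mult[OF conjugation_auto[OF \<phi>.hom_closed[OF g]] \<phi>]
      using g by (intro ext) (simp add: compose_def conjugation_def)
    moreover have "\<phi> \<in> carrier (AutoGroup G)" "conjugation G (\<phi> g) \<in> carrier (AutoGroup G)"
      using \<phi> g by (simp_all add: conjugation_auto)
    ultimately show ?thesis
      by (simp only: A.m_assoc A.r_inv A.r_one A.inv_closed)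
  qed
  moreover have "\<phi> g \<in> carrier G" if "\<phi> \<in> auto G" "g \<in> carrier G" for \<phi> g
    using that autoD(4) by blast
  ultimately show ?thesis
    unfolding A.normal_inv_iff Inn_def using c.img_is_subgroup by auto
qed

lemma (in group) group_OutGroup: "group (OutGroup G)"
  unfolding OutGroup_def by (rule normal.factorgroup_is_group[OF Inn_normal])

text \<open>\<open>H\<^sub>1\<close> with integer coefficients is the abelianization.\<close>

definition H1 :: "('a, 'b) monoid_scheme \<Rightarrow> 'a set monoid"
  where "H1 G = G Mod derived G (carrier G)"

text \<open>An automorphism \<open>\<phi>\<close> preserves the derived subgroup \<open>D\<close>, so the image of the coset \<open>D x\<close>
  under \<open>\<phi>\<close> is the coset \<open>D (\<phi> x)\<close>.\<close>

definition aut_H1 :: "('a, 'b) monoid_scheme \<Rightarrow> ('a \<Rightarrow> 'a) \<Rightarrow> 'a set \<Rightarrow> 'a set"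
  where "aut_H1 G \<phi> = (\<lambda>C\<in>carrier (H1 G). \<phi> ` C)"

text \<open>All representatives of an outer class induce the same map on \<open>H\<^sub>1\<close>; the homomorphism
  property is lemma \<open>out_H1_hom\<close> below.\<close>

definition out_H1 :: "('a, 'b) monoid_scheme \<Rightarrow> ('a \<Rightarrow> 'a) set \<Rightarrow> 'a set \<Rightarrow> 'a set"
  where "out_H1 G c = the_elem (aut_H1 G ` c)"

definition Torelli_Out :: "('a, 'b) monoid_scheme \<Rightarrow> ('a \<Rightarrow> 'a) set monoid"
  where "Torelli_Out G =
    (OutGroup G)\<lparr>carrier := kernel (OutGroup G) (AutoGroup (H1 G)) (out_H1 G)\<rparr>"

lemma (in group) comm_group_H1: "comm_group (H1 G)"
  using derived_quot_of_subgroup_is_comm_group[OF subgroup_self] by (simp add: H1_def)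

lemma (in group) aut_H1_coset:
  assumes \<phi>: "\<phi> \<in> auto G" and x: "x \<in> carrier G"
  shows "aut_H1 G \<phi> (derived G (carrier G) #> x) = derived G (carrier G) #> \<phi> x"
proof -
  let ?D = "derived G (carrier G)"
  interpret \<phi>: group_hom G G \<phi>
    by unfold_locales (rule autoD(1)[OF \<phi>])
  have D: "?D \<subseteq> carrier G" by (simp add: derived_in_carrier)
  have "\<phi> ` ?D = ?D"
    using \<phi>.derived_img[of "carrier G"] autoD(4)[OF \<phi>] by simp
  moreover have "\<phi> ` (?D #> x) = \<phi> ` ?D #> \<phi> x"
    using D x by (force simp: r_coset_def)
  ultimately show ?thesis
    using x by (simp add: aut_H1_def H1_def carrier_FactGroup)
qed

lemma (in group) aut_H1_hom: "aut_H1 G \<in> hom (AutoGroup G) (AutoGroup (H1 G))"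
proof -
  let ?D = "derived G (carrier G)"
  interpret D: normal ?D G by (rule derived_self_is_normal)
  have carr: "carrier (H1 G) = (\<lambda>x. ?D #> x) ` carrier G"
    by (simp add: H1_def carrier_FactGroup)
  have mult: "(?D #> x) \<otimes>\<^bsub>H1 G\<^esub> (?D #> y) = ?D #> (x \<otimes> y)"
    if "x \<in> carrier G" "y \<in> carrier G" for x y
    using that by (simp add: H1_def D.rcos_sum)
  have closed: "\<phi> x \<in> carrier G" if "\<phi> \<in> auto G" "x \<in> carrier G" for \<phi> x
    using that autoD(4) by blast
  have aut: "aut_H1 G \<phi> \<in> auto (H1 G)" if \<phi>: "\<phi> \<in> auto G" for \<phi>
  proof -
    interpret \<phi>: group_hom G G \<phi>
      by unfold_locales (rule autoD(1)[OF \<phi>])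
    have "aut_H1 G \<phi> \<in> hom (H1 G) (H1 G)"
      by (rule homI) (auto simp: carr mult aut_H1_coset[OF \<phi>])
    moreover have "inj_on (aut_H1 G \<phi>) (carrier (H1 G))"
    proof (rule inj_onI)
      fix C C' assume C: "C \<in> carrier (H1 G)" "C' \<in> carrier (H1 G)"
        and "aut_H1 G \<phi> C = aut_H1 G \<phi> C'"
      then have "\<phi> ` C = \<phi> ` C'" by (simp add: aut_H1_def)
      moreover have "C \<subseteq> carrier G" "C' \<subseteq> carrier G"
        using C D.subset by (auto simp: carr r_coset_def)
      ultimately show "C = C'"
        using inj_on_image_eq_iff[OF autoD(3)[OF \<phi>]] by blast
    qed
    moreover have "aut_H1 G \<phi> ` carrier (H1 G) = carrier (H1 G)"
    proof -
      have "aut_H1 G \<phi> ` carrier (H1 G) = (\<lambda>x. ?D #> x) ` \<phi> ` carrier G"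
        by (auto simp: carr image_image aut_H1_coset[OF \<phi>])
      then show ?thesis by (simp add: carr autoD(4)[OF \<phi>])
    qed
    ultimately show ?thesis
      by (simp add: auto_def Bij_def bij_betw_def aut_H1_def)
  qed
  show ?thesis
  proof (rule homI)
    fix \<phi> \<psi> assume "\<phi> \<in> carrier (AutoGroup G)" "\<psi> \<in> carrier (AutoGroup G)"
    then have A: "\<phi> \<in> auto G" "\<psi> \<in> auto G" by simp_all
    then have "compose (carrier G) \<phi> \<psi> \<in> auto G"
      using group.is_monoid[OF AutoGroup] monoid.m_closed[of "AutoGroup G" \<phi> \<psi>]
      by (simp add: AutoGroup_mult)
    then have "aut_H1 G (compose (carrier G) \<phi> \<psi>) C
        = compose (carrier (H1 G)) (aut_H1 G \<phi>) (aut_H1 G \<psi>) C" for C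
    proof (cases "C \<in> carrier (H1 G)")
      case True
      then obtain x where "x \<in> carrier G" "C = ?D #> x" by (auto simp: carr)
      with True A closed \<open>compose (carrier G) \<phi> \<psi> \<in> auto G\<close> show ?thesis
        by (simp add: aut_H1_coset compose_eq)
    next
      case False
      then show ?thesis by (simp add: aut_H1_def compose_def)
    qed
    then show "aut_H1 G (\<phi> \<otimes>\<^bsub>AutoGroup G\<^esub> \<psi>)
        = aut_H1 G \<phi> \<otimes>\<^bsub>AutoGroup (H1 G)\<^esub> aut_H1 G \<psi>"
      using A aut by (auto simp: AutoGroup_mult)
  qed (simp add: aut)
qed

lemma (in group) aut_H1_conjugation:
  assumes g: "g \<in> carrier G"
  shows "aut_H1 G (conjugation G g) = \<one>\<^bsub>AutoGroup (H1 G)\<^esub>"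
proof -
  let ?D = "derived G (carrier G)"
  interpret D: normal ?D G by (rule derived_self_is_normal)
  interpret H: comm_group "H1 G" by (rule comm_group_H1)
  have carr: "carrier (H1 G) = (\<lambda>x. ?D #> x) ` carrier G"
    by (simp add: H1_def carrier_FactGroup)
  have mult: "(?D #> x) \<otimes>\<^bsub>H1 G\<^esub> (?D #> y) = ?D #> (x \<otimes> y)"
    if "x \<in> carrier G" "y \<in> carrier G" for x y
    using that by (simp add: H1_def D.rcos_sum)
  have "?D #> (g \<otimes> x \<otimes> inv g) = ?D #> x" if x: "x \<in> carrier G" for x
  proof -
    have "?D #> (g \<otimes> x) = ?D #> (x \<otimes> g)"
      using H.m_comm[of "?D #> g" "?D #> x"] g x by (simp add: mult carr)
    then have "?D #> (g \<otimes> x \<otimes> inv g) = ?D #> (x \<otimes> g \<otimes> inv g)"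
      using mult[of "g \<otimes> x" "inv g"] mult[of "x \<otimes> g" "inv g"] g x by simp
    with g x show ?thesis by (simp add: m_assoc)
  qed
  then have "aut_H1 G (conjugation G g) C = (\<lambda>C\<in>carrier (H1 G). C) C" for C
    using g
    by (cases "C \<in> carrier (H1 G)")
      (auto simp: carr aut_H1_coset conjugation_auto, auto simp: conjugation_def aut_H1_def carr)
  then show ?thesis by auto
qed

lemma (in group) out_H1_coset:
  assumes \<phi>: "\<phi> \<in> auto G"
  shows "out_H1 G (Inn G #>\<^bsub>AutoGroup G\<^esub> \<phi>) = aut_H1 G \<phi>"
proof -
  interpret H: group "H1 G" using comm_group_H1 by (rule comm_group.axioms)
  interpret A: group "AutoGroup G" by (rule AutoGroup)
  interpret AH: group "AutoGroup (H1 G)" by (rule H.AutoGroup)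
  interpret a: group_hom "AutoGroup G" "AutoGroup (H1 G)" "aut_H1 G"
    by unfold_locales (rule aut_H1_hom)
  have "aut_H1 G (conjugation G g \<otimes>\<^bsub>AutoGroup G\<^esub> \<phi>) = aut_H1 G \<phi>" if g: "g \<in> carrier G" for g
  proof -
    have "aut_H1 G (conjugation G g \<otimes>\<^bsub>AutoGroup G\<^esub> \<phi>)
        = aut_H1 G (conjugation G g) \<otimes>\<^bsub>AutoGroup (H1 G)\<^esub> aut_H1 G \<phi>"
      using \<phi> conjugation_auto[OF g] by (intro a.hom_mult) auto
    also have "\<dots> = \<one>\<^bsub>AutoGroup (H1 G)\<^esub> \<otimes>\<^bsub>AutoGroup (H1 G)\<^esub> aut_H1 G \<phi>"
      by (simp only: aut_H1_conjugation[OF g])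
    also have "\<dots> = aut_H1 G \<phi>"
      using \<phi> a.hom_closed by (intro AH.l_one) auto
    finally show ?thesis .
  qed
  moreover have "Inn G #>\<^bsub>AutoGroup G\<^esub> \<phi>
      = (\<lambda>g. conjugation G g \<otimes>\<^bsub>AutoGroup G\<^esub> \<phi>) ` carrier G"
    by (auto simp: r_coset_def Inn_def)
  ultimately have "aut_H1 G ` (Inn G #>\<^bsub>AutoGroup G\<^esub> \<phi>) = (\<lambda>g. aut_H1 G \<phi>) ` carrier G"
    by (simp only: image_image cong: image_cong)
  also have "\<dots> = {aut_H1 G \<phi>}"
    by (rule image_constant) (rule one_closed)
  finally have "aut_H1 G ` (Inn G #>\<^bsub>AutoGroup G\<^esub> \<phi>) = {aut_H1 G \<phi>}" .
  then show ?thesis by (simp add: out_H1_def)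
qed

lemma (in group) out_H1_hom: "out_H1 G \<in> hom (OutGroup G) (AutoGroup (H1 G))"
proof -
  interpret A: group "AutoGroup G" by (rule AutoGroup)
  interpret N: normal "Inn G" "AutoGroup G" by (rule Inn_normal)
  note h = aut_H1_hom
  show ?thesis
  proof (rule homI)
    fix c assume "c \<in> carrier (OutGroup G)"
    then show "out_H1 G c \<in> carrier (AutoGroup (H1 G))"
      using hom_in_carrier[OF h] by (auto simp: OutGroup_def carrier_FactGroup out_H1_coset)
  next
    fix c c' assume "c \<in> carrier (OutGroup G)" "c' \<in> carrier (OutGroup G)"
    then obtain \<phi> \<psi> where *: "\<phi> \<in> auto G" "c = Inn G #>\<^bsub>AutoGroup G\<^esub> \<phi>"
      "\<psi> \<in> auto G" "c' = Inn G #>\<^bsub>AutoGroup G\<^esub> \<psi>"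
      by (auto simp: OutGroup_def carrier_FactGroup)
    moreover have "\<phi> \<otimes>\<^bsub>AutoGroup G\<^esub> \<psi> \<in> auto G"
      using A.m_closed[of \<phi> \<psi>] * by simp
    ultimately show "out_H1 G (c \<otimes>\<^bsub>OutGroup G\<^esub> c')
        = out_H1 G c \<otimes>\<^bsub>AutoGroup (H1 G)\<^esub> out_H1 G c'"
      using hom_mult[OF h, of \<phi> \<psi>] by (simp add: OutGroup_def N.rcos_sum out_H1_coset)
  qed
qed

lemma (in group) group_Torelli_Out: "group (Torelli_Out G)"
proof -
  interpret H: group "H1 G" using comm_group_H1 by (rule comm_group.axioms)
  interpret O: group "OutGroup G" by (rule group_OutGroup)
  interpret o: group_hom "OutGroup G" "AutoGroup (H1 G)" "out_H1 G"
    by (intro group_hom.intro group_hom_axioms.intro group_OutGroup H.AutoGroup out_H1_hom)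
  show ?thesis
    unfolding Torelli_Out_def
    by (rule subgroup.subgroup_is_group[OF o.subgroup_kernel group_OutGroup])
qed


section \<open>Residual torsion-free nilpotence\<close>

definition torsion_free :: "('a, 'b) monoid_scheme \<Rightarrow> bool"
  where "torsion_free G \<longleftrightarrow>
    (\<forall>x\<in>carrier G. \<forall>n::nat. n > 0 \<longrightarrow> x [^]\<^bsub>G\<^esub> n = \<one>\<^bsub>G\<^esub> \<longrightarrow> x = \<one>\<^bsub>G\<^esub>)"

primrec lower_central :: "('a, 'b) monoid_scheme \<Rightarrow> nat \<Rightarrow> 'a set"
  where
    "lower_central G 0 = carrier G"
  | "lower_central G (Suc n) = generate G
      {h \<otimes>\<^bsub>G\<^esub> g \<otimes>\<^bsub>G\<^esub> inv\<^bsub>G\<^esub> h \<otimes>\<^bsub>G\<^esub> inv\<^bsub>G\<^esub> g |h g. h \<in> lower_central G n \<and> g \<in> carrier G}"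

definition nilpotent_group :: "('a, 'b) monoid_scheme \<Rightarrow> bool"
  where "nilpotent_group G \<longleftrightarrow> group G \<and> (\<exists>n. lower_central G n = {\<one>\<^bsub>G\<^esub>})"

text \<open>HOL cannot quantify over types inside a formula, so the target ranges over groups whose
  elements have type \<open>'a set\<close>. This loses nothing: a group \<open>H\<close> of any type that is an epimorphic
  image of \<open>G\<close> is isomorphic to the quotient of \<open>G\<close> by the kernel, which has this type.\<close>

definition residually_torsion_free_nilpotent :: "('a, 'b) monoid_scheme \<Rightarrow> bool"
  where "residually_torsion_free_nilpotent G \<longleftrightarrow>
    (\<forall>x\<in>carrier G. x \<noteq> \<one>\<^bsub>G\<^esub> \<longrightarrow>
      (\<exists>(H :: 'a set monoid) f. nilpotent_group H \<and> torsion_free H \<and>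
         f \<in> epi G H \<and> f x \<noteq> \<one>\<^bsub>H\<^esub>))"

lemma lower_central_carrier: "group G \<Longrightarrow> lower_central G n \<subseteq> carrier G"
proof (induction n)
  case (Suc n)
  interpret group G by fact
  show ?case using Suc by (auto intro!: generate_incl)
qed simp

lemma lower_central_epi:
  assumes "group G" "group H" and f: "f \<in> epi G H"
  shows "lower_central H n = f ` lower_central G n"
proof -
  interpret group_hom G H f
    using assms by (auto simp: group_hom_def group_hom_axioms_def epi_def)
  have surj: "carrier H = f ` carrier G" using f by (simp add: epi_def)
  show ?thesis
  proof (induction n)
    case 0
    show ?case by (simp add: surj)
  next
    case (Suc n)
    let ?S = "{h \<otimes>\<^bsub>G\<^esub> g \<otimes>\<^bsub>G\<^esub> inv\<^bsub>G\<^esub> h \<otimes>\<^bsub>G\<^esub> inv\<^bsub>G\<^esub> g |h g. h \<in> lower_central G n \<and> g \<in> carrier G}"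
    let ?T = "{h \<otimes>\<^bsub>H\<^esub> g \<otimes>\<^bsub>H\<^esub> inv\<^bsub>H\<^esub> h \<otimes>\<^bsub>H\<^esub> inv\<^bsub>H\<^esub> g |h g. h \<in> lower_central H n \<and> g \<in> carrier H}"
    have sub: "lower_central G n \<subseteq> carrier G"
      by (rule lower_central_carrier) unfold_locales
    have comm: "f (h \<otimes>\<^bsub>G\<^esub> g \<otimes>\<^bsub>G\<^esub> inv\<^bsub>G\<^esub> h \<otimes>\<^bsub>G\<^esub> inv\<^bsub>G\<^esub> g)
        = f h \<otimes>\<^bsub>H\<^esub> f g \<otimes>\<^bsub>H\<^esub> inv\<^bsub>H\<^esub> (f h) \<otimes>\<^bsub>H\<^esub> inv\<^bsub>H\<^esub> (f g)"
      if "h \<in> carrier G" "g \<in> carrier G" for h g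
      using that by simp
    have "f ` ?S = ?T"
    proof (intro equalityI subsetI)
      fix t assume "t \<in> f ` ?S"
      then obtain h g where *: "h \<in> lower_central G n" "g \<in> carrier G"
        and t: "t = f (h \<otimes>\<^bsub>G\<^esub> g \<otimes>\<^bsub>G\<^esub> inv\<^bsub>G\<^esub> h \<otimes>\<^bsub>G\<^esub> inv\<^bsub>G\<^esub> g)"
        by blast
      have "t = f h \<otimes>\<^bsub>H\<^esub> f g \<otimes>\<^bsub>H\<^esub> inv\<^bsub>H\<^esub> (f h) \<otimes>\<^bsub>H\<^esub> inv\<^bsub>H\<^esub> (f g)"
        unfolding t by (rule comm) (use * sub in blast)+
      moreover have "f h \<in> lower_central H n" "f g \<in> carrier H"
        unfolding Suc.IH surj using * by blast+
      ultimately show "t \<in> ?T" by blast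
    next
      fix t assume "t \<in> ?T"
      then obtain h' g' where "h' \<in> lower_central H n" "g' \<in> carrier H"
        and t: "t = h' \<otimes>\<^bsub>H\<^esub> g' \<otimes>\<^bsub>H\<^esub> inv\<^bsub>H\<^esub> h' \<otimes>\<^bsub>H\<^esub> inv\<^bsub>H\<^esub> g'"
        by blast
      then obtain h g where *: "h \<in> lower_central G n" "g \<in> carrier G" "h' = f h" "g' = f g"
        unfolding Suc.IH surj by blast
      have "t = f (h \<otimes>\<^bsub>G\<^esub> g \<otimes>\<^bsub>G\<^esub> inv\<^bsub>G\<^esub> h \<otimes>\<^bsub>G\<^esub> inv\<^bsub>G\<^esub> g)"
        unfolding t *(3,4) by (rule comm[symmetric]) (use * sub in blast)+
      with * show "t \<in> f ` ?S" by blast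
    qed
    moreover have "?S \<subseteq> carrier G" using sub by auto
    ultimately show ?case using generate_img[of ?S] by simp
  qed
qed

lemma (in group) epi_target_carrier_type:
  fixes H :: "('c, 'd) monoid_scheme"
  assumes H: "nilpotent_group H" "torsion_free H"
    and f: "f \<in> epi G H" and x: "x \<in> carrier G" "f x \<noteq> \<one>\<^bsub>H\<^esub>"
  shows "\<exists>(K :: 'a set monoid) h. nilpotent_group K \<and> torsion_free K \<and>
    h \<in> epi G K \<and> h x \<noteq> \<one>\<^bsub>K\<^esub>"
proof -
  have gH: "group H" using H by (simp add: nilpotent_group_def)
  interpret f: group_hom G H f
    using f gH by (auto simp: group_hom_def group_hom_axioms_def epi_def is_group)
  define N where "N = kernel G H f"
  interpret N: normal N G unfolding N_def by (rule f.normal_kernel)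
  let ?K = "G Mod N"
  define k where "k = (\<lambda>C. the_elem (f ` C))"
  have gK: "group ?K" by (rule N.factorgroup_is_group)
  have k: "k \<in> iso ?K H"
    unfolding k_def N_def by (rule f.FactGroup_iso_set) (use f in \<open>simp add: epi_def\<close>)
  interpret k: group_hom ?K H k
    using k gK gH by (auto simp: group_hom_def group_hom_axioms_def iso_def)
  have inj: "inj_on k (carrier ?K)" using k by (simp add: iso_def bij_betw_def)
  have kone: "C = \<one>\<^bsub>?K\<^esub>" if "C \<in> carrier ?K" "k C = \<one>\<^bsub>H\<^esub>" for C
    using inj_onD[OF inj, of C "\<one>\<^bsub>?K\<^esub>"] that k.G.one_closed k.hom_one by metis
  have epi: "k \<in> epi ?K H" using k by (auto simp: iso_def epi_def bij_betw_def)
  obtain n where n: "lower_central H n = {\<one>\<^bsub>H\<^esub>}" using H by (auto simp: nilpotent_group_def)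
  have "lower_central ?K n = {\<one>\<^bsub>?K\<^esub>}"
  proof -
    have im: "k ` lower_central ?K n = {\<one>\<^bsub>H\<^esub>}"
      using lower_central_epi[OF gK gH epi, of n] n by simp
    then have "C = \<one>\<^bsub>?K\<^esub>" if "C \<in> lower_central ?K n" for C
      using that lower_central_carrier[OF gK, of n] kone by blast
    moreover have "lower_central ?K n \<noteq> {}" using im by auto
    ultimately show ?thesis by blast
  qed
  then have "nilpotent_group ?K" using gK by (auto simp: nilpotent_group_def)
  moreover have "torsion_free ?K"
    unfolding torsion_free_def
  proof (intro ballI allI impI)
    fix C and m :: nat
    assume C: "C \<in> carrier ?K" "0 < m" "C [^]\<^bsub>?K\<^esub> m = \<one>\<^bsub>?K\<^esub>"
    then have "k C [^]\<^bsub>H\<^esub> m = \<one>\<^bsub>H\<^esub>"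
      using k.hom_nat_pow[of C m] k.hom_one by metis
    then have "k C = \<one>\<^bsub>H\<^esub>"
      using H(2) C(2) k.hom_closed[OF C(1)] unfolding torsion_free_def by blast
    then show "C = \<one>\<^bsub>?K\<^esub>" by (rule kone[OF C(1)])
  qed
  moreover have "(\<lambda>a. N #> a) \<in> epi G ?K"
    using N.r_coset_hom_Mod by (auto simp: epi_def carrier_FactGroup)
  moreover have "N #> x \<noteq> \<one>\<^bsub>?K\<^esub>"
  proof
    assume "N #> x = \<one>\<^bsub>?K\<^esub>"
    then have "x \<in> N" using rcos_self[OF x(1) N.is_subgroup] by simp
    with x(2) show False unfolding N_def kernel_def by blast
  qed
  ultimately show ?thesis
    by (intro exI[of _ ?K] exI[of _ "\<lambda>a. N #> a"] conjI)
qed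

end

theory Submission
  imports Defs "HOL-Library.Function_Algebras"
begin

text \<open>Let \<open>I\<close> be the augmentation ideal of the real group algebra of \<open>G\<close>. An automorphism acting trivially
  on \<open>H\<^sub>1\<close> acts unipotently on the group algebra modulo \<open>I\<^sup>c\<close>. Those acting as conjugation by a unit of
  augmentation \<open>1\<close> form a normal subgroup \<open>N\<^sub>c\<close> containing the inner automorphisms. The quotient by
  \<open>N\<^sub>c\<close> is nilpotent because commutators act closer to the identity, and it is torsion-free because
  units of augmentation \<open>1\<close> have \<open>n\<close>-th roots modulo \<open>I\<^sup>c\<close> and unipotent operators have at most one
  unipotent \<open>n\<close>-th root. This holds for every group \<open>G\<close>.

  It remains to see that for a right-angled Artin group an automorphism \<open>\<phi>\<close> in all \<open>N\<^sub>c\<close> is inner. The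
  Magnus map \<open>v \<mapsto> 1 + v\<close> into the algebra of noncommutative power series with adjacent vertices
  commuting turns the conjugating units into series \<open>u\<close> with \<open>\<phi>(a) u = u a\<close>. Comparing traces of a
  shortest conjugate of \<open>\<phi>(v)\<close> with those of \<open>1 + v\<close> shows that \<open>\<phi>(v)\<close> is conjugate to \<open>v\<close>. A common
  conjugator for all vertices is found one vertex at a time: if \<open>\<phi>\<close> fixes the vertices in \<open>W\<close> and maps
  \<open>v\<close> to \<open>h v h\<^sup>-\<^sup>1\<close> with \<open>h\<close> shortest in its double coset for the centralizers of \<open>W\<close> and \<open>v\<close>, then
  \<open>u\<close> centralizes \<open>W\<close> and \<open>h\<^sup>-\<^sup>1 u\<close> centralizes \<open>v\<close>, and comparing the coefficients of \<open>u\<close> and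
  \<open>h (h\<^sup>-\<^sup>1 u)\<close> at the top monomial of \<open>h\<close> forces \<open>h = 1\<close>.\<close>

section \<open>Polynomial functions on a group\<close>

text \<open>The pointwise vector space structure lets \<open>linear\<close> and
  \<open>subspace\<close> speak about functions on the group and about operators on them.\<close>

instantiation "fun" :: (type, real_vector) real_vector
begin

definition scaleR_fun :: "real \<Rightarrow> ('a \<Rightarrow> 'b) \<Rightarrow> 'a \<Rightarrow> 'b"
  where "scaleR_fun r f = (\<lambda>x. r *\<^sub>R f x)"

instance
  by standard (auto simp: scaleR_fun_def fun_eq_iff algebra_simps)

end

lemma scaleR_fun_apply: "(r *\<^sub>R f) x = r *\<^sub>R f x"
  by (simp add: scaleR_fun_def)

text \<open>As simplification rules the following eta-expand functions that the simplifier should treat as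
  vectors.\<close>

lemmas fun_apply = plus_fun_apply minus_apply uminus_apply zero_fun_apply scaleR_fun_apply

declare fun_apply [simp del]

text \<open>Translates and pullbacks are extended by 0 outside the carrier, so that agreement on the
  carrier becomes equality of functions.\<close>

definition rtr :: "('a, 'b) monoid_scheme \<Rightarrow> 'a \<Rightarrow> ('a \<Rightarrow> real) \<Rightarrow> 'a \<Rightarrow> real"
  where "rtr G g f = (\<lambda>x. if x \<in> carrier G then f (x \<otimes>\<^bsub>G\<^esub> g) else 0)"

definition ltr :: "('a, 'b) monoid_scheme \<Rightarrow> 'a \<Rightarrow> ('a \<Rightarrow> real) \<Rightarrow> 'a \<Rightarrow> real"
  where "ltr G g f = (\<lambda>x. if x \<in> carrier G then f (g \<otimes>\<^bsub>G\<^esub> x) else 0)"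

definition pull :: "('a, 'b) monoid_scheme \<Rightarrow> ('a \<Rightarrow> 'a) \<Rightarrow> ('a \<Rightarrow> real) \<Rightarrow> 'a \<Rightarrow> real"
  where "pull G \<phi> f = (\<lambda>x. if x \<in> carrier G then f (\<phi> x) else 0)"

text \<open>\<open>polyf G j\<close> is the annihilator of the \<open>j\<close>-th power of the augmentation ideal of the real
  group algebra, under the pairing of functions with the group algebra.\<close>

primrec polyf :: "('a, 'b) monoid_scheme \<Rightarrow> nat \<Rightarrow> ('a \<Rightarrow> real) set"
  where
    "polyf G 0 = {0}"
  | "polyf G (Suc j) = {f. (\<forall>x. x \<notin> carrier G \<longrightarrow> f x = 0) \<and>
      (\<forall>g\<in>carrier G. rtr G g f - f \<in> polyf G j)}"

lemma linear_rtr: "linear (rtr G g)"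
  and linear_ltr: "linear (ltr G g)"
  and linear_pull: "linear (pull G \<phi>)"
  by (rule linearI; auto simp: rtr_def ltr_def pull_def fun_eq_iff fun_apply)+

lemma polyf_support: "f \<in> polyf G j \<Longrightarrow> x \<notin> carrier G \<Longrightarrow> f x = 0"
  by (cases j) (auto simp: fun_apply)

lemma subspace_polyf: "subspace (polyf G j)"
proof (induction j)
  case (Suc j)
  note IH = subspace_0[OF Suc.IH] subspace_add[OF Suc.IH] subspace_scale[OF Suc.IH]
  have add: "rtr G g (f + h) - (f + h) = (rtr G g f - f) + (rtr G g h - h)"
    and scale: "rtr G g (c *\<^sub>R f) - c *\<^sub>R f = c *\<^sub>R (rtr G g f - f)" for g f h c
    by (simp_all add: linear_add[OF linear_rtr] linear_scale[OF linear_rtr] algebra_simps)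
  show ?case
    unfolding polyf.simps
  proof (intro subspaceI CollectI conjI ballI; (elim CollectE conjE)?)
    fix f h g assume "\<forall>g\<in>carrier G. rtr G g f - f \<in> polyf G j"
      "\<forall>g\<in>carrier G. rtr G g h - h \<in> polyf G j" "g \<in> carrier G"
    then show "rtr G g (f + h) - (f + h) \<in> polyf G j"
      unfolding add by (blast intro: IH)
  next
    fix f g and c :: real assume "\<forall>g\<in>carrier G. rtr G g f - f \<in> polyf G j" "g \<in> carrier G"
    then show "rtr G g (c *\<^sub>R f) - c *\<^sub>R f \<in> polyf G j"
      unfolding scale by (blast intro: IH)
  qed (simp_all add: linear_0[OF linear_rtr] IH fun_apply(1,4,5))
qed (simp add: subspace_def)

lemmas polyf_diff = subspace_diff[OF subspace_polyf]
  and polyf_add = subspace_add[OF subspace_polyf]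
  and polyf_scale = subspace_scale[OF subspace_polyf]
  and polyf_0 = subspace_0[OF subspace_polyf]

lemma polyf_Suc_mono: "f \<in> polyf G j \<Longrightarrow> f \<in> polyf G (Suc j)"
proof (induction j arbitrary: f)
  case 0
  then have "f = 0" by simp
  then show ?case using subspace_0[OF subspace_polyf] by (simp only:)
next
  case (Suc j)
  have "rtr G g f - f \<in> polyf G (Suc j)" if "g \<in> carrier G" for g
    using Suc.IH[of "rtr G g f - f"] Suc.prems that by auto
  moreover have "\<forall>x. x \<notin> carrier G \<longrightarrow> f x = 0"
    using Suc.prems by auto
  ultimately show ?case by (subst polyf.simps(2)) blast
qed

lemma polyf_mono: "i \<le> j \<Longrightarrow> f \<in> polyf G i \<Longrightarrow> f \<in> polyf G j"
  by (induction rule: dec_induct) (auto intro: polyf_Suc_mono simp del: polyf.simps)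

text \<open>\<open>U - 1\<close> lowers the filtration by \<open>k\<close>; dually, its transpose
  raises the power of the augmentation ideal by \<open>k\<close>. Besides linearity, weight 0 only
  means that every \<open>polyf G j\<close> is preserved.\<close>

definition unip :: "('a, 'b) monoid_scheme \<Rightarrow> nat \<Rightarrow> (('a \<Rightarrow> real) \<Rightarrow> 'a \<Rightarrow> real) \<Rightarrow> bool"
  where "unip G k U \<longleftrightarrow> linear U \<and> (\<forall>j. \<forall>f\<in>polyf G (j + k). U f - f \<in> polyf G j)"

lemma unipD: "unip G k U \<Longrightarrow> f \<in> polyf G (j + k) \<Longrightarrow> U f - f \<in> polyf G j"
  by (simp add: unip_def)

lemma unip_linear: "unip G k U \<Longrightarrow> linear U"
  by (simp add: unip_def)

lemma unip_preserves:
  assumes U: "unip G k U" and f: "f \<in> polyf G j"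
  shows "U f \<in> polyf G j"
proof -
  \<comment> \<open>Truncated subtraction also covers \<open>j < k\<close>: the index is then
    \<open>k\<close>, and \<open>f\<close> lies in the larger space.\<close>
  have "f \<in> polyf G ((j - k) + k)"
    by (rule polyf_mono[OF _ f]) simp
  then have "U f - f \<in> polyf G (j - k)"
    using U by (rule unipD[rotated])
  then have "U f - f \<in> polyf G j"
    by (rule polyf_mono[rotated]) simp
  then show ?thesis
    using polyf_add[OF _ f, of "U f - f"] by simp
qed

lemma unip_le:
  assumes "unip G k U" "i \<le> k"
  shows "unip G i U"
  unfolding unip_def
proof (intro conjI allI ballI)
  fix j f assume f: "f \<in> polyf G (j + i)"
  have "f \<in> polyf G ((j + i - k) + k)"
    by (rule polyf_mono[OF _ f]) simp
  then have "U f - f \<in> polyf G (j + i - k)"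
    using assms(1) by (rule unipD[rotated])
  then show "U f - f \<in> polyf G j"
    by (rule polyf_mono[rotated]) (use assms(2) in simp)
qed (use assms in \<open>simp add: unip_def\<close>)

lemma unip_comp:
  assumes U: "unip G k U" and V: "unip G k V"
  shows "unip G k (\<lambda>f. U (V f))"
  unfolding unip_def
proof (intro conjI allI ballI)
  show "linear (\<lambda>f. U (V f))"
    using linear_compose[OF unip_linear[OF V] unip_linear[OF U]] by (simp add: o_def)
  fix j f assume f: "f \<in> polyf G (j + k)"
  have "U (V f) - V f \<in> polyf G j"
    using U unip_preserves[OF V f] by (rule unipD)
  from polyf_add[OF this unipD[OF V f]] show "U (V f) - f \<in> polyf G j"
    by simp
qed

lemma unip_ident: "unip G k (\<lambda>f. f)"
  unfolding unip_def using polyf_0 by (auto simp: linear_ident)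

lemma unip_funpow: "unip G k U \<Longrightarrow> unip G k (U ^^ n)"
  by (induction n) (simp_all add: unip_ident unip_comp o_def id_def)

text \<open>\<open>f - V f\<close> is \<open>V (U f - f)\<close>, and \<open>V\<close> preserves the
  filtration.\<close>

lemma unip_inverse:
  assumes U: "unip G k U" and V: "unip G 0 V" and inv: "\<And>j f. f \<in> polyf G j \<Longrightarrow> V (U f) = f"
  shows "unip G k V"
  unfolding unip_def
proof (intro conjI allI ballI)
  fix j f assume f: "f \<in> polyf G (j + k)"
  have "V (U f - f) \<in> polyf G j"
    using V unipD[OF U f] by (rule unip_preserves)
  then have "f - V f \<in> polyf G j"
    by (simp add: linear_diff[OF unip_linear[OF V]] inv[OF f])
  then show "V f - f \<in> polyf G j"
    using subspace_neg[OF subspace_polyf] by fastforce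
qed (rule unip_linear[OF V])

text \<open>Weights add because \<open>A B - B A\<close> equals
  \<open>(A - 1) (B - 1) - (B - 1) (A - 1)\<close>. Both sides are applied to
  \<open>h = A' (B' f)\<close>, for which \<open>B (A h)\<close> is \<open>f\<close>.\<close>

lemma unip_commutator:
  assumes A: "unip G k A" and B: "unip G l B" and A': "unip G 0 A'" and B': "unip G 0 B'"
    and invA: "\<And>j f. f \<in> polyf G j \<Longrightarrow> A (A' f) = f"
    and invB: "\<And>j f. f \<in> polyf G j \<Longrightarrow> B (B' f) = f"
  shows "unip G (k + l) (\<lambda>f. A (B (A' (B' f))))"
  unfolding unip_def
proof (intro conjI allI ballI)
  note lin = unip_linear[OF A] unip_linear[OF B] unip_linear[OF A'] unip_linear[OF B']
  show "linear (\<lambda>f. A (B (A' (B' f))))"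
    using linear_compose[OF linear_compose[OF linear_compose[OF lin(4,3)] lin(2)] lin(1)]
    by (simp add: o_def)
  fix j f assume f: "f \<in> polyf G (j + (k + l))"
  define h where "h = A' (B' f)"
  have h: "h \<in> polyf G (j + (k + l))"
    unfolding h_def by (rule unip_preserves[OF A' unip_preserves[OF B' f]])
  have "A h = B' f"
    unfolding h_def by (rule invA[OF unip_preserves[OF B' f]])
  then have BA: "B (A h) = f" using invB[OF f] by simp
  have "B h - h \<in> polyf G (j + k)" "A h - h \<in> polyf G (j + l)"
    by (rule unipD[OF B], use h in \<open>simp add: add.assoc\<close>)
       (rule unipD[OF A], use h in \<open>simp add: ac_simps\<close>)
  then have "A (B h - h) - (B h - h) \<in> polyf G j" "B (A h - h) - (A h - h) \<in> polyf G j"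
    by (auto intro: unipD[OF A] unipD[OF B])
  from polyf_diff[OF this] have "A (B h) - B (A h) \<in> polyf G j"
    by (simp add: linear_diff[OF lin(1)] linear_diff[OF lin(2)] algebra_simps)
  then show "A (B (A' (B' f))) - f \<in> polyf G j"
    unfolding BA by (simp add: h_def)
qed

text \<open>On \<open>f - g\<close>, which \<open>U\<close> kills, \<open>U - 1\<close> is negation,
  so the difference sinks one degree at a time down to \<open>polyf G 0\<close>.\<close>

lemma unip_injective:
  assumes U: "unip G 1 U" and f: "f \<in> polyf G c" and g: "g \<in> polyf G c" and eq: "U f = U g"
  shows "f = g"
proof -
  have "f - g \<in> polyf G (c - j)" if "j \<le> c" for j
    using that
  proof (induction j)
    case 0
    show ?case using polyf_diff[OF f g] by (simp only: diff_zero)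
  next
    case (Suc j)
    then have "f - g \<in> polyf G ((c - Suc j) + 1)" by (simp add: Suc_diff_Suc del: polyf.simps)
    from unipD[OF U this] have "g - f \<in> polyf G (c - Suc j)"
      by (simp add: linear_diff[OF unip_linear[OF U]] eq)
    then show ?case using subspace_neg[OF subspace_polyf] by fastforce
  qed
  from this[of c] show ?thesis by simp
qed

text \<open>Induction on the degree of \<open>f\<close>. Once \<open>C\<close> and \<open>U\<close>
  agree in lower degree, the difference of their \<open>n\<close>-th powers at \<open>f\<close> is a
  sum of \<open>n\<close> terms, each congruent to \<open>g = C f - U f\<close> modulo lower degree.
  Its vanishing pushes \<open>g\<close> down to 0.\<close>

lemma unip_root_unique:
  assumes C: "unip G 1 C" and U: "unip G 1 U" and n: "n > 0"
    and eq: "\<And>f. f \<in> polyf G c \<Longrightarrow> (C ^^ n) f = (U ^^ n) f"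
    and "f \<in> polyf G c"
  shows "C f = U f"
proof -
  note lC = linear_add[OF unip_linear[OF C]] linear_diff[OF unip_linear[OF C]]
    linear_sum[OF unip_linear[OF C]]
  note lU = linear_diff[OF unip_linear[OF U]]
  have "C f = U f" if "j \<le> c" "f \<in> polyf G j" for j f
    using that
  proof (induction j arbitrary: f)
    case 0
    then have "f = 0" by simp
    then show ?case
      by (simp only: linear_0[OF unip_linear[OF C]] linear_0[OF unip_linear[OF U]])
  next
    case (Suc j)
    define g where "g = C f - U f"
    have f: "f \<in> polyf G (j + 1)" using Suc.prems by simp
    have step: "C h - U h = 0" if "h \<in> polyf G j" for h
      using Suc that by simp
    \<comment> \<open>Telescoping: \<open>(U ^^ m) f\<close> differs from \<open>f\<close> by a
      function of lower degree, where \<open>C\<close> and \<open>U\<close> already agree, so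
      \<open>C - U\<close> takes the value \<open>g\<close> on both.\<close>
    have sum: "(C ^^ m) f - (U ^^ m) f = (\<Sum>i<m. (C ^^ i) g)" for m
    proof (induction m)
      case (Suc m)
      define h where "h = (U ^^ m) f"
      have "h - f \<in> polyf G j"
        unfolding h_def by (rule unipD[OF unip_funpow[OF U] f])
      from step[OF this] have "C h - U h = g"
        by (simp add: g_def lC lU algebra_simps)
      moreover have "(C ^^ Suc m) f - (U ^^ Suc m) f = C ((C ^^ m) f - h) + (C h - U h)"
        by (simp add: lC h_def)
      ultimately have "(C ^^ Suc m) f - (U ^^ Suc m) f = g + (\<Sum>i<m. C ((C ^^ i) g))"
        using Suc by (simp add: h_def lC)
      then show ?case
        by (simp add: sum.lessThan_Suc_shift del: sum.lessThan_Suc)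
    qed simp
    have zero: "(\<Sum>i<n. (C ^^ i) g) = 0"
      using sum[of n] eq[OF polyf_mono[OF Suc.prems]] by simp
    \<comment> \<open>Modulo \<open>polyf G k\<close> every \<open>(C ^^ i) g\<close> is
      \<open>g\<close>, so the vanishing sum puts \<open>n\<close> times \<open>g\<close> there;
      dividing by \<open>n\<close> uses the real coefficients.\<close>
    have g: "g \<in> polyf G k" if "g \<in> polyf G (k + 1)" for k
    proof -
      have "(\<Sum>i<n. (C ^^ i) g - g) \<in> polyf G k"
        by (intro subspace_sum[OF subspace_polyf] unipD[OF unip_funpow[OF C] that])
      then have "- real n *\<^sub>R g \<in> polyf G k"
        by (simp add: sum_subtractf zero sum_constant_scaleR del: sum_constant)
      from polyf_scale[OF this, of "- 1 / real n"] n show ?thesis by simp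
    qed
    have "g \<in> polyf G (Suc c - i)" if "i \<le> Suc c" for i
      using that
    proof (induction i)
      case 0
      have "g \<in> polyf G (Suc j)"
        unfolding g_def
        by (intro polyf_diff unip_preserves[OF C] unip_preserves[OF U] Suc.prems)
      then show ?case
        by (rule polyf_mono[rotated]) (use Suc.prems in simp)
    next
      case (Suc i)
      then show ?case
        using g[of "c - i"] by (simp add: Suc_diff_le del: polyf.simps)
    qed
    from this[of "Suc c"] show ?case by (simp add: g_def)
  qed
  then show ?thesis using assms by blast
qed

section \<open>Operators induced by the group algebra\<close>

text \<open>Pairs of operators \<open>f \<mapsto> f(x \<cdot>)\<close> and \<open>f \<mapsto> f(\<cdot> x)\<close> for an element \<open>x\<close> of augmentation \<open>1\<close> in
  the real group algebra, functions being extended linearly to the group algebra.\<close>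

inductive gapair :: "('a, 'b) monoid_scheme \<Rightarrow> (('a \<Rightarrow> real) \<Rightarrow> 'a \<Rightarrow> real) \<Rightarrow>
    (('a \<Rightarrow> real) \<Rightarrow> 'a \<Rightarrow> real) \<Rightarrow> bool"
  for G :: "('a, 'b) monoid_scheme"
  where
    transl: "g \<in> carrier G \<Longrightarrow> gapair G (ltr G g) (rtr G g)"
  | affine: "gapair G L R \<Longrightarrow> gapair G L1 R1 \<Longrightarrow> gapair G L2 R2 \<Longrightarrow>
      gapair G (\<lambda>f. L f + r *\<^sub>R (L1 f - L2 f)) (\<lambda>f. R f + r *\<^sub>R (R1 f - R2 f))"

text \<open>The coefficients 1, \<open>r\<close> and \<open>-r\<close> add up to 1, so subtracting
  the identity can be distributed over the three operators.\<close>

lemma unip_affine: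
  assumes "unip G k U" "unip G k V" "unip G k W"
  shows "unip G k (\<lambda>f. U f + r *\<^sub>R (V f - W f))"
  unfolding unip_def
proof (intro conjI allI ballI)
  note lin = unip_linear[OF assms(1)] unip_linear[OF assms(2)] unip_linear[OF assms(3)]
  show "linear (\<lambda>f. U f + r *\<^sub>R (V f - W f))"
    using lin by (intro linear_compose_add linear_compose_scale_right linear_compose_sub)
  fix j f assume f: "f \<in> polyf G (j + k)"
  have "(U f - f) + r *\<^sub>R ((V f - f) - (W f - f)) \<in> polyf G j"
    by (intro polyf_add polyf_scale polyf_diff unipD[OF _ f] assms)
  then show "U f + r *\<^sub>R (V f - W f) - f \<in> polyf G j"
    by (simp add: algebra_simps)
qed

lemma rtr_unip: "g \<in> carrier G \<Longrightarrow> unip G 1 (rtr G g)"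
  by (auto simp: unip_def linear_rtr)

context group
begin

lemma rtr_rtr: "g \<in> carrier G \<Longrightarrow> h \<in> carrier G \<Longrightarrow> rtr G g (rtr G h f) = rtr G (g \<otimes> h) f"
  and ltr_rtr: "g \<in> carrier G \<Longrightarrow> h \<in> carrier G \<Longrightarrow> ltr G g (rtr G h f) = rtr G h (ltr G g f)"
  by (auto simp: rtr_def ltr_def fun_eq_iff m_assoc)

lemma rtr_one: "f \<in> polyf G j \<Longrightarrow> rtr G \<one> f = f"
  and ltr_one: "f \<in> polyf G j \<Longrightarrow> ltr G \<one> f = f"
  by (auto simp: rtr_def ltr_def fun_eq_iff polyf_support)

lemma polyf_1:
  assumes "f \<in> polyf G 1" "x \<in> carrier G" "y \<in> carrier G"
  shows "f x = f y"
proof -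
  have "rtr G g f x = f x" if "g \<in> carrier G" for g
    using assms(1) that by (simp add: fun_eq_iff fun_apply)
  from this[of "inv x \<otimes> y"] show ?thesis
    using assms(2,3) by (simp add: rtr_def m_assoc[symmetric])
qed

text \<open>\<open>polyf\<close> is defined by right translations. Left translations commute with
  them, so induction leads down to degree 1, where functions are constant on the carrier.\<close>

lemma ltr_unip:
  assumes g: "g \<in> carrier G"
  shows "unip G 1 (ltr G g)"
proof -
  have "ltr G g f - f \<in> polyf G j" if "f \<in> polyf G (Suc j)" for f j
    using that
  proof (induction j arbitrary: f)
    case 0
    have "ltr G g f x = f x" for x
    proof (cases "x \<in> carrier G")
      case True
      then show ?thesis using polyf_1[of f "g \<otimes> x" x] 0 g by (simp add: ltr_def)
    qed (use polyf_support[OF 0] in \<open>simp add: ltr_def\<close>)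
    then have "ltr G g f = f" by (rule ext)
    then show ?case by simp
  next
    case (Suc j)
    have "rtr G h (ltr G g f - f) - (ltr G g f - f) \<in> polyf G j" if h: "h \<in> carrier G" for h
    proof -
      have "rtr G h f - f \<in> polyf G (Suc j)"
        using Suc.prems h by simp
      from Suc.IH[OF this] show ?thesis
        by (simp add: linear_diff[OF linear_rtr] linear_diff[OF linear_ltr] ltr_rtr[OF g h]
            algebra_simps)
    qed
    moreover have "(ltr G g f - f) x = 0" if "x \<notin> carrier G" for x
      using polyf_support[OF Suc.prems that] that by (simp add: fun_apply ltr_def)
    ultimately show ?case by simp
  qed
  then show ?thesis by (simp add: unip_def linear_ltr del: polyf.simps)
qed

lemma gapair_unip:
  assumes "gapair G L R"
  shows "unip G 1 L" "unip G 1 R"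
proof -
  have "unip G 1 L \<and> unip G 1 R"
    using assms
  proof induction
    case (transl g)
    then show ?case by (intro conjI ltr_unip rtr_unip)
  next
    case affine
    then show ?case by (intro conjI unip_affine) blast+
  qed
  then show "unip G 1 L" "unip G 1 R" by auto
qed

lemma gapair_linear:
  assumes "gapair G L R"
  shows "linear L" "linear R"
  using gapair_unip[OF assms] by (auto dest: unip_linear)

text \<open>Both sides are the value at the group algebra element itself of the linear extension of
  \<open>f\<close>.\<close>

lemma gapair_one: "gapair G L R \<Longrightarrow> L f \<one> = R f \<one>"
  by (induction rule: gapair.induct) (simp_all add: ltr_def rtr_def fun_apply)

lemma gapair_support: "gapair G L R \<Longrightarrow> x \<notin> carrier G \<Longrightarrow> L f x = 0 \<and> R f x = 0"
  by (induction rule: gapair.induct) (simp_all add: ltr_def rtr_def fun_apply)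

lemma gapair_commute:
  assumes "gapair G L R" "gapair G L' R'"
  shows "L (R' f) = R' (L f)"
  using assms(1)
proof (induction rule: gapair.induct)
  case (transl g)
  show ?case
    using assms(2) transl
    by (induction rule: gapair.induct)
      (simp_all add: ltr_rtr linear_add[OF linear_ltr] linear_diff[OF linear_ltr]
        linear_scale[OF linear_ltr])
next
  case affine
  note lin = gapair_linear(2)[OF assms(2)]
  from affine show ?case by (simp add: linear_add[OF lin] linear_diff[OF lin] linear_scale[OF lin])
qed

text \<open>If the pairs belong to \<open>x\<close> and \<open>y\<close>, the composite belongs to
  \<open>x y\<close>; acting on functions reverses the order of the left operators.\<close>

lemma gapair_comp:
  assumes "gapair G L R" "gapair G L' R'"
  shows "gapair G (\<lambda>f. L' (L f)) (\<lambda>f. R (R' f))"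
  using assms(1)
proof (induction rule: gapair.induct)
  case (transl g)
  from assms(2) show ?case
  proof (induction rule: gapair.induct)
    case (transl h)
    then have "ltr G h (ltr G g f) = ltr G (g \<otimes> h) f" "rtr G g (rtr G h f) = rtr G (g \<otimes> h) f" for f
      using \<open>g \<in> carrier G\<close> by (auto simp: ltr_def rtr_def m_assoc)
    then show ?case
      using gapair.transl[of "g \<otimes> h" G] transl \<open>g \<in> carrier G\<close> by simp
  next
    case affine
    from gapair.affine[OF affine.IH] show ?case
      by (simp add: linear_add[OF linear_rtr] linear_diff[OF linear_rtr] linear_scale[OF linear_rtr])
  qed
next
  case affine
  note lin = gapair_linear(1)[OF assms(2)]
  from gapair.affine[OF affine.IH] show ?case
    by (simp add: linear_add[OF lin] linear_diff[OF lin] linear_scale[OF lin])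
qed

lemma gapair_funpow:
  assumes "gapair G L R" "n > 0"
  shows "gapair G (L ^^ n) (R ^^ n)"
  using assms(2)
proof (induction n rule: nat_induct_non_zero)
  case (Suc n)
  from gapair_comp[OF Suc.IH assms(1)] show ?case
    by (simp add: o_def funpow_swap1)
qed (use assms in simp)

text \<open>Modulo a power of the augmentation ideal, left and right multiplication by \<open>x\<close> both determine
  \<open>x\<close>: evaluate at the unit after a translation.\<close>

lemma gapair_transfer:
  assumes LR: "gapair G L R" "gapair G L' R'"
    and eq: "\<And>f. f \<in> polyf G c \<Longrightarrow> L f = L' f"
    and f: "f \<in> polyf G c"
  shows "R f = R' f"
proof
  fix x
  show "R f x = R' f x"
  proof (cases "x \<in> carrier G")
    case True
    note T = gapair.transl[OF True]
    have *: "R'' f x = L'' (ltr G x f) \<one>" if "gapair G L'' R''" for L'' R''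
    proof -
      have "R'' f x = ltr G x (R'' f) \<one>" using True by (simp add: ltr_def)
      also have "\<dots> = L'' (ltr G x f) \<one>"
        by (simp add: gapair_commute[OF T that] gapair_one[OF that])
      finally show ?thesis .
    qed
    show ?thesis
      unfolding *[OF LR(1)] *[OF LR(2)]
      using eq[OF unip_preserves[OF ltr_unip[OF True] f]] by simp
  qed (use gapair_support LR in metis)
qed

text \<open>If \<open>y\<close> is a right inverse of \<open>x\<close> modulo one power of the
  augmentation ideal, then \<open>y + 1 - x y\<close> is one modulo the next power: its error is
  \<open>(1 - x) (1 - x y)\<close>.\<close>

lemma gapair_inverse:
  assumes LR: "gapair G L R"
  obtains L' R' where "gapair G L' R'"
    "\<And>f. f \<in> polyf G c \<Longrightarrow> L' (L f) = f" "\<And>f. f \<in> polyf G c \<Longrightarrow> L (L' f) = f"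
    "\<And>f. f \<in> polyf G c \<Longrightarrow> R' (R f) = f" "\<And>f. f \<in> polyf G c \<Longrightarrow> R (R' f) = f"
proof -
  note one = gapair.transl[OF one_closed]
  have "\<exists>L' R'. gapair G L' R' \<and> (\<forall>f\<in>polyf G c. L' (L f) = f)"
  proof (induction c)
    case 0
    show ?case
      using one by (auto simp: linear_0[OF gapair_linear(1)[OF LR]] linear_0[OF linear_ltr])
  next
    case (Suc c)
    then obtain V W where VW: "gapair G V W" and V: "\<And>f. f \<in> polyf G c \<Longrightarrow> V (L f) = f" by blast
    note lin = gapair_linear(1)[OF VW] gapair_linear(1)[OF LR]
    let ?V = "\<lambda>f. V f + 1 *\<^sub>R (ltr G \<one> f - V (L f))"
    have "?V (L f) = f" if f: "f \<in> polyf G (Suc c)" for f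
    proof -
      have "L f - f \<in> polyf G c"
        by (rule unipD[OF gapair_unip(1)[OF LR]]) (use f in simp)
      from V[OF this] have "V (L (L f)) - V (L f) = L f - f"
        by (simp add: linear_diff[OF lin(1)] linear_diff[OF lin(2)])
      moreover have "ltr G \<one> (L f) = L f"
        by (rule ltr_one[OF unip_preserves[OF gapair_unip(1)[OF LR] f]])
      ultimately show ?thesis by (simp add: algebra_simps)
    qed
    moreover have "gapair G ?V (\<lambda>f. W f + 1 *\<^sub>R (rtr G \<one> f - R (W f)))"
      by (rule gapair.affine[OF VW one gapair_comp[OF LR VW]])
    ultimately show ?case by blast
  qed
  then obtain L' R' where L'R': "gapair G L' R'" and L': "\<And>f. f \<in> polyf G c \<Longrightarrow> L' (L f) = f"
    by blast
  note U = gapair_unip(1)[OF LR] gapair_unip(1)[OF L'R']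
  \<comment> \<open>\<open>L'\<close> maps \<open>L (L' f)\<close> and \<open>f\<close> to the same
    function and is injective on \<open>polyf G c\<close>.\<close>
  have L: "L (L' f) = f" if f: "f \<in> polyf G c" for f
    by (rule unip_injective[OF U(2) _ f])
      (intro unip_preserves[OF U(1)] unip_preserves[OF U(2)] f L')+
  have "R (R' f) = f" if f: "f \<in> polyf G c" for f
    using gapair_transfer[OF gapair_comp[OF LR L'R'] one _ f] L' by (simp add: ltr_one rtr_one[OF f])
  moreover have "R' (R f) = f" if f: "f \<in> polyf G c" for f
    using gapair_transfer[OF gapair_comp[OF L'R' LR] one _ f] L by (simp add: ltr_one rtr_one[OF f])
  ultimately show thesis using that L'R' L L' by blast
qed

text \<open>Lifting as in Hensel's lemma: a root \<open>V\<close> in degree \<open>c\<close> is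
  corrected by \<open>1 / n\<close> times the error \<open>L - V ^^ n\<close>. In degree
  \<open>c + 1\<close> the error has constant values; on constants it vanishes and \<open>V\<close>
  is the identity, so the correction enters powers linearly.\<close>

lemma gapair_root:
  assumes LR: "gapair G L R" and n: "n > 0"
  obtains L' R' where "gapair G L' R'"
    "\<And>f. f \<in> polyf G c \<Longrightarrow> (L' ^^ n) f = L f" "\<And>f. f \<in> polyf G c \<Longrightarrow> (R' ^^ n) f = R f"
proof -
  have "\<exists>L' R'. gapair G L' R' \<and> (\<forall>f\<in>polyf G c. (L' ^^ n) f = L f)"
  proof (induction c)
    case 0
    have "(L ^^ n) 0 = L 0"
      using linear_0 gapair_linear(1)[OF LR] gapair_linear(1)[OF gapair_funpow[OF LR n]] by metis
    with LR show ?case by auto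
  next
    case (Suc c)
    then obtain V W where VW: "gapair G V W" and V: "\<And>f. f \<in> polyf G c \<Longrightarrow> (V ^^ n) f = L f"
      by blast
    note P = gapair_funpow[OF VW n]
    note lin = gapair_linear(1)[OF VW] gapair_linear(1)[OF LR] gapair_linear(1)[OF P]
    note U = gapair_unip(1)[OF VW] gapair_unip(1)[OF LR] gapair_unip(1)[OF P]
    define D where "D f = L f - (V ^^ n) f" for f
    have linD: "linear D"
      unfolding D_def using lin by (intro linear_compose_sub)
    have D0: "D f = 0" if "f \<in> polyf G c" for f
      using V[OF that] by (simp add: D_def)
    have fix1: "T f = f" if "unip G 1 T" "f \<in> polyf G 1" for T f
      using unipD[OF that(1), of f 0] that(2) by simp
    \<comment> \<open>\<open>D\<close> commutes with right translations and kills
      \<open>polyf G c\<close>, so \<open>D f\<close> is invariant under them.\<close>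
    have D1: "D f \<in> polyf G 1" if f: "f \<in> polyf G (Suc c)" for f
    proof -
      have "rtr G g (D f) - D f = 0" if g: "g \<in> carrier G" for g
      proof -
        note T = gapair.transl[OF g]
        have "rtr G g (D f) = D (rtr G g f)"
          unfolding D_def linear_diff[OF linear_rtr]
          by (simp only: gapair_commute[OF LR T] gapair_commute[OF P T])
        then have "rtr G g (D f) - D f = D (rtr G g f - f)"
          by (simp add: linear_diff[OF linD])
        also have "\<dots> = 0" using f g by (intro D0) simp
        finally show ?thesis .
      qed
      moreover have "D f x = 0" if "x \<notin> carrier G" for x
        using gapair_support[OF LR that] gapair_support[OF P that] by (simp add: D_def fun_apply)
      ultimately show ?thesis by simp
    qed
    let ?V = "\<lambda>f. V f + (1 / real n) *\<^sub>R (L f - (V ^^ n) f)"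
    have pair: "gapair G ?V (\<lambda>f. W f + (1 / real n) *\<^sub>R (R f - (W ^^ n) f))"
      by (rule gapair.affine[OF VW LR P])
    define Z where "Z = (\<lambda>f. V f + (1 / real n) *\<^sub>R D f)"
    have "(Z ^^ m) f = (V ^^ m) f + (real m / real n) *\<^sub>R D f" if f: "f \<in> polyf G (Suc c)" for m f
    proof (induction m)
      case (Suc m)
      have "V (D f) = D f" by (rule fix1[OF U(1) D1[OF f]])
      moreover have "D (D f) = 0"
        using fix1[OF U(2) D1[OF f]] fix1[OF U(3) D1[OF f]] by (simp add: D_def[of "D f"])
      moreover have "D ((V ^^ m) f - f) = 0"
        by (intro D0 unipD[OF unip_funpow[OF U(1)]]) (use f in simp)
      then have "D ((V ^^ m) f) = D f"
        by (simp add: linear_diff[OF linD])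
      ultimately have "(Z ^^ Suc m) f = V ((V ^^ m) f) + (real m / real n) *\<^sub>R D f
          + (1 / real n) *\<^sub>R D f"
        unfolding funpow.simps o_apply Suc.IH
        by (simp add: Z_def linear_add[OF lin(1)] linear_scale[OF lin(1)] linear_add[OF linD]
            linear_scale[OF linD])
      then show ?case by (simp add: scaleR_add_left[symmetric] add_divide_distrib add.assoc add.commute)
    qed simp
    from this[of _ n] n have "(Z ^^ n) f = L f" if "f \<in> polyf G (Suc c)" for f
      using that by (simp add: D_def)
    then have "(?V ^^ n) f = L f" if "f \<in> polyf G (Suc c)" for f
      using that by (simp add: Z_def D_def)
    with pair show ?case by blast
  qed
  then obtain L' R' where *: "gapair G L' R'" "\<And>f. f \<in> polyf G c \<Longrightarrow> (L' ^^ n) f = L f" by blast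
  show thesis
    by (rule that[OF *]) (assumption, rule gapair_transfer[OF gapair_funpow[OF *(1) n] LR *(2)])
qed

end

section \<open>Automorphisms acting trivially on homology\<close>

definition IA :: "('a, 'b) monoid_scheme \<Rightarrow> ('a \<Rightarrow> 'a) set"
  where "IA G = kernel (AutoGroup G) (AutoGroup (H1 G)) (aut_H1 G)"

definition IA_group :: "('a, 'b) monoid_scheme \<Rightarrow> ('a \<Rightarrow> 'a) monoid"
  where "IA_group G = (AutoGroup G)\<lparr>carrier := IA G\<rparr>"

text \<open>The automorphisms \<open>\<phi>\<close> that act on the group algebra modulo the \<open>c\<close>-th power of the augmentation
  ideal as conjugation by an element \<open>x\<close> of augmentation \<open>1\<close>, that is, \<open>\<phi>(a) x = x a\<close>.\<close>

definition unit_inner :: "('a, 'b) monoid_scheme \<Rightarrow> nat \<Rightarrow> ('a \<Rightarrow> 'a) set"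
  where "unit_inner G c = {\<phi> \<in> IA G. \<exists>L R. gapair G L R \<and>
    (\<forall>f\<in>polyf G c. pull G \<phi> (R f) = L f)}"

context group
begin

text \<open>Dually, \<open>d - 1\<close> lies in the square of the augmentation ideal: translations
  have weight 1 and weights add under commutators.\<close>

lemma derived_rtr_unip:
  assumes "d \<in> derived G (carrier G)"
  shows "unip G 2 (rtr G d)"
proof -
  have rtr_inv: "rtr G a (rtr G (inv a) f) = f" "rtr G (inv a) (rtr G a f) = f"
    if "a \<in> carrier G" "f \<in> polyf G j" for a f j
    using that by (simp_all add: rtr_rtr rtr_one)
  have rtr_0: "unip G 0 (rtr G a)" if "a \<in> carrier G" for a
    by (rule unip_le[OF rtr_unip[OF that]]) simp
  have "d \<in> carrier G \<and> unip G 2 (rtr G d)"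
    using assms unfolding derived_def
  proof (induction rule: generate.induct)
    case one
    have "rtr G \<one> f - f \<in> polyf G j" if "f \<in> polyf G (j + 2)" for f j
      using rtr_one[OF that] polyf_0 by simp
    then show ?case by (simp add: unip_def linear_rtr)
  next
    have comm: "h \<in> carrier G \<and> unip G 2 (rtr G h)"
      if h_in: "h \<in> (\<Union>h1\<in>carrier G. \<Union>h2\<in>carrier G. {h1 \<otimes> h2 \<otimes> inv h1 \<otimes> inv h2})" for h
    proof -
      obtain a b where ab: "a \<in> carrier G" "b \<in> carrier G" and h: "h = a \<otimes> b \<otimes> inv a \<otimes> inv b"
        using h_in by auto
      have "unip G (1 + 1) (\<lambda>f. rtr G a (rtr G b (rtr G (inv a) (rtr G (inv b) f))))"
        using ab by (intro unip_commutator[OF rtr_unip[OF ab(1)] rtr_unip[OF ab(2)] rtr_0 rtr_0]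
            rtr_inv(1)) simp_all
      with ab show ?thesis by (simp add: h rtr_rtr m_assoc numeral_2_eq_2)
    qed
    {
      case (incl h)
      then show ?case by (rule comm)
    next
      case (inv h)
      have h: "h \<in> carrier G" "unip G 2 (rtr G h)" using comm[OF inv] by blast+
      have "unip G 2 (rtr G (inv h))"
        by (rule unip_inverse[OF h(2) rtr_0 rtr_inv(2)]) (use h(1) in simp_all)
      with h(1) show ?case by simp
    }
  next
    case (eng h1 h2)
    then show ?case
      using unip_comp[of G 2 "rtr G h1" "rtr G h2"] by (simp add: rtr_rtr)
  qed
  then show ?thesis ..
qed

lemma unit_inner_IA: "\<phi> \<in> unit_inner G c \<Longrightarrow> \<phi> \<in> IA G"
  by (simp add: unit_inner_def)

lemma IA_auto: "\<phi> \<in> IA G \<Longrightarrow> \<phi> \<in> auto G"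
  by (simp add: IA_def kernel_def)

lemma auto_closed: "\<phi> \<in> auto G \<Longrightarrow> x \<in> carrier G \<Longrightarrow> \<phi> x \<in> carrier G"
  using autoD(4) by blast

lemma auto_mult: "\<phi> \<in> auto G \<Longrightarrow> x \<in> carrier G \<Longrightarrow> y \<in> carrier G \<Longrightarrow> \<phi> (x \<otimes> y) = \<phi> x \<otimes> \<phi> y"
  using autoD(1) hom_mult by metis

lemma IA_derived:
  assumes \<phi>: "\<phi> \<in> IA G" and x: "x \<in> carrier G"
  obtains d where "d \<in> derived G (carrier G)" "\<phi> x = d \<otimes> x"
proof -
  let ?D = "derived G (carrier G)"
  interpret D: normal ?D G by (rule derived_self_is_normal)
  have "?D #> \<phi> x = aut_H1 G \<phi> (?D #> x)"
    using aut_H1_coset[OF IA_auto[OF \<phi>] x] by simp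
  also have "\<dots> = ?D #> x"
    using \<phi> x by (simp add: IA_def kernel_def H1_def carrier_FactGroup)
  finally have "\<phi> x \<in> ?D #> x"
    using rcos_self[OF auto_closed[OF IA_auto[OF \<phi>] x] D.is_subgroup] by simp
  then show thesis using that by (auto simp: r_coset_def)
qed

lemma pull_rtr:
  assumes "\<phi> \<in> auto G" "g \<in> carrier G"
  shows "rtr G g (pull G \<phi> f) = pull G \<phi> (rtr G (\<phi> g) f)"
    "ltr G g (pull G \<phi> f) = pull G \<phi> (ltr G (\<phi> g) f)"
  using assms by (auto simp: rtr_def ltr_def pull_def fun_eq_iff auto_mult auto_closed)

lemma pull_unip:
  assumes \<phi>: "\<phi> \<in> IA G"
  shows "unip G 1 (pull G \<phi>)"
proof -
  note aut = IA_auto[OF \<phi>]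
  have "pull G \<phi> f - f \<in> polyf G j" if "f \<in> polyf G (Suc j)" for f j
    using that
  proof (induction j arbitrary: f)
    case 0
    have "pull G \<phi> f x = f x" for x
    proof (cases "x \<in> carrier G")
      case True
      then show ?thesis using polyf_1[of f "\<phi> x" x] 0 by (simp add: pull_def auto_closed[OF aut])
    qed (use polyf_support[OF 0] in \<open>simp add: pull_def\<close>)
    then have "pull G \<phi> f = f" by (rule ext)
    then show ?case by simp
  next
    case (Suc j)
    have "rtr G g (pull G \<phi> f - f) - (pull G \<phi> f - f) \<in> polyf G j" if g: "g \<in> carrier G" for g
    proof -
      obtain d where d: "d \<in> derived G (carrier G)" "\<phi> g = d \<otimes> g"
        using IA_derived[OF \<phi> g] .
      have dG: "d \<in> carrier G"
        using derived_in_carrier[of "carrier G"] d(1) by auto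
      \<comment> \<open>The difference to be estimated is \<open>pull G \<phi> h - h\<close> plus
        the difference of the translates of \<open>f\<close> by \<open>\<phi> g\<close> and by
        \<open>g\<close>. Induction handles the first; the second drops by two degrees because
        \<open>d\<close> is in the derived subgroup.\<close>
      define h where "h = rtr G (\<phi> g) f - f"
      have "h \<in> polyf G (Suc j)"
        unfolding h_def using Suc.prems auto_closed[OF aut g] by simp
      moreover have "rtr G d (rtr G g f) - rtr G g f \<in> polyf G j"
        by (rule unipD[OF derived_rtr_unip[OF d(1)] unip_preserves[OF rtr_unip[OF g]]])
          (use Suc.prems in \<open>simp add: numeral_2_eq_2\<close>)
      ultimately have "(pull G \<phi> h - h) + (rtr G d (rtr G g f) - rtr G g f) \<in> polyf G j"
        by (intro polyf_add Suc.IH)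
      moreover have "rtr G d (rtr G g f) = rtr G (\<phi> g) f"
        using d(2) dG g by (simp add: rtr_rtr)
      ultimately show ?thesis
        by (simp add: h_def linear_diff[OF linear_rtr] linear_diff[OF linear_pull]
            pull_rtr[OF aut g] algebra_simps)
    qed
    moreover have "(pull G \<phi> f - f) x = 0" if "x \<notin> carrier G" for x
      using polyf_support[OF Suc.prems that] that by (simp add: fun_apply pull_def)
    ultimately show ?case by simp
  qed
  then show ?thesis by (simp add: unip_def linear_pull del: polyf.simps)
qed

section \<open>The group of automorphisms trivial on homology and its normal subgroups
  \<open>unit_inner G c\<close>\<close>

lemma subgroup_IA: "subgroup (IA G) (AutoGroup G)"
proof -
  interpret H: group "H1 G" using comm_group_H1 by (rule comm_group.axioms)
  have "group_hom (AutoGroup G) (AutoGroup (H1 G)) (aut_H1 G)"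
    by (intro group_hom.intro group_hom_axioms.intro AutoGroup H.AutoGroup aut_H1_hom)
  then show ?thesis unfolding IA_def by (rule group_hom.subgroup_kernel)
qed

lemma group_IA_group: "group (IA_group G)"
  unfolding IA_group_def
  by (rule subgroup.subgroup_is_group[OF subgroup_IA AutoGroup])

lemma carrier_IA_group [simp]: "carrier (IA_group G) = IA G"
  by (simp add: IA_group_def)

lemma IA_group_one: "\<one>\<^bsub>IA_group G\<^esub> = (\<lambda>x\<in>carrier G. x)"
  by (simp add: IA_group_def)

lemma pull_mult:
  "\<phi> \<in> IA G \<Longrightarrow> \<psi> \<in> IA G \<Longrightarrow> pull G (\<phi> \<otimes>\<^bsub>IA_group G\<^esub> \<psi>) f = pull G \<psi> (pull G \<phi> f)"
  using IA_auto auto_closed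
  by (auto simp: IA_group_def AutoGroup_mult pull_def compose_def fun_eq_iff)

lemma pull_one: "f \<in> polyf G j \<Longrightarrow> pull G (\<one>\<^bsub>IA_group G\<^esub>) f = f"
  by (auto simp: pull_def fun_eq_iff polyf_support IA_group_one)

lemma conjugation_IA: "g \<in> carrier G \<Longrightarrow> conjugation G g \<in> IA G"
  using aut_H1_conjugation by (simp add: IA_def kernel_def conjugation_auto)

lemma conjugation_unit_inner:
  assumes g: "g \<in> carrier G"
  shows "conjugation G g \<in> unit_inner G c"
proof -
  have "pull G (conjugation G g) (rtr G g f) = ltr G g f" for f
    using g by (auto simp: pull_def conjugation_def ltr_def rtr_def m_assoc fun_eq_iff)
  with gapair.transl[OF g] conjugation_IA[OF g] show ?thesis
    by (auto simp: unit_inner_def)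
qed

text \<open>The new pair belongs to the image of the given element under the linear extension of
  \<open>\<phi>\<close> to the group algebra.\<close>

lemma gapair_pull:
  assumes \<phi>: "\<phi> \<in> auto G" and "gapair G L R"
  shows "\<exists>L' R'. gapair G L' R' \<and> (\<forall>f. pull G \<phi> (L' f) = L (pull G \<phi> f)) \<and>
    (\<forall>f. pull G \<phi> (R' f) = R (pull G \<phi> f))"
  using assms(2)
proof induction
  case (transl g)
  then show ?case
    using gapair.transl[OF auto_closed[OF \<phi> transl]] pull_rtr[OF \<phi> transl]
    by (intro exI[of _ "ltr G (\<phi> g)"] exI[of _ "rtr G (\<phi> g)"]) simp
next
  case (affine L R L1 R1 L2 R2 r)
  then obtain L' R' L1' R1' L2' R2' where
    "gapair G L' R'" "gapair G L1' R1'" "gapair G L2' R2'" and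
    *: "\<And>f. pull G \<phi> (L' f) = L (pull G \<phi> f)" "\<And>f. pull G \<phi> (R' f) = R (pull G \<phi> f)"
      "\<And>f. pull G \<phi> (L1' f) = L1 (pull G \<phi> f)" "\<And>f. pull G \<phi> (R1' f) = R1 (pull G \<phi> f)"
      "\<And>f. pull G \<phi> (L2' f) = L2 (pull G \<phi> f)" "\<And>f. pull G \<phi> (R2' f) = R2 (pull G \<phi> f)"
    by blast
  from gapair.affine[OF this(1-3), of r] show ?case
    by (intro exI conjI allI, assumption)
      (simp_all only: * linear_add[OF linear_pull] linear_diff[OF linear_pull]
        linear_scale[OF linear_pull])
qed

text \<open>Inverses and products of conjugating elements conjugate for the inverse and product
  automorphisms; inverses exist modulo each power of the ideal by
  \<open>gapair_inverse\<close>.\<close>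

lemma subgroup_unit_inner: "subgroup (unit_inner G c) (IA_group G)"
proof -
  interpret T: group "IA_group G" by (rule group_IA_group)
  show ?thesis
  proof (rule T.subgroupI)
    show "unit_inner G c \<subseteq> carrier (IA_group G)"
      by (auto simp: unit_inner_def)
    show "unit_inner G c \<noteq> {}"
      using conjugation_unit_inner[OF one_closed] by blast
  next
    fix \<phi> assume "\<phi> \<in> unit_inner G c"
    then obtain L R where \<phi>: "\<phi> \<in> IA G" and LR: "gapair G L R"
      and eq: "\<And>f. f \<in> polyf G c \<Longrightarrow> pull G \<phi> (R f) = L f"
      by (auto simp: unit_inner_def)
    obtain L' R' where L'R': "gapair G L' R'"
      and inv: "\<And>f. f \<in> polyf G c \<Longrightarrow> L (L' f) = f" "\<And>f. f \<in> polyf G c \<Longrightarrow> R (R' f) = f"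
      using gapair_inverse[OF LR] by metis
    note U = gapair_unip[OF L'R']
    have "pull G (inv\<^bsub>IA_group G\<^esub> \<phi>) (R' f) = L' f" if f: "f \<in> polyf G c" for f
    proof -
      have "pull G \<phi> (L' f) = pull G \<phi> (L' (R (R' f)))"
        by (simp add: inv(2)[OF f])
      also have "\<dots> = pull G \<phi> (R (L' (R' f)))"
        by (simp add: gapair_commute[OF L'R' LR])
      also have "\<dots> = L (L' (R' f))"
        by (intro eq unip_preserves[OF U(1)] unip_preserves[OF U(2)] f)
      also have "\<dots> = R' f"
        by (intro inv(1) unip_preserves[OF U(2)] f)
      finally have "pull G (inv\<^bsub>IA_group G\<^esub> \<phi>) (R' f)
          = pull G (\<phi> \<otimes>\<^bsub>IA_group G\<^esub> inv\<^bsub>IA_group G\<^esub> \<phi>) (L' f)"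
        using \<phi> T.inv_closed[of \<phi>] by (subst pull_mult) simp_all
      also have "\<dots> = L' f"
        using T.r_inv[of \<phi>] \<phi> pull_one[OF unip_preserves[OF U(1) f]] by simp
      finally show ?thesis .
    qed
    with L'R' show "inv\<^bsub>IA_group G\<^esub> \<phi> \<in> unit_inner G c"
      using \<phi> T.inv_closed[of \<phi>] by (auto simp: unit_inner_def)
  next
    fix \<phi> \<psi> assume "\<phi> \<in> unit_inner G c" "\<psi> \<in> unit_inner G c"
    then obtain L R L' R' where \<phi>: "\<phi> \<in> IA G" "\<psi> \<in> IA G"
      and LR: "gapair G L R" "gapair G L' R'"
      and eq: "\<And>f. f \<in> polyf G c \<Longrightarrow> pull G \<phi> (R f) = L f"
        "\<And>f. f \<in> polyf G c \<Longrightarrow> pull G \<psi> (R' f) = L' f"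
      by (auto simp: unit_inner_def)
    have "pull G (\<phi> \<otimes>\<^bsub>IA_group G\<^esub> \<psi>) (R (R' f)) = L' (L f)" if f: "f \<in> polyf G c" for f
      using eq(1)[OF unip_preserves[OF gapair_unip(2)[OF LR(2)] f]]
        eq(2)[OF unip_preserves[OF gapair_unip(1)[OF LR(1)] f]]
      by (simp add: pull_mult[OF \<phi>] gapair_commute[OF LR])
    with gapair_comp[OF LR] show "\<phi> \<otimes>\<^bsub>IA_group G\<^esub> \<psi> \<in> unit_inner G c"
      using \<phi> T.m_closed[of \<phi> \<psi>] by (auto simp: unit_inner_def)
  qed
qed

text \<open>If \<open>\<phi>\<close> is conjugation by \<open>x\<close>, then its conjugate by
  \<open>\<chi>\<close> is conjugation by \<open>\<chi>(x)\<close>, which \<open>gapair_pull\<close>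
  supplies.\<close>

lemma normal_unit_inner: "unit_inner G c \<lhd> IA_group G"
proof -
  interpret T: group "IA_group G" by (rule group_IA_group)
  have "\<chi> \<otimes>\<^bsub>IA_group G\<^esub> \<phi> \<otimes>\<^bsub>IA_group G\<^esub> inv\<^bsub>IA_group G\<^esub> \<chi> \<in> unit_inner G c"
    if \<chi>: "\<chi> \<in> IA G" and "\<phi> \<in> unit_inner G c" for \<chi> \<phi>
  proof -
    obtain L R where \<phi>: "\<phi> \<in> IA G" and LR: "gapair G L R"
      and eq: "\<And>f. f \<in> polyf G c \<Longrightarrow> pull G \<phi> (R f) = L f"
      using \<open>\<phi> \<in> unit_inner G c\<close> by (auto simp: unit_inner_def)
    obtain L' R' where L'R': "gapair G L' R'" "\<And>f. pull G \<chi> (L' f) = L (pull G \<chi> f)"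
      "\<And>f. pull G \<chi> (R' f) = R (pull G \<chi> f)"
      using gapair_pull[OF IA_auto[OF \<chi>] LR] by blast
    have inv: "inv\<^bsub>IA_group G\<^esub> \<chi> \<in> IA G" using T.inv_closed[of \<chi>] \<chi> by simp
    have \<chi>\<phi>: "\<chi> \<otimes>\<^bsub>IA_group G\<^esub> \<phi> \<in> IA G" using T.m_closed[of \<chi> \<phi>] \<chi> \<phi> by simp
    have "pull G (\<chi> \<otimes>\<^bsub>IA_group G\<^esub> \<phi> \<otimes>\<^bsub>IA_group G\<^esub> inv\<^bsub>IA_group G\<^esub> \<chi>) (R' f) = L' f"
      if f: "f \<in> polyf G c" for f
    proof -
      have "pull G (\<chi> \<otimes>\<^bsub>IA_group G\<^esub> \<phi> \<otimes>\<^bsub>IA_group G\<^esub> inv\<^bsub>IA_group G\<^esub> \<chi>) (R' f)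
          = pull G (inv\<^bsub>IA_group G\<^esub> \<chi>) (pull G \<phi> (R (pull G \<chi> f)))"
        by (simp add: pull_mult[OF \<chi>\<phi> inv] pull_mult[OF \<chi> \<phi>] L'R'(3))
      also have "\<dots> = pull G (inv\<^bsub>IA_group G\<^esub> \<chi>) (pull G \<chi> (L' f))"
        by (simp add: eq[OF unip_preserves[OF pull_unip[OF \<chi>] f]] L'R'(2))
      also have "\<dots> = pull G (\<one>\<^bsub>IA_group G\<^esub>) (L' f)"
        using pull_mult[OF \<chi> inv] T.r_inv[of \<chi>] \<chi> by simp
      also have "\<dots> = L' f"
        by (rule pull_one[OF unip_preserves[OF gapair_unip(1)[OF L'R'(1)] f]])
      finally show ?thesis .
    qed
    with L'R'(1) show ?thesis
      using T.m_closed[OF _ T.inv_closed, of "\<chi> \<otimes>\<^bsub>IA_group G\<^esub> \<phi>" \<chi>] \<chi> \<chi>\<phi>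
      by (auto simp: unit_inner_def)
  qed
  with subgroup_unit_inner show ?thesis
    by (auto simp: T.normal_inv_iff)
qed

lemma pull_funpow:
  assumes \<phi>: "\<phi> \<in> IA G" and f: "f \<in> polyf G j"
  shows "pull G (\<phi> [^]\<^bsub>IA_group G\<^esub> (n :: nat)) f = (pull G \<phi> ^^ n) f"
proof -
  interpret T: group "IA_group G" by (rule group_IA_group)
  show ?thesis
  proof (induction n)
    case 0
    show ?case by (simp add: pull_one[OF f])
  next
    case (Suc n)
    then show ?case
      using pull_mult[OF _ \<phi>, of "\<phi> [^]\<^bsub>IA_group G\<^esub> n"] T.nat_pow_closed[of \<phi> n] \<phi> by simp
  qed
qed

text \<open>If the \<open>n\<close>-th power of \<open>\<phi>\<close> is conjugation by
  \<open>x\<close> and \<open>y\<close> is an \<open>n\<close>-th root of \<open>x\<close>, then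
  pullback by \<open>\<phi>\<close> and conjugation by \<open>y\<close> are unipotent
  \<open>n\<close>-th roots of the same operator, hence equal.\<close>

lemma unit_inner_root:
  assumes \<phi>: "\<phi> \<in> IA G" and n: "n > 0" and pow: "\<phi> [^]\<^bsub>IA_group G\<^esub> (n :: nat) \<in> unit_inner G c"
  shows "\<phi> \<in> unit_inner G c"
proof -
  obtain L R where LR: "gapair G L R"
    and eq: "\<And>f. f \<in> polyf G c \<Longrightarrow> pull G (\<phi> [^]\<^bsub>IA_group G\<^esub> n) (R f) = L f"
    using pow by (auto simp: unit_inner_def)
  obtain L' R' where L'R': "gapair G L' R'"
    and root: "\<And>f. f \<in> polyf G c \<Longrightarrow> (L' ^^ n) f = L f" "\<And>f. f \<in> polyf G c \<Longrightarrow> (R' ^^ n) f = R f"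
    using gapair_root[OF LR n] by metis
  obtain L'' R'' where L''R'': "gapair G L'' R''"
    and inv: "\<And>f. f \<in> polyf G c \<Longrightarrow> R'' (R' f) = f" "\<And>f. f \<in> polyf G c \<Longrightarrow> R' (R'' f) = f"
    using gapair_inverse[OF L'R'] by metis
  note U = gapair_unip[OF L'R'] gapair_unip[OF L''R''] pull_unip[OF \<phi>]
  \<comment> \<open>With \<open>y\<close> the element of \<open>L'\<close> and \<open>R'\<close>,
    this is the operator sending \<open>f\<close> to \<open>f(y . y^-1)\<close>. Its left and right
    factors commute, so its powers split.\<close>
  define C where "C = (\<lambda>f. L' (R'' f))"
  have C: "unip G 1 C"
    unfolding C_def by (rule unip_comp[OF U(1) U(4)])
  have powC: "(C ^^ m) f = (L' ^^ m) ((R'' ^^ m) f)" for m f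
  proof (induction m arbitrary: f)
    case (Suc m)
    have comm: "(R'' ^^ m) (L' h) = L' ((R'' ^^ m) h)" for h
      by (induction m) (simp_all add: gapair_commute[OF L'R' L''R''])
    have "(C ^^ Suc m) f = (L' ^^ m) ((R'' ^^ m) (L' (R'' f)))"
      unfolding funpow_Suc_right o_apply Suc.IH by (simp only: C_def)
    then show ?case
      by (simp only: comm funpow_Suc_right o_apply)
  qed simp
  have powR: "(R' ^^ m) ((R'' ^^ m) f) = f" if "f \<in> polyf G c" for m f
    using that
  proof (induction m arbitrary: f)
    case (Suc m)
    have "(R' ^^ Suc m) ((R'' ^^ Suc m) f) = R' ((R' ^^ m) ((R'' ^^ m) (R'' f)))"
      by (simp add: funpow_swap1)
    also have "\<dots> = f"
      using Suc.IH[OF unip_preserves[OF U(4) Suc.prems]] inv(2)[OF Suc.prems] by simp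
    finally show ?case .
  qed simp
  have "pull G \<phi> f = C f" if f: "f \<in> polyf G c" for f
  proof (rule unip_root_unique[OF U(5) C n _ f])
    fix f assume f: "f \<in> polyf G c"
    define h where "h = (R'' ^^ n) f"
    have h: "h \<in> polyf G c"
      unfolding h_def by (rule unip_preserves[OF unip_funpow[OF U(4)] f])
    have "(pull G \<phi> ^^ n) f = pull G (\<phi> [^]\<^bsub>IA_group G\<^esub> n) f"
      using pull_funpow[OF \<phi> f] by simp
    moreover have "f = R h"
      using powR[OF f, of n] root(2)[OF h] by (simp add: h_def)
    ultimately have "(pull G \<phi> ^^ n) f = (L' ^^ n) h"
      using eq[OF h] root(1)[OF h] by simp
    then show "(pull G \<phi> ^^ n) f = (C ^^ n) f"
      by (simp add: powC h_def)
  qed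
  then have "pull G \<phi> (R' f) = L' f" if f: "f \<in> polyf G c" for f
    using unip_preserves[OF U(2) f] by (simp add: C_def inv(1)[OF f])
  with \<phi> L'R' show ?thesis by (auto simp: unit_inner_def)
qed

text \<open>Weights add under commutators, and term 0 of the series already has weight 1, hence
  \<open>Suc k\<close>.\<close>

lemma lower_central_IA_unip:
  "\<phi> \<in> lower_central (IA_group G) k \<Longrightarrow> \<phi> \<in> IA G \<and> unip G (Suc k) (pull G \<phi>)"
proof (induction k arbitrary: \<phi>)
  case 0
  then show ?case using pull_unip by simp
next
  case (Suc k)
  interpret T: group "IA_group G" by (rule group_IA_group)
  have inv: "inv\<^bsub>IA_group G\<^esub> \<psi> \<in> IA G" if "\<psi> \<in> IA G" for \<psi>
    using T.inv_closed[of \<psi>] that by simp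
  have mult: "\<psi> \<otimes>\<^bsub>IA_group G\<^esub> \<chi> \<in> IA G" if "\<psi> \<in> IA G" "\<chi> \<in> IA G" for \<psi> \<chi>
    using T.m_closed[of \<psi> \<chi>] that by simp
  have pinv: "pull G \<psi> (pull G (inv\<^bsub>IA_group G\<^esub> \<psi>) f) = f"
    "pull G (inv\<^bsub>IA_group G\<^esub> \<psi>) (pull G \<psi> f) = f"
    if "\<psi> \<in> IA G" "f \<in> polyf G j" for \<psi> f j
    using pull_mult[OF inv[OF that(1)] that(1)] pull_mult[OF that(1) inv[OF that(1)]]
      T.r_inv[of \<psi>] T.l_inv[of \<psi>] that(1) pull_one[OF that(2)] by simp_all
  have pull_0: "unip G 0 (pull G \<psi>)" if "\<psi> \<in> IA G" for \<psi>
    by (rule unip_le[OF pull_unip[OF that]]) simp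
  have uinv: "unip G i (pull G (inv\<^bsub>IA_group G\<^esub> \<psi>))" if "\<psi> \<in> IA G" "unip G i (pull G \<psi>)" for \<psi> i
    by (rule unip_inverse[OF that(2) pull_0[OF inv[OF that(1)]] pinv(2)[OF that(1)]])
  have comm: "\<xi> \<in> IA G \<and> unip G (Suc (Suc k)) (pull G \<xi>)"
    if "\<xi> \<in> {\<psi> \<otimes>\<^bsub>IA_group G\<^esub> \<chi> \<otimes>\<^bsub>IA_group G\<^esub> inv\<^bsub>IA_group G\<^esub> \<psi> \<otimes>\<^bsub>IA_group G\<^esub> inv\<^bsub>IA_group G\<^esub> \<chi> |\<psi> \<chi>.
      \<psi> \<in> lower_central (IA_group G) k \<and> \<chi> \<in> carrier (IA_group G)}" for \<xi>
  proof -
    obtain \<psi> \<chi> where \<psi>: "\<psi> \<in> IA G" "unip G (Suc k) (pull G \<psi>)" and \<chi>: "\<chi> \<in> IA G"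
      and \<xi>: "\<xi> = \<psi> \<otimes>\<^bsub>IA_group G\<^esub> \<chi> \<otimes>\<^bsub>IA_group G\<^esub> inv\<^bsub>IA_group G\<^esub> \<psi> \<otimes>\<^bsub>IA_group G\<^esub> inv\<^bsub>IA_group G\<^esub> \<chi>"
      using \<open>\<xi> \<in> _\<close> Suc.IH by auto
    \<comment> \<open>Pullback reverses products, so the commutator of \<open>\<psi>\<close> and
      \<open>\<chi>\<close> becomes that of the pullbacks of \<open>\<chi>^-1\<close> and
      \<open>\<psi>^-1\<close>.\<close>
    have "unip G (1 + Suc k) (\<lambda>f. pull G (inv\<^bsub>IA_group G\<^esub> \<chi>) (pull G (inv\<^bsub>IA_group G\<^esub> \<psi>)
        (pull G \<chi> (pull G \<psi> f))))"
      by (rule unip_commutator[OF pull_unip[OF inv[OF \<chi>]] uinv[OF \<psi>] pull_0[OF \<chi>] pull_0[OF \<psi>(1)]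
            pinv(2)[OF \<chi>] pinv(2)[OF \<psi>(1)]])
    then show ?thesis
      using \<psi> \<chi> by (simp add: \<xi> pull_mult[symmetric] mult inv T.m_assoc)
  qed
  show ?case
    using Suc.prems unfolding lower_central.simps
  proof (induction rule: generate.induct)
    case one
    have "pull G (\<one>\<^bsub>IA_group G\<^esub>) f - f \<in> polyf G j" if "f \<in> polyf G (j + Suc (Suc k))" for f j
      using pull_one[OF that] polyf_0 by simp
    then show ?case
      using T.one_closed by (simp add: unip_def linear_pull)
  next
    case (incl \<xi>)
    then show ?case by (rule comm)
  next
    case (inv \<xi>)
    from comm[OF inv] show ?case using uinv \<open>\<And>\<psi>. \<psi> \<in> IA G \<Longrightarrow> inv\<^bsub>IA_group G\<^esub> \<psi> \<in> IA G\<close> by blast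
  next
    case (eng \<psi> \<chi>)
    then show ?case
      using unip_comp[of G "Suc (Suc k)" "pull G \<chi>" "pull G \<psi>"] by (simp add: pull_mult[symmetric] mult)
  qed
qed

text \<open>Weight above \<open>c\<close> means acting as the identity on \<open>polyf G c\<close>,
  that is, as conjugation by the element 1.\<close>

lemma lower_central_unit_inner: "lower_central (IA_group G) c \<subseteq> unit_inner G c"
proof
  fix \<phi> assume "\<phi> \<in> lower_central (IA_group G) c"
  then have \<phi>: "\<phi> \<in> IA G" "unip G (Suc c) (pull G \<phi>)"
    using lower_central_IA_unip by auto
  have "pull G \<phi> (rtr G \<one> f) = ltr G \<one> f" if f: "f \<in> polyf G c" for f
  proof -
    have "f \<in> polyf G (0 + Suc c)" by (rule polyf_mono[OF _ f]) simp
    from unipD[OF \<phi>(2) this] show ?thesis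
      by (simp add: rtr_one[OF f] ltr_one[OF f])
  qed
  with \<phi>(1) gapair.transl[OF one_closed] show "\<phi> \<in> unit_inner G c"
    by (auto simp: unit_inner_def)
qed

text \<open>For a class function the left and right operators of any group algebra element coincide,
  so conjugation by that element fixes the function.\<close>

lemma unit_inner_class_function:
  assumes "\<phi> \<in> unit_inner G c" and f: "f \<in> polyf G c"
    and central: "\<And>g h. g \<in> carrier G \<Longrightarrow> h \<in> carrier G \<Longrightarrow> f (g \<otimes> h) = f (h \<otimes> g)"
    and x: "x \<in> carrier G"
  shows "f (\<phi> x) = f x"
proof -
  obtain L R where LR: "gapair G L R"
    and eq: "\<And>f. f \<in> polyf G c \<Longrightarrow> pull G \<phi> (R f) = L f"
    using assms(1) by (auto simp: unit_inner_def)
  obtain L' R' where L'R': "gapair G L' R'"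
    and inv: "\<And>f. f \<in> polyf G c \<Longrightarrow> R' (R f) = f" "\<And>f. f \<in> polyf G c \<Longrightarrow> R (R' f) = f"
    using gapair_inverse[OF LR] by metis
  have same: "L f = R f"
    using LR
  proof induction
    case (transl g)
    then show ?case using central by (auto simp: ltr_def rtr_def fun_eq_iff)
  qed simp
  have "pull G \<phi> f = pull G \<phi> (R (R' f))"
    by (simp add: inv(2)[OF f])
  also have "\<dots> = L (R' f)"
    by (rule eq[OF unip_preserves[OF gapair_unip(2)[OF L'R'] f]])
  also have "\<dots> = f"
    by (simp add: gapair_commute[OF LR L'R'] same inv(1)[OF f])
  finally show ?thesis
    using x by (simp add: pull_def fun_eq_iff split: if_splits)
qed

text \<open>By \<open>out_H1_coset\<close> a class lies in the kernel exactly when its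
  representatives act trivially on homology, so the kernel consists of the cosets of
  \<open>Inn G\<close> in \<open>IA G\<close>.\<close>

lemma Torelli_Out_eq: "Torelli_Out G = IA_group G Mod Inn G"
proof -
  have "kernel (OutGroup G) (AutoGroup (H1 G)) (out_H1 G)
      = {c \<in> (\<lambda>\<phi>. Inn G #>\<^bsub>AutoGroup G\<^esub> \<phi>) ` auto G. out_H1 G c = \<one>\<^bsub>AutoGroup (H1 G)\<^esub>}"
    by (simp only: kernel_def OutGroup_def carrier_FactGroup AutoGroup_simps)
  also have "\<dots> = (\<lambda>\<phi>. Inn G #>\<^bsub>AutoGroup G\<^esub> \<phi>) ` IA G"
    unfolding IA_def kernel_def by (auto simp only: out_H1_coset AutoGroup_simps)
  also have "\<dots> = (\<lambda>\<phi>. Inn G #>\<^bsub>IA_group G\<^esub> \<phi>) ` IA G"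
    by (simp add: r_coset_def IA_group_def)
  finally have carr: "kernel (OutGroup G) (AutoGroup (H1 G)) (out_H1 G) = rcosets\<^bsub>IA_group G\<^esub> Inn G"
    by (auto simp: RCOSETS_def)
  show ?thesis
    unfolding Torelli_Out_def carr
    by (simp add: OutGroup_def FactGroup_def IA_group_def set_mult_def fun_eq_iff)
qed

text \<open>The quotients of \<open>IA_group G\<close> by the subgroups
  \<open>unit_inner G c\<close> are torsion-free nilpotent. The assumption says that these subgroups
  meet in \<open>Inn G\<close>, so the quotients separate the nontrivial classes.\<close>

lemma residually_torsion_free_nilpotent_Torelli_Out:
  assumes inner: "\<And>\<phi>. \<phi> \<in> IA G \<Longrightarrow> (\<And>c. \<phi> \<in> unit_inner G c) \<Longrightarrow> \<phi> \<in> Inn G"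
  shows "residually_torsion_free_nilpotent (Torelli_Out G)"
proof -
  interpret A: group "AutoGroup G" by (rule AutoGroup)
  interpret T: group "IA_group G" by (rule group_IA_group)
  have Inn_IA: "Inn G \<subseteq> IA G"
    using conjugation_IA by (auto simp: Inn_def)
  have Inn: "Inn G \<lhd> IA_group G"
    unfolding IA_group_def
    by (rule A.normal_restrict_supergroup[OF subgroup_IA Inn_normal Inn_IA])
  interpret Inn: normal "Inn G" "IA_group G" by (rule Inn)
  interpret Q: group "IA_group G Mod Inn G" by (rule Inn.factorgroup_is_group)
  show ?thesis
    unfolding residually_torsion_free_nilpotent_def Torelli_Out_eq
  proof (intro ballI impI)
    fix x assume x: "x \<in> carrier (IA_group G Mod Inn G)" "x \<noteq> \<one>\<^bsub>IA_group G Mod Inn G\<^esub>"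
    then obtain \<phi> where \<phi>: "\<phi> \<in> IA G" and x_eq: "x = Inn G #>\<^bsub>IA_group G\<^esub> \<phi>"
      by (auto simp: carrier_FactGroup)
    have "\<phi> \<notin> Inn G"
      using T.coset_join2[OF _ Inn.is_subgroup, of \<phi>] \<phi> x(2) x_eq by auto
    then obtain c where c: "\<phi> \<notin> unit_inner G c"
      using inner \<phi> by blast
    let ?U = "unit_inner G c"
    interpret U: normal ?U "IA_group G" by (rule normal_unit_inner)
    let ?K = "IA_group G Mod ?U"
    let ?q = "\<lambda>\<psi>. ?U #>\<^bsub>IA_group G\<^esub> \<psi>"
    interpret K: group ?K by (rule U.factorgroup_is_group)
    interpret q: group_hom "IA_group G" ?K ?q
      by unfold_locales (rule U.r_coset_hom_Mod)
    have q_one: "?q \<psi> = \<one>\<^bsub>?K\<^esub> \<longleftrightarrow> \<psi> \<in> ?U" if "\<psi> \<in> IA G" for \<psi>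
    proof -
      have "\<psi> \<in> carrier (IA_group G)" using that by simp
      then show ?thesis
        using T.coset_join1[OF _ _ U.is_subgroup] T.coset_join2[OF _ U.is_subgroup]
        unfolding one_FactGroup by blast
    qed
    have epi: "?q \<in> epi (IA_group G) ?K"
      using U.r_coset_hom_Mod by (auto simp: epi_def carrier_FactGroup)
    have "y = \<one>\<^bsub>?K\<^esub>" if y: "y \<in> lower_central ?K c" for y
    proof -
      obtain \<psi> where \<psi>: "\<psi> \<in> lower_central (IA_group G) c" "y = ?q \<psi>"
        using y lower_central_epi[OF T.is_group K.is_group epi] by auto
      have "\<psi> \<in> ?U" using \<psi>(1) lower_central_unit_inner by blast
      then show ?thesis
        using q_one[OF unit_inner_IA] \<psi>(2) by blast
    qed
    moreover have "\<one>\<^bsub>?K\<^esub> \<in> lower_central ?K k" for k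
      by (cases k) (simp_all only: lower_central.simps K.one_closed generate.one)
    ultimately have "lower_central ?K c = {\<one>\<^bsub>?K\<^esub>}"
      by (intro equalityI subsetI) simp_all
    then have nil: "nilpotent_group ?K"
      using K.is_group unfolding nilpotent_group_def by blast
    have tf: "torsion_free ?K"
      unfolding torsion_free_def
    proof (intro ballI allI impI)
      fix y and n :: nat assume y: "y \<in> carrier ?K" "0 < n" "y [^]\<^bsub>?K\<^esub> n = \<one>\<^bsub>?K\<^esub>"
      then obtain \<psi> where \<psi>: "\<psi> \<in> IA G" "y = ?q \<psi>"
        by (auto simp: carrier_FactGroup)
      then have "?q (\<psi> [^]\<^bsub>IA_group G\<^esub> n) = \<one>\<^bsub>?K\<^esub>"
        using y(3) q.hom_nat_pow[of \<psi> n] by simp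
      then have "\<psi> [^]\<^bsub>IA_group G\<^esub> n \<in> ?U"
        using q_one T.nat_pow_closed[of \<psi> n] \<psi>(1) by simp
      then have "\<psi> \<in> ?U"
        by (rule unit_inner_root[OF \<psi>(1) y(2)])
      then show "y = \<one>\<^bsub>?K\<^esub>"
        using q_one \<psi> by simp
    qed
    have "Inn G \<subseteq> ?U"
      using conjugation_unit_inner by (auto simp: Inn_def)
    then have "Inn G \<subseteq> kernel (IA_group G) ?K ?q"
      using q_one Inn_IA unfolding kernel_def by auto
    then obtain g where g: "g \<in> hom (IA_group G Mod Inn G) ?K"
      "\<And>\<psi>. \<psi> \<in> carrier (IA_group G) \<Longrightarrow> g (Inn G #>\<^bsub>IA_group G\<^esub> \<psi>) = ?q \<psi>"
      using q.FactGroup_universal_kernel[OF Inn] by metis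
    then have "g ` carrier (IA_group G Mod Inn G) = carrier ?K"
      by (simp add: carrier_FactGroup image_image)
    with g(1) have "g \<in> epi (IA_group G Mod Inn G) ?K"
      by (simp add: epi_def)
    moreover have "g x \<noteq> \<one>\<^bsub>?K\<^esub>"
      using g(2)[of \<phi>] q_one[OF \<phi>] c \<phi> x_eq by simp
    \<comment> \<open>Elements of \<open>?K\<close> are sets of automorphisms, whereas the
      definition asks for a group whose elements are sets of outer classes; the quotient by the
      kernel has that type.\<close>
    ultimately show "\<exists>(H :: ('a \<Rightarrow> 'a) set set monoid) f. nilpotent_group H \<and> torsion_free H \<and>
        f \<in> epi (IA_group G Mod Inn G) H \<and> f x \<noteq> \<one>\<^bsub>H\<^esub>"
      using Q.epi_target_carrier_type[OF nil tf _ x(1)] by blast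
  qed
qed

end

section \<open>Partially commutative words\<close>

locale commutation =
  fixes E :: "('v \<times> 'v) set"
  assumes E_sym: "(a, b) \<in> E \<Longrightarrow> (b, a) \<in> E"
    and E_irrefl: "(a, a) \<notin> E"
begin

inductive swap :: "'v list \<Rightarrow> 'v list \<Rightarrow> bool"
  where swap: "(a, b) \<in> E \<Longrightarrow> swap (p @ a # b # q) (p @ b # a # q)"

text \<open>Words modulo \<open>teq\<close> form the trace monoid of \<open>E\<close>, the monomials
  of the power series algebra.\<close>

definition teq :: "'v list \<Rightarrow> 'v list \<Rightarrow> bool"
  where "teq = swap\<^sup>*\<^sup>*"

lemma swap_sym: "swap u v \<Longrightarrow> swap v u"
  by (induction rule: swap.induct) (rule swap.swap, erule E_sym)

lemma swap_context: "swap u v \<Longrightarrow> swap (p @ u @ q) (p @ v @ q)"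
proof (induction rule: swap.induct)
  case (swap a b r s)
  from swap.swap[OF this, of "p @ r" "s @ q"] show ?case by simp
qed

lemma swap_rev: "swap u v \<Longrightarrow> swap (rev u) (rev v)"
proof (induction rule: swap.induct)
  case (swap a b r s)
  from swap.swap[OF E_sym[OF this], of "rev s" "rev r"] show ?case by simp
qed

lemma teq_refl [simp]: "teq u u"
  by (simp add: teq_def)

lemma teq_trans [trans]: "teq u v \<Longrightarrow> teq v w \<Longrightarrow> teq u w"
  by (simp add: teq_def)

lemma swap_teq: "swap u v \<Longrightarrow> teq u v"
  by (simp add: teq_def)

lemma teq_sym: "teq u v \<Longrightarrow> teq v u"
  unfolding teq_def
  by (induction rule: rtranclp_induct) (auto intro: converse_rtranclp_into_rtranclp swap_sym)

lemma teq_context: "teq u v \<Longrightarrow> teq (p @ u @ q) (p @ v @ q)"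
  unfolding teq_def
  by (induction rule: rtranclp_induct) (auto intro: rtranclp.rtrancl_into_rtrancl swap_context)

lemma teq_append: "teq u v \<Longrightarrow> teq (u @ q) (v @ q)"
  using teq_context[of u v "[]"] by simp

lemma teq_Cons: "teq u v \<Longrightarrow> teq (a # u) (a # v)"
  using teq_context[of u v "[a]" "[]"] by simp

lemma teq_prepend: "teq u v \<Longrightarrow> teq (p @ u) (p @ v)"
  using teq_context[of u v p "[]"] by simp

lemma teq_rev: "teq u v \<Longrightarrow> teq (rev u) (rev v)"
  unfolding teq_def
  by (induction rule: rtranclp_induct) (auto intro: rtranclp.rtrancl_into_rtrancl swap_rev)

lemma teq_mset: "teq u v \<Longrightarrow> mset u = mset v"
  unfolding teq_def by (induction rule: rtranclp_induct) (auto simp: swap.simps)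

lemma teq_length: "teq u v \<Longrightarrow> length u = length v"
  using teq_mset size_mset by metis

lemma teq_set: "teq u v \<Longrightarrow> set u = set v"
  using teq_mset set_mset_mset by metis

text \<open>The leading \<open>v\<close> is followed through the swaps: a letter can get in front of
  it only by being swapped with it.\<close>

lemma teq_Cons_decomp:
  assumes "teq (v # u) w"
  shows "\<exists>p q. w = p @ v # q \<and> (\<forall>a\<in>set p. (a, v) \<in> E) \<and> teq u (p @ q)"
  using assms unfolding teq_def
proof (induction rule: rtranclp_induct)
  case base
  show ?case by (rule exI[of _ "[]"]) simp
next
  case (step w w')
  then obtain p q where w: "w = p @ v # q" and p: "\<forall>a\<in>set p. (a, v) \<in> E" and u: "teq u (p @ q)"
    by (auto simp: teq_def)
  from \<open>swap w w'\<close> obtain a b r s where ab: "(a, b) \<in> E" and rs: "w = r @ a # b # s"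
    and w': "w' = r @ b # a # s"
    by (auto simp: swap.simps)
  have "p @ v # q = r @ a # b # s" using w rs by simp
  \<comment> \<open>The swapped pair lies before the followed \<open>v\<close>, has it as right or
    left member, or lies after it.\<close>
  then consider (before) t where "p = r @ a # b # t" "s = t @ v # q"
    | (right) "p = r @ [a]" "b = v" "s = q"
    | (left) "p = r" "a = v" "q = b # s"
    | (after) t where "r = p @ v # t" "q = t @ a # b # s"
    by (auto simp: append_eq_append_conv2 Cons_eq_append_conv append_eq_Cons_conv)
  then have "\<exists>p q. w' = p @ v # q \<and> (\<forall>a\<in>set p. (a, v) \<in> E) \<and> teq u (p @ q)"
  proof cases
    case before
    have "teq (p @ q) ((r @ b # a # t) @ q)"
      using swap_teq[OF swap.swap[OF ab, of r "t @ q"]] before by simp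
    then have "teq u ((r @ b # a # t) @ q)" by (rule teq_trans[OF u])
    then show ?thesis using p before w' by (intro exI[of _ "r @ b # a # t"] exI[of _ q]) auto
  next
    case right
    then show ?thesis using p u w' by (intro exI[of _ r] exI[of _ "a # q"]) auto
  next
    case left
    then show ?thesis using p u w' E_sym[OF ab] by (intro exI[of _ "p @ [b]"] exI[of _ s]) auto
  next
    case after
    have "teq (p @ q) (p @ t @ b # a # s)"
      using swap_teq[OF swap.swap[OF ab, of "p @ t" s]] after by simp
    then have "teq u (p @ t @ b # a # s)" by (rule teq_trans[OF u])
    then show ?thesis using p after w' by (intro exI[of _ p] exI[of _ "t @ b # a # s"]) auto
  qed
  then show ?case by (simp add: teq_def)
qed

text \<open>If the followed \<open>v\<close> were not the first letter, then the first letter, again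
  \<open>v\<close>, would be adjacent to itself.\<close>

lemma teq_Cons_cancel:
  assumes "teq (v # u) (v # t)"
  shows "teq u t"
proof -
  obtain p q where "v # t = p @ v # q" "\<forall>a\<in>set p. (a, v) \<in> E" "teq u (p @ q)"
    using teq_Cons_decomp[OF assms] by blast
  then show ?thesis using E_irrefl by (cases p) auto
qed

lemma teq_Cons_iff [simp]: "teq (v # u) (v # t) \<longleftrightarrow> teq u t"
  using teq_Cons_cancel teq_Cons by blast

lemma teq_prepend_iff [simp]: "teq (w @ u) (w @ t) \<longleftrightarrow> teq u t"
  by (induction w) simp_all

lemma teq_snoc_iff [simp]: "teq (u @ [v]) (t @ [v]) \<longleftrightarrow> teq u t"
  using teq_rev[of "u @ [v]" "t @ [v]"] teq_rev[of "rev u" "rev t"] teq_append by auto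

lemma teq_commute_past:
  assumes "\<forall>a\<in>set p. (a, v) \<in> E"
  shows "teq (p @ v # q) (v # p @ q)"
  using assms
proof (induction p)
  case (Cons a p)
  have "teq (a # p @ v # q) (a # v # p @ q)"
    using Cons by simp
  also have "teq \<dots> (v # a # p @ q)"
    using swap_teq[OF swap.swap[of a v "[]" "p @ q"]] Cons by simp
  finally show ?case by simp
qed simp

text \<open>The leading \<open>v\<close> ends up either as the final letter, having passed all of
  \<open>t\<close>, or inside \<open>t\<close>, from where it could be moved to the front of
  \<open>t\<close>.\<close>

lemma teq_snoc_left:
  assumes "teq (t @ [v]) (v # u)" "\<And>t'. \<not> teq t (v # t')"
  shows "\<forall>a\<in>set t. (a, v) \<in> E"
proof -
  obtain p q where pq: "t @ [v] = p @ v # q" and p: "\<forall>a\<in>set p. (a, v) \<in> E"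
    using teq_Cons_decomp[OF teq_sym[OF assms(1)]] by blast
  show ?thesis
  proof (cases q rule: rev_cases)
    case Nil
    then show ?thesis using pq p by simp
  next
    case (snoc q' b)
    then have "t = p @ v # q'" using pq by simp
    then show ?thesis using teq_commute_past[OF p, of q'] assms(2) by blast
  qed
qed

definition square_free :: "'v list \<Rightarrow> bool"
  where "square_free m \<longleftrightarrow> (\<forall>p a q. \<not> teq m (p @ a # a # q))"

lemma square_free_teq: "square_free m \<Longrightarrow> teq m t \<Longrightarrow> square_free t"
  unfolding square_free_def by (meson teq_trans)

lemma square_free_suffix: "square_free (w @ s) \<Longrightarrow> square_free s"
  unfolding square_free_def using teq_prepend by (metis append.assoc)

definition trace_fun :: "nat \<Rightarrow> ('v list \<Rightarrow> real) set"
  where "trace_fun c = {F. (\<forall>u v. swap u v \<longrightarrow> F u = F v) \<and> (\<forall>w. c \<le> length w \<longrightarrow> F w = 0)}"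

definition trace_ind :: "'v list \<Rightarrow> 'v list \<Rightarrow> real"
  where "trace_ind t = (\<lambda>w. if teq t w then 1 else 0)"

text \<open>Transpose of right multiplication by the letter \<open>v\<close>; likewise
  \<open>prefix_op w\<close> is the transpose of left multiplication by \<open>w\<close>.\<close>

definition snoc_op :: "'v \<Rightarrow> ('v list \<Rightarrow> real) \<Rightarrow> 'v list \<Rightarrow> real"
  where "snoc_op v F = (\<lambda>u. F (u @ [v]))"

definition prefix_op :: "'v list \<Rightarrow> ('v list \<Rightarrow> real) \<Rightarrow> 'v list \<Rightarrow> real"
  where "prefix_op w F = (\<lambda>u. F (w @ u))"

lemma subspace_trace_fun: "subspace (trace_fun c)"
  by (rule subspaceI) (auto simp: trace_fun_def fun_apply)

lemma trace_fun_mono: "F \<in> trace_fun c \<Longrightarrow> c \<le> d \<Longrightarrow> F \<in> trace_fun d"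
  by (auto simp: trace_fun_def)

lemma trace_fun_0: "F \<in> trace_fun 0 \<longleftrightarrow> F = 0"
  by (auto simp: trace_fun_def fun_eq_iff zero_fun_apply)

lemma trace_ind_trace_fun: "length t < c \<Longrightarrow> trace_ind t \<in> trace_fun c"
proof -
  assume t: "length t < c"
  have "teq t u \<longleftrightarrow> teq t v" if "swap u v" for u v
    using that swap_teq swap_sym teq_trans by meson
  moreover have "\<not> teq t w" if "c \<le> length w" for w
    using teq_length[of t w] t that by auto
  ultimately show ?thesis by (simp add: trace_fun_def trace_ind_def)
qed

lemma linear_snoc_op: "linear (snoc_op v)" and linear_prefix_op: "linear (prefix_op w)"
  by (rule linearI; simp add: snoc_op_def prefix_op_def fun_eq_iff fun_apply)+

lemma snoc_op_trace_fun: "F \<in> trace_fun (Suc c) \<Longrightarrow> snoc_op v F \<in> trace_fun c"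
  using swap_context[of _ _ "[]" "[v]"] by (auto simp: trace_fun_def snoc_op_def)

lemma prefix_op_trace_fun: "F \<in> trace_fun c \<Longrightarrow> prefix_op w F \<in> trace_fun c"
  using swap_context[of _ _ w "[]"] by (auto simp: trace_fun_def prefix_op_def)

section \<open>The action of a right-angled Artin group on trace functions\<close>

text \<open>The Magnus map: \<open>v\<close> acts as \<open>1 + v\<close>, its formal inverse as the
  geometric series of \<open>(1 + v)^-1\<close> cut off at degree \<open>c\<close>.\<close>

fun letter_op :: "nat \<Rightarrow> 'v \<times> bool \<Rightarrow> ('v list \<Rightarrow> real) \<Rightarrow> 'v list \<Rightarrow> real"
  where
    "letter_op c (v, True) F = F + snoc_op v F"
  | "letter_op c (v, False) F = (\<lambda>u. \<Sum>i<c. (- 1) ^ i * F (u @ replicate i v))"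

text \<open>Swap-invariant functions on words of length less than \<open>c\<close> are dual to the power series algebra
  truncated at degree \<open>c\<close>; the elements of constant term \<open>1\<close> act on them by operators satisfying
  \<open>trace_op c\<close>.\<close>

definition trace_op :: "nat \<Rightarrow> (('v list \<Rightarrow> real) \<Rightarrow> 'v list \<Rightarrow> real) \<Rightarrow> bool"
  where "trace_op c T \<longleftrightarrow> linear T \<and> (\<forall>w F. T (prefix_op w F) = prefix_op w (T F)) \<and>
    (\<forall>d<c. \<forall>F\<in>trace_fun (Suc d). T F - F \<in> trace_fun d)"

lemma trace_op_linear: "trace_op c T \<Longrightarrow> linear T"
  and trace_op_prefix: "trace_op c T \<Longrightarrow> T (prefix_op w F) = prefix_op w (T F)"
  and trace_op_diff: "trace_op c T \<Longrightarrow> d < c \<Longrightarrow> F \<in> trace_fun (Suc d) \<Longrightarrow> T F - F \<in> trace_fun d"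
  by (auto simp: trace_op_def)

lemma trace_op_trace_fun:
  assumes T: "trace_op c T" and "d \<le> c" and F: "F \<in> trace_fun d"
  shows "T F \<in> trace_fun d"
proof (cases d)
  case 0
  then show ?thesis using F linear_0[OF trace_op_linear[OF T]] by (simp add: trace_fun_0)
next
  case (Suc e)
  then have "T F - F \<in> trace_fun d"
    using trace_op_diff[OF T, of e F] trace_fun_mono[of _ e d] assms by simp
  then show ?thesis using subspace_add[OF subspace_trace_fun _ F] by fastforce
qed

lemma trace_op_comp:
  assumes T: "trace_op c T" and Y: "trace_op c Y"
  shows "trace_op c (\<lambda>F. T (Y F))"
  unfolding trace_op_def
proof (intro conjI allI impI ballI)
  show "linear (\<lambda>F. T (Y F))"
    using linear_compose[OF trace_op_linear[OF Y] trace_op_linear[OF T]] by (simp add: o_def)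
  show "T (Y (prefix_op w F)) = prefix_op w (T (Y F))" for w F
    by (simp add: trace_op_prefix[OF T] trace_op_prefix[OF Y])
  fix d F assume d: "d < c" and F: "F \<in> trace_fun (Suc d)"
  have "T (Y F) - Y F \<in> trace_fun d" "Y F - F \<in> trace_fun d"
    using trace_op_diff[OF T d trace_op_trace_fun[OF Y _ F]] trace_op_diff[OF Y d F] d by auto
  from subspace_add[OF subspace_trace_fun this] show "T (Y F) - F \<in> trace_fun d"
    by simp
qed

lemma trace_op_ident: "trace_op c (\<lambda>F. F)"
  by (simp add: trace_op_def linear_ident subspace_0[OF subspace_trace_fun])

lemma trace_op_affine:
  assumes T: "trace_op c T" and Y: "trace_op c Y" and Z: "trace_op c Z"
  shows "trace_op c (\<lambda>F. T F + r *\<^sub>R (Y F - Z F))"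
  unfolding trace_op_def
proof (intro conjI allI impI ballI)
  show "linear (\<lambda>F. T F + r *\<^sub>R (Y F - Z F))"
    using assms[THEN trace_op_linear]
    by (intro linear_compose_add linear_compose_scale_right linear_compose_sub)
  show "T (prefix_op w F) + r *\<^sub>R (Y (prefix_op w F) - Z (prefix_op w F)) = prefix_op w (T F + r *\<^sub>R (Y F - Z F))" for w F
    by (simp add: assms[THEN trace_op_prefix] linear_add[OF linear_prefix_op] linear_diff[OF linear_prefix_op]
        linear_scale[OF linear_prefix_op])
  fix d F assume d: "d < c" and F: "F \<in> trace_fun (Suc d)"
  have "(T F - F) + r *\<^sub>R ((Y F - F) - (Z F - F)) \<in> trace_fun d"
    by (intro subspace_add[OF subspace_trace_fun] subspace_scale[OF subspace_trace_fun]
        subspace_diff[OF subspace_trace_fun] trace_op_diff[OF _ d F] assms)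
  then show "T F + r *\<^sub>R (Y F - Z F) - F \<in> trace_fun d"
    by (simp add: algebra_simps)
qed

lemma trace_op_letter: "trace_op c (letter_op c (v, b))"
proof (cases b)
  case True
  have [simp]: "letter_op c (v, True) = (\<lambda>F. F + snoc_op v F)" by (rule ext) simp
  have "linear (\<lambda>F. F + snoc_op v F)"
    by (intro linear_compose_add linear_ident linear_snoc_op)
  moreover have "snoc_op v (prefix_op w F) = prefix_op w (snoc_op v F)" for w F
    by (simp add: snoc_op_def prefix_op_def)
  ultimately show ?thesis
    using True by (simp add: trace_op_def linear_add[OF linear_prefix_op] snoc_op_trace_fun)
next
  case False
  have [simp]: "letter_op c (v, False) = (\<lambda>F u. \<Sum>i<c. (- 1) ^ i * F (u @ replicate i v))"
    by (rule ext) simp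
  have "letter_op c (v, False) F - F \<in> trace_fun d" if d: "d < c" and F: "F \<in> trace_fun (Suc d)" for d F
  proof -
    have eq: "(letter_op c (v, False) F - F) u = (\<Sum>i\<in>{0<..<c}. (- 1) ^ i * F (u @ replicate i v))" for u
    proof -
      \<comment> \<open>From \<open>d < c\<close> the index 0 occurs; its term \<open>F u\<close> is
        the one that cancels.\<close>
      have "{..<c} = insert 0 {0<..<c}" using d by auto
      then show ?thesis by (simp add: fun_apply)
    qed
    show ?thesis
      unfolding trace_fun_def
    proof (intro CollectI conjI allI impI)
      fix u u' assume "swap u u'"
      then have "F (u @ w) = F (u' @ w)" for w
        using F swap_context[of u u' "[]"] by (auto simp: trace_fun_def)
      then show "(letter_op c (v, False) F - F) u = (letter_op c (v, False) F - F) u'"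
        unfolding eq by simp
    next
      fix w :: "'v list" assume "d \<le> length w"
      then have "F (w @ replicate i v) = 0" if "i > 0" for i
        using F that by (auto simp: trace_fun_def)
      then show "(letter_op c (v, False) F - F) w = 0"
        unfolding eq by simp
    qed
  qed
  moreover have "linear (letter_op c (v, False))"
    by (rule linearI)
      (simp_all add: fun_eq_iff fun_apply sum.distrib algebra_simps sum_distrib_left)
  moreover have "letter_op c (v, False) (prefix_op w F) = prefix_op w (letter_op c (v, False) F)" for w F
    by (simp add: prefix_op_def)
  ultimately show ?thesis
    using False by (simp add: trace_op_def del: letter_op.simps)
qed

text \<open>The alternating sum telescopes, and the remaining term involves a word of length at
  least \<open>c\<close>, where \<open>F\<close> vanishes.\<close>

lemma letter_op_cancel:
  assumes F: "F \<in> trace_fun c"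
  shows "letter_op c (v, b) (letter_op c (v, \<not> b) F) = F"
proof -
  have "(\<Sum>i<n. (- 1) ^ i * F (u @ replicate i v)) + (\<Sum>i<n. (- 1) ^ i * F (u @ v # replicate i v))
      = F u - (- 1) ^ n * F (u @ replicate n v)" for u n
    by (induction n) (simp_all add: algebra_simps)
  moreover have "F (u @ replicate c v) = 0" for u
    using F by (simp add: trace_fun_def)
  ultimately have *: "(\<Sum>i<c. (- 1) ^ i * F (u @ replicate i v))
      + (\<Sum>i<c. (- 1) ^ i * F (u @ v # replicate i v)) = F u" for u
    by simp
  show ?thesis
  proof (cases b)
    case True
    then show ?thesis using * by (simp add: fun_eq_iff snoc_op_def fun_apply)
  next
    case False
    then show ?thesis
      using * by (simp add: fun_eq_iff snoc_op_def fun_apply replicate_append_same distrib_left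
          sum.distrib)
  qed
qed

definition act :: "nat \<Rightarrow> 'v word \<Rightarrow> ('v list \<Rightarrow> real) \<Rightarrow> 'v list \<Rightarrow> real"
  where "act c w F = foldr (letter_op c) w F"

lemma act_simps [simp]: "act c [] F = F" "act c (a # w) F = letter_op c a (act c w F)"
  "act c (u @ w) F = act c u (act c w F)"
  by (simp_all add: act_def)

lemma trace_op_act: "trace_op c (act c w)"
proof (induction w)
  case Nil
  then show ?case using trace_op_ident[of c] by (simp add: act_def)
next
  case (Cons a w)
  obtain v b where "a = (v, b)" by force
  with trace_op_comp[OF trace_op_letter Cons] show ?case
    by (simp add: act_def)
qed

lemma act_trace_fun: "F \<in> trace_fun c \<Longrightarrow> act c w F \<in> trace_fun c"
  by (rule trace_op_trace_fun[OF trace_op_act]) simp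

lemma letter_op_commute:
  assumes "(v, w) \<in> E" and F: "F \<in> trace_fun c"
  shows "letter_op c (v, True) (letter_op c (w, True) F) = letter_op c (w, True) (letter_op c (v, True) F)"
proof -
  have "F (u @ [v, w]) = F (u @ [w, v])" for u
    using F swap.swap[OF assms(1), of u "[]"] by (simp add: trace_fun_def)
  then show ?thesis
    by (simp add: snoc_op_def fun_eq_iff fun_apply)
qed

text \<open>This makes the Magnus action well defined on the presented group.\<close>

lemma word_eq_act:
  assumes "word_eq S {commutator_word v w |v w. (v, w) \<in> E} u u'" and "F \<in> trace_fun c"
  shows "act c u F = act c u' F"
  using assms
proof (induction arbitrary: F rule: word_eq.induct)
  case (cancel u v s b)
  then show ?case by (simp add: letter_op_cancel act_trace_fun)
next
  case (relator u v r)
  then obtain a b where ab: "(a, b) \<in> E" and r: "r = commutator_word a b" by blast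
  define H where "H = act c v F"
  have H: "H \<in> trace_fun c" unfolding H_def by (rule act_trace_fun[OF relator.prems])
  note T = trace_op_trace_fun[OF trace_op_letter order_refl]
  \<comment> \<open>Past the two inverse letters, the relator applies only the operators of
    \<open>a\<close> and \<open>b\<close>, which commute; after exchanging them everything
    cancels.\<close>
  define K where "K = letter_op c (a, False) (letter_op c (b, False) H)"
  have "act c r H = letter_op c (a, True) (letter_op c (b, True) K)"
    by (simp add: r commutator_word_def K_def del: letter_op.simps)
  also have "\<dots> = letter_op c (b, True) (letter_op c (a, True) K)"
    by (rule letter_op_commute[OF ab]) (simp add: K_def T H del: letter_op.simps)
  also have "\<dots> = H"
    using letter_op_cancel[of _ c a True] letter_op_cancel[of _ c b True]
    by (simp add: K_def T H del: letter_op.simps)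
  finally show ?case by (simp add: H_def)
qed auto

end

lemma (in group) int_pow_commute:
  assumes x: "x \<in> carrier G" and y: "y \<in> carrier G" and xy: "x \<otimes> y = y \<otimes> x"
  shows "x [^] (i :: int) \<otimes> y = y \<otimes> x [^] i"
proof -
  have nat: "x [^] (n :: nat) \<otimes> y = y \<otimes> x [^] n" for n
  proof (induction n)
    case (Suc n)
    have "x [^] Suc n \<otimes> y = x [^] n \<otimes> y \<otimes> x" using x y by (simp add: m_assoc xy)
    then show ?case using x y by (simp add: Suc m_assoc)
  qed (use y in simp)
  have inv: "inv z \<otimes> y = y \<otimes> inv z" if z: "z \<in> carrier G" "z \<otimes> y = y \<otimes> z" for z
  proof -
    have "inv z \<otimes> y = inv z \<otimes> (y \<otimes> z) \<otimes> inv z" using y z(1) by (simp add: m_assoc)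
    also have "\<dots> = y \<otimes> inv z" unfolding z(2)[symmetric] using y z(1) by (simp add: m_assoc[symmetric])
    finally show ?thesis .
  qed
  show ?thesis
  proof (cases i rule: int_cases2)
    case (nonneg n)
    then show ?thesis using nat by (simp add: int_pow_int)
  next
    case (nonpos n)
    then show ?thesis using inv[OF nat_pow_closed[OF x] nat] x by (simp add: int_pow_neg_int)
  qed
qed

section \<open>The right-angled Artin group and its Magnus representation on trace functions\<close>

locale raag = commutation E for E :: "('v \<times> 'v) set" +
  fixes V :: "'v set"
  assumes finite_V: "finite V" and E_V: "E \<subseteq> V \<times> V"
begin

definition A :: "'v word set monoid"
  where "A = presented_group V {commutator_word v w |v w. (v, w) \<in> E}"

definition cls :: "'v word \<Rightarrow> 'v word set"
  where "cls u = word_rel V {commutator_word v w |v w. (v, w) \<in> E} `` {u}"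

sublocale A: group A
  unfolding A_def by (rule group_presented_group)

abbreviation gen :: "'v \<Rightarrow> 'v word set"
  where "gen v \<equiv> cls [(v, True)]"

lemma cls_closed: "u \<in> words V \<Longrightarrow> cls u \<in> carrier A"
  unfolding A_def cls_def by (rule word_class_in_carrier)

lemma cls_eq: "u \<in> words V \<Longrightarrow> v \<in> words V \<Longrightarrow>
    cls u = cls v \<longleftrightarrow> word_eq V {commutator_word v w |v w. (v, w) \<in> E} u v"
  unfolding cls_def by (rule word_rel_class_eq)

lemma cls_mult: "u \<in> words V \<Longrightarrow> v \<in> words V \<Longrightarrow> cls u \<otimes>\<^bsub>A\<^esub> cls v = cls (u @ v)"
  unfolding A_def cls_def by (rule presented_group_mult)

lemma cls_Nil: "cls [] = \<one>\<^bsub>A\<^esub>"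
  unfolding A_def cls_def by (rule presented_group_one[symmetric])

lemma carrier_cls:
  assumes "x \<in> carrier A"
  obtains u where "u \<in> words V" "x = cls u"
  using assms unfolding A_def cls_def by (rule presented_group_carrierE)

lemma words_simps [simp]: "[] \<in> words V" "a # u \<in> words V \<longleftrightarrow> fst a \<in> V \<and> u \<in> words V"
  "u @ w \<in> words V \<longleftrightarrow> u \<in> words V \<and> w \<in> words V"
  by (auto simp: words_def mem_Times_iff)

lemma gen_closed: "v \<in> V \<Longrightarrow> gen v \<in> carrier A"
  by (simp add: cls_closed)

lemma cls_inverse:
  assumes "v \<in> V"
  shows "cls [(v, False)] = inv\<^bsub>A\<^esub> (gen v)"
proof -
  have "cls [(v, False)] \<otimes>\<^bsub>A\<^esub> gen v = \<one>\<^bsub>A\<^esub>"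
    using assms word_eq.cancel[of "[]" V "[]" v _ False]
    by (simp add: cls_mult cls_Nil[symmetric] cls_eq)
  then show ?thesis
    using assms by (simp add: A.inv_equality cls_closed)
qed

lemma gen_commute:
  assumes "(a, b) \<in> E"
  shows "gen a \<otimes>\<^bsub>A\<^esub> gen b = gen b \<otimes>\<^bsub>A\<^esub> gen a"
proof -
  have V: "a \<in> V" "b \<in> V" using assms E_V by auto
  note cl = gen_closed[OF V(1)] gen_closed[OF V(2)]
  have "cls (commutator_word a b) = \<one>\<^bsub>A\<^esub>"
    using V assms word_eq.relator[of "[]" V "[]" "commutator_word a b"]
    by (auto simp: cls_Nil[symmetric] cls_eq commutator_word_def)
  moreover have "cls (commutator_word a b) = gen a \<otimes>\<^bsub>A\<^esub> (gen b \<otimes>\<^bsub>A\<^esub> (inv\<^bsub>A\<^esub> gen a \<otimes>\<^bsub>A\<^esub> inv\<^bsub>A\<^esub> gen b))"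
    using V by (simp add: cls_inverse[symmetric] cls_mult commutator_word_def)
  ultimately have "(gen a \<otimes>\<^bsub>A\<^esub> gen b) \<otimes>\<^bsub>A\<^esub> inv\<^bsub>A\<^esub> (gen b \<otimes>\<^bsub>A\<^esub> gen a) = \<one>\<^bsub>A\<^esub>"
    using cl by (simp add: A.inv_mult_group A.m_assoc)
  then show ?thesis
    using cl by (metis A.inv_closed A.inv_equality A.inv_inv A.m_closed)
qed

text \<open>The operator of some word representing \<open>x\<close>; by \<open>word_eq_act\<close>
  the choice does not matter on \<open>trace_fun c\<close>.\<close>

definition rho :: "nat \<Rightarrow> 'v word set \<Rightarrow> ('v list \<Rightarrow> real) \<Rightarrow> 'v list \<Rightarrow> real"
  where "rho c x = act c (SOME w. w \<in> words V \<and> x = cls w)"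

lemma trace_op_rho: "trace_op c (rho c x)"
  unfolding rho_def by (rule trace_op_act)

lemmas rho_trace_fun = trace_op_trace_fun[OF trace_op_rho order_refl]
  and linear_rho = trace_op_linear[OF trace_op_rho]
  and rho_prefix = trace_op_prefix[OF trace_op_rho]

lemma rho_cls:
  assumes u: "u \<in> words V" and F: "F \<in> trace_fun c"
  shows "rho c (cls u) F = act c u F"
proof -
  define w where "w = (SOME w. w \<in> words V \<and> cls u = cls w)"
  have "w \<in> words V \<and> cls u = cls w"
    unfolding w_def by (rule someI[of _ u]) (simp add: u)
  then have "word_eq V {commutator_word v w |v w. (v, w) \<in> E} w u"
    using u cls_eq word_eq.sym by blast
  from word_eq_act[OF this F] show ?thesis
    by (simp add: rho_def w_def)
qed

lemma rho_mult:
  assumes "x \<in> carrier A" "y \<in> carrier A" and F: "F \<in> trace_fun c"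
  shows "rho c (x \<otimes>\<^bsub>A\<^esub> y) F = rho c x (rho c y F)"
proof -
  obtain u w where "u \<in> words V" "x = cls u" "w \<in> words V" "y = cls w"
    using carrier_cls assms by metis
  then show ?thesis
    using F by (simp add: cls_mult rho_cls act_trace_fun)
qed

lemma rho_one: "F \<in> trace_fun c \<Longrightarrow> rho c (\<one>\<^bsub>A\<^esub>) F = F"
  by (simp add: cls_Nil[symmetric] rho_cls)

lemma rho_inv:
  assumes "x \<in> carrier A" "F \<in> trace_fun c"
  shows "rho c (inv\<^bsub>A\<^esub> x) (rho c x F) = F" "rho c x (rho c (inv\<^bsub>A\<^esub> x) F) = F"
  using assms rho_mult[of "inv\<^bsub>A\<^esub> x" x F c] rho_mult[of x "inv\<^bsub>A\<^esub> x" F c]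
  by (simp_all add: rho_one)

lemma rho_gen: "v \<in> V \<Longrightarrow> F \<in> trace_fun c \<Longrightarrow> rho c (gen v) F = F + snoc_op v F"
  by (simp add: rho_cls)

text \<open>The value of the functional \<open>F\<close> on the Magnus expansion of
  \<open>x\<close>.\<close>

definition coef :: "nat \<Rightarrow> ('v list \<Rightarrow> real) \<Rightarrow> 'v word set \<Rightarrow> real"
  where "coef c F = (\<lambda>x. if x \<in> carrier A then rho c x F [] else 0)"

text \<open>Translation by \<open>g\<close> turns the coefficient function of \<open>F\<close> into
  that of \<open>rho c g F\<close>, and \<open>rho c g F - F\<close> has lower degree.\<close>

lemma coef_polyf: "d \<le> c \<Longrightarrow> F \<in> trace_fun d \<Longrightarrow> coef c F \<in> polyf A d"
proof (induction d arbitrary: F)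
  case 0
  then have "F = 0" by (simp only: trace_fun_0)
  then have "coef c F x = 0" for x
    by (simp add: coef_def linear_0[OF linear_rho]) (simp add: zero_fun_apply)
  then have "coef c F = 0" by (simp add: fun_eq_iff zero_fun_apply)
  then show ?case by simp
next
  case (Suc d)
  have F: "F \<in> trace_fun c" using trace_fun_mono Suc.prems by blast
  have "rtr A g (coef c F) - coef c F = coef c (rho c g F - F)" if g: "g \<in> carrier A" for g
  proof
    fix x
    show "(rtr A g (coef c F) - coef c F) x = coef c (rho c g F - F) x"
      using g by (simp add: coef_def rtr_def minus_apply rho_mult[OF _ g F] linear_diff[OF linear_rho])
  qed
  moreover have "rho c g F - F \<in> trace_fun d" for g
    using trace_op_diff[OF trace_op_rho, of d c F g] Suc.prems by simp
  ultimately have "rtr A g (coef c F) - coef c F \<in> polyf A d" if "g \<in> carrier A" for g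
    using Suc that by simp
  then show ?case by (simp add: coef_def)
qed

text \<open>\<open>T\<close> is the operator of the Magnus image of the group algebra element. It
  stands inside \<open>rho c x\<close> for right multiplication and outside for left
  multiplication.\<close>

lemma gapair_trace_op:
  assumes "gapair A L R"
  shows "\<exists>T. trace_op c T \<and> (\<forall>F\<in>trace_fun c. \<forall>x\<in>carrier A.
    R (coef c F) x = rho c x (T F) [] \<and> L (coef c F) x = T (rho c x F) [])"
  using assms
proof induction
  case (transl g)
  then have "rtr A g (coef c F) x = rho c x (rho c g F) [] \<and> ltr A g (coef c F) x = rho c g (rho c x F) []"
    if "F \<in> trace_fun c" "x \<in> carrier A" for F x
    using that by (simp add: rtr_def ltr_def coef_def rho_mult)
  then show ?case using trace_op_rho[of c g] by (intro exI[of _ "rho c g"] conjI ballI) simp_all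
next
  case (affine L R L1 R1 L2 R2 r)
  obtain T where T: "trace_op c T" "\<forall>F\<in>trace_fun c. \<forall>x\<in>carrier A.
      R (coef c F) x = rho c x (T F) [] \<and> L (coef c F) x = T (rho c x F) []"
    using affine.IH(1) by (elim exE conjE)
  obtain T1 where T1: "trace_op c T1" "\<forall>F\<in>trace_fun c. \<forall>x\<in>carrier A.
      R1 (coef c F) x = rho c x (T1 F) [] \<and> L1 (coef c F) x = T1 (rho c x F) []"
    using affine.IH(2) by (elim exE conjE)
  obtain T2 where T2: "trace_op c T2" "\<forall>F\<in>trace_fun c. \<forall>x\<in>carrier A.
      R2 (coef c F) x = rho c x (T2 F) [] \<and> L2 (coef c F) x = T2 (rho c x F) []"
    using affine.IH(3) by (elim exE conjE)
  show ?case
  proof (intro exI conjI ballI)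
    show "trace_op c (\<lambda>F. T F + r *\<^sub>R (T1 F - T2 F))"
      by (rule trace_op_affine[OF T(1) T1(1) T2(1)])
    fix F x assume F: "F \<in> trace_fun c" and x: "x \<in> carrier A"
    have "rho c x (T F + r *\<^sub>R (T1 F - T2 F))
        = rho c x (T F) + r *\<^sub>R (rho c x (T1 F) - rho c x (T2 F))"
      by (simp add: linear_add[OF linear_rho] linear_diff[OF linear_rho] linear_scale[OF linear_rho])
    then show "(R (coef c F) + r *\<^sub>R (R1 (coef c F) - R2 (coef c F))) x
        = rho c x (T F + r *\<^sub>R (T1 F - T2 F)) []"
      using F x T(2) T1(2) T2(2) by (simp add: fun_apply)
    show "(L (coef c F) + r *\<^sub>R (L1 (coef c F) - L2 (coef c F))) x
        = (T (rho c x F) + r *\<^sub>R (T1 (rho c x F) - T2 (rho c x F))) []"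
      using F x T(2) T1(2) T2(2) by (simp add: fun_apply)
  qed
qed

text \<open>The relation \<open>\<phi>(a) u = u a\<close> is carried from the group algebra to power
  series.\<close>

lemma unit_inner_trace_op:
  assumes \<phi>: "\<phi> \<in> unit_inner A c"
  obtains T where "trace_op c T"
    "\<And>x F. x \<in> carrier A \<Longrightarrow> F \<in> trace_fun c \<Longrightarrow> rho c (\<phi> x) (T F) = T (rho c x F)"
proof -
  obtain L R where LR: "gapair A L R" and eq: "\<And>f. f \<in> polyf A c \<Longrightarrow> pull A \<phi> (R f) = L f"
    using \<phi> by (auto simp: unit_inner_def)
  obtain T where T: "trace_op c T" and TLR: "\<And>F x. F \<in> trace_fun c \<Longrightarrow> x \<in> carrier A \<Longrightarrow>
      R (coef c F) x = rho c x (T F) [] \<and> L (coef c F) x = T (rho c x F) []"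
    using gapair_trace_op[OF LR] by blast
  have Nil: "rho c (\<phi> x) (T F) [] = T (rho c x F) []" if x: "x \<in> carrier A" and F: "F \<in> trace_fun c" for x F
  proof -
    have "\<phi> x \<in> carrier A"
      by (rule A.auto_closed[OF A.IA_auto[OF A.unit_inner_IA[OF \<phi>]] x])
    then have "rho c (\<phi> x) (T F) [] = pull A \<phi> (R (coef c F)) x"
      using TLR[OF F, of "\<phi> x"] x by (simp add: pull_def)
    then show ?thesis
      using TLR[OF F x] eq[OF coef_polyf[OF order_refl F]] by simp
  qed
  \<comment> \<open>The identity at the empty word, applied to \<open>prefix_op w F\<close>, gives
    the identity at \<open>w\<close>, since all operators commute with
    \<open>prefix_op\<close>.\<close>
  have "rho c (\<phi> x) (T F) w = T (rho c x F) w" if x: "x \<in> carrier A" and F: "F \<in> trace_fun c" for x F w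
    using Nil[OF x prefix_op_trace_fun[OF F, of w]]
    unfolding trace_op_prefix[OF T] rho_prefix by (simp add: prefix_op_def)
  then have "rho c (\<phi> x) (T F) = T (rho c x F)" if "x \<in> carrier A" "F \<in> trace_fun c" for x F
    using that by blast
  with T show thesis using that by blast
qed

text \<open>\<open>(1 + v)^e\<close> is \<open>1 + e v\<close> modulo \<open>v^2\<close>, for
  negative \<open>e\<close> as well.\<close>

lemma rho_gen_pow:
  assumes v: "v \<in> V" and F: "F \<in> trace_fun c" and zero: "snoc_op v (snoc_op v F) = 0"
  shows "rho c (gen v [^]\<^bsub>A\<^esub> (e :: int)) F = F + of_int e *\<^sub>R snoc_op v F"
proof -
  note g = gen_closed[OF v]
  have snoc: "snoc_op v H \<in> trace_fun c" if "H \<in> trace_fun c" for H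
    by (rule snoc_op_trace_fun[OF trace_fun_mono[OF that]]) simp
  have nat: "rho c (gen v [^]\<^bsub>A\<^esub> n) H = H + real n *\<^sub>R snoc_op v H"
    if "H \<in> trace_fun c" "snoc_op v (snoc_op v H) = 0" for n H
    using that
  proof (induction n arbitrary: H)
    case 0
    then show ?case by (simp add: rho_one)
  next
    case (Suc n)
    have "rho c (gen v [^]\<^bsub>A\<^esub> n) (snoc_op v H) = snoc_op v H"
      using Suc.IH[OF snoc[OF Suc.prems(1)]] Suc.prems(2) by (simp add: linear_0[OF linear_snoc_op])
    then show ?case
      using Suc g by (simp add: rho_mult rho_gen[OF v] linear_add[OF linear_rho] scaleR_add_left)
  qed
  show ?thesis
  proof (cases e rule: int_cases2)
    case (nonneg n)
    then show ?thesis using nat[OF F zero] by (simp add: int_pow_int)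
  next
    case (nonpos n)
    \<comment> \<open>The expected image of \<open>F\<close> under the inverse power; it is
      confirmed by applying the positive power to it.\<close>
    define H where "H = F - real n *\<^sub>R snoc_op v F"
    have H: "H \<in> trace_fun c"
      unfolding H_def
      by (intro subspace_diff[OF subspace_trace_fun] subspace_scale[OF subspace_trace_fun] F snoc)
    have "snoc_op v H = snoc_op v F"
      by (simp add: H_def linear_diff[OF linear_snoc_op] linear_scale[OF linear_snoc_op] zero)
    then have "rho c (gen v [^]\<^bsub>A\<^esub> n) H = F"
      using nat[OF H, of n] zero by (simp add: H_def)
    then have "rho c (inv\<^bsub>A\<^esub> (gen v [^]\<^bsub>A\<^esub> n)) F = H"
      using rho_inv(1)[OF A.nat_pow_closed[OF g] H] by metis
    then show ?thesis
      using nonpos g by (simp add: A.int_pow_neg_int H_def)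
  qed
qed

section \<open>Syllable decompositions\<close>

text \<open>Zero exponents and equal neighbouring letters are allowed; where reduced forms are
  wanted, minimal length excludes them.\<close>

definition syllables :: "('v \<times> int) list \<Rightarrow> bool"
  where "syllables es \<longleftrightarrow> fst ` set es \<subseteq> V"

definition val :: "('v \<times> int) list \<Rightarrow> 'v word set"
  where "val es = foldr (\<lambda>(v, e) y. gen v [^]\<^bsub>A\<^esub> e \<otimes>\<^bsub>A\<^esub> y) es (\<one>\<^bsub>A\<^esub>)"

lemma syllables_simps [simp]: "syllables []" "syllables (s # es) \<longleftrightarrow> fst s \<in> V \<and> syllables es"
  "syllables (es @ fs) \<longleftrightarrow> syllables es \<and> syllables fs"
  by (auto simp: syllables_def)

lemma val_simps [simp]: "val [] = \<one>\<^bsub>A\<^esub>" "val ((v, e) # es) = gen v [^]\<^bsub>A\<^esub> e \<otimes>\<^bsub>A\<^esub> val es"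
  by (simp_all add: val_def)

lemma val_closed: "syllables es \<Longrightarrow> val es \<in> carrier A"
  by (induction es) (auto simp: gen_closed)

lemma val_append: "syllables es \<Longrightarrow> syllables fs \<Longrightarrow> val (es @ fs) = val es \<otimes>\<^bsub>A\<^esub> val fs"
  by (induction es) (auto simp: gen_closed val_closed A.m_assoc)

lemma syllables_exist:
  assumes "x \<in> carrier A"
  shows "\<exists>es. syllables es \<and> val es = x"
proof -
  obtain u where "u \<in> words V" "x = cls u"
    using assms by (rule carrier_cls)
  then show ?thesis
  proof (induction u arbitrary: x)
    case Nil
    then show ?case by (intro exI[of _ "[]"]) (simp add: cls_Nil)
  next
    case (Cons a u)
    obtain v b where a: "a = (v, b)" by force
    have v: "v \<in> V" and u: "u \<in> words V" using Cons.prems a by auto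
    obtain es where es: "syllables es" "val es = cls u"
      using Cons.IH[OF u HOL.refl] by blast
    have "x = cls [a] \<otimes>\<^bsub>A\<^esub> val es"
      using cls_mult[of "[a]" u] v u a es(2) Cons.prems by simp
    moreover have "cls [a] = gen v [^]\<^bsub>A\<^esub> (if b then 1 else - 1 :: int)"
      using a v by (auto simp: cls_inverse gen_closed A.int_pow_neg A.int_pow_1)
    ultimately show ?case
      using es(1) v by (intro exI[of _ "(v, if b then 1 else - 1) # es"]) simp
  qed
qed

lemma val_swap:
  assumes "syllables es" "swap (map fst es) m"
  shows "\<exists>es'. syllables es' \<and> map fst es' = m \<and> val es' = val es"
proof -
  obtain p q a b where ab: "(a, b) \<in> E" "map fst es = p @ a # b # q" and m: "m = p @ b # a # q"
    using assms(2) by (auto simp: swap.simps)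
  then obtain es1 e f es2 where es: "es = es1 @ (a, e) # (b, f) # es2" "p = map fst es1" "q = map fst es2"
    by (auto simp: map_eq_append_conv map_eq_Cons_conv append_eq_map_conv Cons_eq_map_conv)
  have V: "a \<in> V" "b \<in> V" using ab E_V by auto
  note g = gen_closed[OF V(1)] gen_closed[OF V(2)]
  have "gen b \<otimes>\<^bsub>A\<^esub> gen a [^]\<^bsub>A\<^esub> e = gen a [^]\<^bsub>A\<^esub> e \<otimes>\<^bsub>A\<^esub> gen b"
    using A.int_pow_commute[OF g gen_commute[OF ab(1)]] by simp
  from A.int_pow_commute[OF g(2) A.int_pow_closed[OF g(1)] this]
  have "gen b [^]\<^bsub>A\<^esub> f \<otimes>\<^bsub>A\<^esub> (gen a [^]\<^bsub>A\<^esub> e \<otimes>\<^bsub>A\<^esub> val es2)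
      = gen a [^]\<^bsub>A\<^esub> e \<otimes>\<^bsub>A\<^esub> (gen b [^]\<^bsub>A\<^esub> f \<otimes>\<^bsub>A\<^esub> val es2)"
    using g val_closed[of es2] assms(1) es(1) by (simp add: A.m_assoc[symmetric])
  then have "val (es1 @ (b, f) # (a, e) # es2) = val es"
    using assms(1) es(1) V by (simp add: val_append)
  then show ?thesis
    using es assms(1) m by (intro exI[of _ "es1 @ (b, f) # (a, e) # es2"]) simp
qed

lemma val_teq:
  assumes "syllables es" "teq (map fst es) m"
  shows "\<exists>es'. syllables es' \<and> map fst es' = m \<and> val es' = val es"
  using assms(2) unfolding teq_def
proof (induction rule: rtranclp_induct)
  case base
  then show ?case using assms(1) by blast
next
  case (step m m')
  then obtain es' where "syllables es'" "map fst es' = m" "val es' = val es" by blast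
  then show ?case using val_swap[of es' m'] step.hyps(2) by simp
qed

lemma val_merge:
  "v \<in> V \<Longrightarrow> syllables es \<Longrightarrow> val ((v, e) # (v, f) # es) = val ((v, e + f) # es)"
  using gen_closed val_closed by (simp add: A.int_pow_mult A.m_assoc)

definition square_zero :: "('v list \<Rightarrow> real) \<Rightarrow> bool"
  where "square_zero F \<longleftrightarrow> (\<forall>p a q. F (p @ a # a # q) = 0)"

text \<open>On functions vanishing on all words with a square, \<open>v\<^sup>e\<close> acts as \<open>1 + e v\<close>.\<close>

lemma rho_val_top:
  assumes "syllables es" "F \<in> trace_fun c" "square_zero F" "\<And>w. length w < length es \<Longrightarrow> F w = 0"
  shows "rho c (val es) F [] = real_of_int (prod_list (map snd es)) * F (map fst es)"
  using assms
proof (induction es arbitrary: F rule: rev_induct)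
  case Nil
  then show ?case by (simp add: rho_one)
next
  case (snoc s es)
  obtain v e where s: "s = (v, e)" by force
  have v: "v \<in> V" and es: "syllables es" using snoc.prems(1) s by auto
  have F': "snoc_op v F \<in> trace_fun c"
    by (rule snoc_op_trace_fun[OF trace_fun_mono[OF snoc.prems(2)]]) simp
  have "snoc_op v (snoc_op v F) = 0"
    using snoc.prems(3) by (auto simp: snoc_op_def square_zero_def fun_eq_iff zero_fun_apply)
  then have "rho c (val (es @ [s])) F = rho c (val es) (F + of_int e *\<^sub>R snoc_op v F)"
    using v es s gen_closed[OF v] val_closed[OF es] snoc.prems(2)
    by (simp add: val_append rho_mult rho_gen_pow)
  then have "rho c (val (es @ [s])) F [] = rho c (val es) F [] + e * rho c (val es) (snoc_op v F) []"
    by (simp add: linear_add[OF linear_rho] linear_scale[OF linear_rho] fun_apply)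
  \<comment> \<open>Without the last syllable the top word is too short for \<open>F\<close> to be
    nonzero on it.\<close>
  also have "rho c (val es) F [] = 0"
    using snoc.IH[OF es snoc.prems(2,3)] snoc.prems(4) by simp
  also have "rho c (val es) (snoc_op v F) [] = real_of_int (prod_list (map snd es)) * snoc_op v F (map fst es)"
  proof (rule snoc.IH[OF es F'])
    show "square_zero (snoc_op v F)"
      using snoc.prems(3) by (auto simp: snoc_op_def square_zero_def)
    show "snoc_op v F w = 0" if "length w < length es" for w
      using that snoc.prems(4)[of "w @ [v]"] by (simp add: snoc_op_def)
  qed
  finally show ?case
    by (simp add: s snoc_op_def)
qed

end

section \<open>Vanishing coefficients of commuting series, and cyclic words\<close>

context commutation
begin

text \<open>Compare the coefficients of \<open>t v\<close> on both sides of the commutation relation, after moving a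
  leading \<open>v\<close> of \<open>t\<close> to the end.\<close>

lemma trace_op_commuting_coefficient:
  assumes T: "trace_op c T" and comm: "\<And>F. F \<in> trace_fun c \<Longrightarrow> T (snoc_op v F) = snoc_op v (T F)"
    and t: "square_free t" "length t + 1 < c" and b: "b \<in> set t" "b \<noteq> v" "(b, v) \<notin> E"
  shows "T (trace_ind t) [] = 0"
proof -
  \<comment> \<open>Both sides are the value of \<open>T F\<close> at the word
    \<open>[v]\<close>.\<close>
  have key: "T (snoc_op v F) [] = T (prefix_op [v] F) []" if "F \<in> trace_fun c" for F
    unfolding comm[OF that] trace_op_prefix[OF T] by (simp add: snoc_op_def prefix_op_def)
  \<comment> \<open>For the indicator of \<open>t v\<close>, one side of \<open>key\<close> sees
    \<open>t\<close>, while the other vanishes: the letter \<open>b\<close> keeps the final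
    \<open>v\<close> from moving to the front.\<close>
  have no_left: "T (trace_ind t) [] = 0"
    if "\<And>u. \<not> teq t (v # u)" "length t + 1 < c" "b \<in> set t" for t
  proof -
    have "snoc_op v (trace_ind (t @ [v])) = trace_ind t"
      by (simp add: snoc_op_def trace_ind_def)
    moreover have "\<not> teq (t @ [v]) (v # u)" for u
      using teq_snoc_left[of t v u] that b by blast
    then have "prefix_op [v] (trace_ind (t @ [v])) = 0"
      by (simp add: prefix_op_def trace_ind_def fun_eq_iff zero_fun_apply)
    ultimately have "T (trace_ind t) [] = T 0 []"
      using key[OF trace_ind_trace_fun[of "t @ [v]" c]] that(2) by simp
    then show ?thesis
      by (simp add: linear_0[OF trace_op_linear[OF T]]) (simp add: zero_fun_apply)
  qed
  show ?thesis
  proof (cases "\<exists>u. teq t (v # u)")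
    case False
    then show ?thesis using no_left t(2) b(1) by blast
  next
    case True
    then obtain u where u: "teq t (v # u)" ..
    have bu: "b \<in> set u" using teq_set[OF u] b by auto
    have len: "length t = Suc (length u)" using teq_length[OF u] by simp
    \<comment> \<open>Square-freeness leaves no second \<open>v\<close> at the front, so
      \<open>u v\<close> falls under the case already treated.\<close>
    have "\<not> teq u (v # s)" for s
    proof
      assume "teq u (v # s)"
      then have "teq t (v # v # s)" using u by (meson teq_Cons teq_trans)
      then show False using t(1) unfolding square_free_def by (metis append_Nil)
    qed
    then have "\<not> teq (u @ [v]) (v # s)" for s
      using teq_snoc_left[of u v s] bu b by blast
    then have "T (trace_ind (u @ [v])) [] = 0"
      using t(2) bu len by (intro no_left) auto
    moreover have "trace_ind t = snoc_op v (trace_ind (v # u @ [v]))"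
    proof
      fix w
      have "teq (v # u @ [v]) (w @ [v]) \<longleftrightarrow> teq (v # u) w"
        using teq_snoc_iff[of "v # u" v w] by simp
      also have "\<dots> \<longleftrightarrow> teq t w" using u teq_sym teq_trans by blast
      finally show "trace_ind t w = snoc_op v (trace_ind (v # u @ [v])) w"
        by (simp add: trace_ind_def snoc_op_def)
    qed
    moreover have "prefix_op [v] (trace_ind (v # u @ [v])) = trace_ind (u @ [v])"
      by (simp add: prefix_op_def trace_ind_def)
    ultimately show ?thesis
      using key[OF trace_ind_trace_fun[of "v # u @ [v]" c]] t(2) len by simp
  qed
qed

text \<open>Swaps and rotations can be realized on syllables without leaving the conjugacy class of
  the value.\<close>

definition cyc_step :: "'v list \<Rightarrow> 'v list \<Rightarrow> bool"
  where "cyc_step u w \<longleftrightarrow> swap u w \<or> (\<exists>p q. u = p @ q \<and> w = q @ p)"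

definition ceq :: "'v list \<Rightarrow> 'v list \<Rightarrow> bool"
  where "ceq = cyc_step\<^sup>*\<^sup>*"

lemma ceq_step: "ceq m u \<Longrightarrow> cyc_step u w \<Longrightarrow> ceq m w"
  unfolding ceq_def by (rule rtranclp.rtrancl_into_rtrancl)

lemma cyc_step_sym: "cyc_step u w \<Longrightarrow> cyc_step w u"
  unfolding cyc_step_def using swap_sym by blast

lemma ceq_mset: "ceq u w \<Longrightarrow> mset u = mset w"
  unfolding ceq_def
  by (induction rule: rtranclp_induct) (auto simp: cyc_step_def dest: teq_mset[OF swap_teq])

lemma ceq_length: "ceq u w \<Longrightarrow> length u = length w"
  using ceq_mset size_mset by metis

definition cyc_ind :: "'v list \<Rightarrow> 'v list \<Rightarrow> real"
  where "cyc_ind m = (\<lambda>w. if ceq m w then 1 else 0)"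

lemma cyc_ind_step: "cyc_step u w \<Longrightarrow> cyc_ind m u = cyc_ind m w"
  unfolding cyc_ind_def using ceq_step cyc_step_sym by metis

lemma cyc_ind_trace_fun: "length m < c \<Longrightarrow> cyc_ind m \<in> trace_fun c"
  using ceq_length cyc_ind_step by (auto simp: trace_fun_def cyc_step_def) (auto simp: cyc_ind_def)

end

context group
begin

text \<open>Allows an automorphism to be normalized by an inner one while staying in every
  \<open>unit_inner G c\<close>.\<close>

lemma conjugation_unit_inner_mult:
  assumes k: "k \<in> carrier G" and \<phi>: "\<And>c. \<phi> \<in> unit_inner G c"
  obtains \<psi> where "\<And>c. \<psi> \<in> unit_inner G c" "\<And>x. x \<in> carrier G \<Longrightarrow> \<psi> x = k \<otimes> \<phi> x \<otimes> inv k"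
proof
  let ?\<psi> = "conjugation G k \<otimes>\<^bsub>IA_group G\<^esub> \<phi>"
  show "?\<psi> \<in> unit_inner G c" for c
    by (rule subgroup.m_closed[OF subgroup_unit_inner conjugation_unit_inner[OF k] \<phi>])
  have aut: "\<phi> \<in> auto G" by (rule IA_auto[OF unit_inner_IA[OF \<phi>]])
  then show "?\<psi> x = k \<otimes> \<phi> x \<otimes> inv k" if "x \<in> carrier G" for x
    using that auto_closed[OF aut that]
    by (simp add: IA_group_def AutoGroup_mult conjugation_auto[OF k] compose_eq)
      (simp add: conjugation_def)
qed

lemma mult_inv_cancel:
  assumes "y \<in> carrier G" "z \<in> carrier G"
  shows "y \<otimes> (inv y \<otimes> z) = z" "inv y \<otimes> (y \<otimes> z) = z"
  using assms by (simp_all flip: m_assoc)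

lemma conj_cyclic:
  assumes "g \<in> carrier G" "y \<in> carrier G" "z \<in> carrier G"
  shows "g \<otimes> (y \<otimes> z) \<otimes> inv g = (g \<otimes> y) \<otimes> (z \<otimes> y) \<otimes> inv (g \<otimes> y)"
  using assms by (simp add: inv_mult_group m_assoc mult_inv_cancel)

end

section \<open>From conjugating series to conjugating group elements\<close>

context raag
begin

lemma val_remove_zero:
  assumes "syllables es" "0 \<in> snd ` set es"
  obtains es' where "syllables es'" "val es' = val es" "length es' < length es"
proof -
  obtain a where "(a, 0) \<in> set es" using assms(2) by force
  then obtain es1 es2 where es: "es = es1 @ (a, 0) # es2" by (auto dest: split_list)
  then have "val (es1 @ es2) = val es"
    using assms(1) by (simp add: val_append gen_closed val_closed)
  then show thesis using that[of "es1 @ es2"] es assms(1) by simp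
qed

lemma val_merge_square:
  assumes "syllables es" "map fst es = p @ a # a # q"
  obtains es' where "syllables es'" "val es' = val es" "length es' < length es"
proof -
  obtain es1 e f es2 where es: "es = es1 @ (a, e) # (a, f) # es2"
    using assms(2) by (auto simp: map_eq_append_conv map_eq_Cons_conv)
  then have "val (es1 @ (a, e + f) # es2) = val es"
    using assms(1) val_merge[of a es2 e f] by (simp add: val_append del: val_simps)
  then show thesis using that[of "es1 @ (a, e + f) # es2"] es assms(1) by simp
qed

text \<open>Rotation invariance makes \<open>snoc_op v F\<close> equal to
  \<open>prefix_op [v] F\<close>, which settles generators; the elements \<open>y\<close> that work
  for all \<open>x\<close> are closed under products and inverses.\<close>

lemma coef_class_function:
  assumes F: "F \<in> trace_fun c" and cyc: "\<And>u v. F (v # u) = F (u @ [v])"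
    and x: "x \<in> carrier A" and y: "y \<in> carrier A"
  shows "coef c F (x \<otimes>\<^bsub>A\<^esub> y) = coef c F (y \<otimes>\<^bsub>A\<^esub> x)"
proof -
  define Z where "Z = {y \<in> carrier A. \<forall>x\<in>carrier A. coef c F (x \<otimes>\<^bsub>A\<^esub> y) = coef c F (y \<otimes>\<^bsub>A\<^esub> x)}"
  have gen: "gen v \<in> Z" if v: "v \<in> V" for v
  proof -
    have snoc: "snoc_op v F = prefix_op [v] F"
      using cyc by (simp add: snoc_op_def prefix_op_def)
    have "coef c F (x \<otimes>\<^bsub>A\<^esub> gen v) = coef c F (gen v \<otimes>\<^bsub>A\<^esub> x)" if x: "x \<in> carrier A" for x
    proof -
      have "rho c x (snoc_op v F) [] = rho c x F [v]"
        unfolding snoc rho_prefix by (simp add: prefix_op_def)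
      then show ?thesis
        using x gen_closed[OF v] F
        by (simp add: coef_def rho_mult rho_gen[OF v] rho_trace_fun linear_add[OF linear_rho] fun_apply
            snoc_op_def[of v "rho c x F"])
    qed
    then show ?thesis using gen_closed[OF v] by (simp add: Z_def)
  qed
  have inv: "inv\<^bsub>A\<^esub> z \<in> Z" if z: "z \<in> Z" for z
  proof -
    have zc: "z \<in> carrier A" using z by (simp add: Z_def)
    have "coef c F (x \<otimes>\<^bsub>A\<^esub> inv\<^bsub>A\<^esub> z) = coef c F (inv\<^bsub>A\<^esub> z \<otimes>\<^bsub>A\<^esub> x)" if x: "x \<in> carrier A" for x
    proof -
      \<comment> \<open>Chosen so that \<open>z w = x z^-1\<close> and \<open>w z = z^-1 x\<close>:
        the property of \<open>z\<close> at \<open>w\<close> is the property of \<open>z^-1\<close>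
        at \<open>x\<close>.\<close>
      define w where "w = inv\<^bsub>A\<^esub> z \<otimes>\<^bsub>A\<^esub> x \<otimes>\<^bsub>A\<^esub> inv\<^bsub>A\<^esub> z"
      have w: "w \<in> carrier A" using x zc by (simp add: w_def)
      have "z \<otimes>\<^bsub>A\<^esub> w = x \<otimes>\<^bsub>A\<^esub> inv\<^bsub>A\<^esub> z" "w \<otimes>\<^bsub>A\<^esub> z = inv\<^bsub>A\<^esub> z \<otimes>\<^bsub>A\<^esub> x"
        using x zc by (simp_all add: w_def A.m_assoc) (simp_all add: A.m_assoc[symmetric])
      moreover have "coef c F (w \<otimes>\<^bsub>A\<^esub> z) = coef c F (z \<otimes>\<^bsub>A\<^esub> w)"
        using z w by (simp add: Z_def)
      ultimately show ?thesis by simp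
    qed
    then show ?thesis using zc by (simp add: Z_def)
  qed
  have mult: "z \<otimes>\<^bsub>A\<^esub> w \<in> Z" if z: "z \<in> Z" and w: "w \<in> Z" for z w
  proof -
    have c: "z \<in> carrier A" "w \<in> carrier A" using z w by (simp_all add: Z_def)
    have "coef c F (x \<otimes>\<^bsub>A\<^esub> (z \<otimes>\<^bsub>A\<^esub> w)) = coef c F (z \<otimes>\<^bsub>A\<^esub> w \<otimes>\<^bsub>A\<^esub> x)" if x: "x \<in> carrier A" for x
    proof -
      have "coef c F ((x \<otimes>\<^bsub>A\<^esub> z) \<otimes>\<^bsub>A\<^esub> w) = coef c F (w \<otimes>\<^bsub>A\<^esub> (x \<otimes>\<^bsub>A\<^esub> z))"
        using w A.m_closed[OF x c(1)] by (simp add: Z_def)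
      also have "\<dots> = coef c F ((w \<otimes>\<^bsub>A\<^esub> x) \<otimes>\<^bsub>A\<^esub> z)" using x c by (simp add: A.m_assoc)
      also have "\<dots> = coef c F (z \<otimes>\<^bsub>A\<^esub> (w \<otimes>\<^bsub>A\<^esub> x))"
        using z A.m_closed[OF c(2) x] by (simp add: Z_def)
      finally show ?thesis using x c by (simp add: A.m_assoc)
    qed
    then show ?thesis using c by (simp add: Z_def)
  qed
  obtain u where "u \<in> words V" "y = cls u" using y by (rule carrier_cls)
  then have "y \<in> Z"
  proof (induction u arbitrary: y)
    case Nil
    then show ?case by (simp add: Z_def cls_Nil)
  next
    case (Cons a u)
    obtain v b where a: "a = (v, b)" by force
    have v: "v \<in> V" and u: "u \<in> words V" using Cons.prems a by auto
    have "cls [a] \<in> Z"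
      using gen[OF v] inv[OF gen[OF v]] a by (cases b) (simp_all add: cls_inverse[OF v])
    moreover have "cls u \<in> Z" by (rule Cons.IH[OF u HOL.refl])
    moreover have "y = cls [a] \<otimes>\<^bsub>A\<^esub> cls u"
      using cls_mult[of "[a]" u] v u a Cons.prems by simp
    ultimately show ?case using mult by simp
  qed
  with x show ?thesis by (simp add: Z_def)
qed

text \<open>The coefficient of \<open>1 + v\<close> at the monomial \<open>v\<close> is 1.\<close>

lemma gen_nontrivial:
  assumes v: "v \<in> V"
  shows "gen v \<noteq> \<one>\<^bsub>A\<^esub>"
proof
  assume eq: "gen v = \<one>\<^bsub>A\<^esub>"
  have F: "trace_ind [v] \<in> trace_fun 2" by (rule trace_ind_trace_fun) simp
  have "trace_ind [v] + snoc_op v (trace_ind [v]) = trace_ind [v]"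
    using rho_gen[OF v F] rho_one[OF F] eq by simp
  then have "snoc_op v (trace_ind [v]) = 0" by simp
  then have "snoc_op v (trace_ind [v]) [] = 0" by (simp only: zero_fun_apply)
  then show False by (simp add: snoc_op_def trace_ind_def)
qed

lemma conj_val_step:
  assumes es: "syllables es" and g: "g \<in> carrier A" and step: "cyc_step (map fst es) m"
  shows "\<exists>es' g'. syllables es' \<and> g' \<in> carrier A \<and> map fst es' = m \<and>
    g' \<otimes>\<^bsub>A\<^esub> val es' \<otimes>\<^bsub>A\<^esub> inv\<^bsub>A\<^esub> g' = g \<otimes>\<^bsub>A\<^esub> val es \<otimes>\<^bsub>A\<^esub> inv\<^bsub>A\<^esub> g"
proof -
  from step consider "swap (map fst es) m" | p q where "map fst es = p @ q" "m = q @ p"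
    by (auto simp: cyc_step_def)
  then show ?thesis
  proof cases
    case 1
    then show ?thesis using val_swap[OF es] g by metis
  next
    case (2 p q)
    then obtain es1 es2 where es12: "es = es1 @ es2" "p = map fst es1" "q = map fst es2"
      by (auto simp: map_eq_append_conv)
    with es have S: "syllables es1" "syllables es2" by auto
    note c = val_closed[OF S(1)] val_closed[OF S(2)]
    show ?thesis
      using S 2 es12 A.conj_cyclic[OF g c] g c
      by (intro exI[of _ "es2 @ es1"] exI[of _ "g \<otimes>\<^bsub>A\<^esub> val es1"]) (simp add: val_append)
  qed
qed

lemma conj_val_ceq:
  assumes "syllables es" "g \<in> carrier A" "ceq (map fst es) m"
  shows "\<exists>es' g'. syllables es' \<and> g' \<in> carrier A \<and> map fst es' = m \<and>
    g' \<otimes>\<^bsub>A\<^esub> val es' \<otimes>\<^bsub>A\<^esub> inv\<^bsub>A\<^esub> g' = g \<otimes>\<^bsub>A\<^esub> val es \<otimes>\<^bsub>A\<^esub> inv\<^bsub>A\<^esub> g"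
  using assms(3) unfolding ceq_def
proof (induction rule: rtranclp_induct)
  case base
  then show ?case using assms(1,2) by blast
next
  case (step m m')
  then obtain es' g' where *: "syllables es'" "g' \<in> carrier A" "map fst es' = m"
    "g' \<otimes>\<^bsub>A\<^esub> val es' \<otimes>\<^bsub>A\<^esub> inv\<^bsub>A\<^esub> g' = g \<otimes>\<^bsub>A\<^esub> val es \<otimes>\<^bsub>A\<^esub> inv\<^bsub>A\<^esub> g"
    by blast
  then show ?case using conj_val_step[OF *(1,2), of m'] step.hyps(2) by simp
qed

text \<open>Class functions detect a cyclically reduced conjugate of \<open>\<phi>(v)\<close>: its top cyclic coefficient
  has to occur in \<open>1 + v\<close>.\<close>

lemma unit_inner_gen_conjugate:
  assumes \<phi>: "\<And>c. \<phi> \<in> unit_inner A c" and v: "v \<in> V"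
  shows "\<exists>g\<in>carrier A. \<phi> (gen v) = g \<otimes>\<^bsub>A\<^esub> gen v \<otimes>\<^bsub>A\<^esub> inv\<^bsub>A\<^esub> g"
proof -
  have aut: "\<phi> \<in> auto A" by (rule A.IA_auto[OF A.unit_inner_IA[OF \<phi>]])
  note gv = gen_closed[OF v]
  have \<phi>v: "\<phi> (gen v) \<in> carrier A" by (rule A.auto_closed[OF aut gv])
  \<comment> \<open>\<open>es\<close> spells a conjugate of \<open>\<phi>(v)\<close>; a shortest
    such list serves as the cyclically reduced form.\<close>
  define P where "P es \<longleftrightarrow> syllables es \<and>
    (\<exists>g\<in>carrier A. \<phi> (gen v) = g \<otimes>\<^bsub>A\<^esub> val es \<otimes>\<^bsub>A\<^esub> inv\<^bsub>A\<^esub> g)" for es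
  obtain es0 where "syllables es0" "val es0 = \<phi> (gen v)" using syllables_exist[OF \<phi>v] by blast
  then have "P es0" unfolding P_def using \<phi>v by (intro conjI bexI[of _ "\<one>\<^bsub>A\<^esub>"]) simp_all
  then obtain es where "P es" and min: "\<And>es'. P es' \<Longrightarrow> length es \<le> length es'"
    using ex_has_least_nat[of P es0 length] by blast
  then obtain g where es: "syllables es" and g: "g \<in> carrier A"
    and \<phi>_eq: "\<phi> (gen v) = g \<otimes>\<^bsub>A\<^esub> val es \<otimes>\<^bsub>A\<^esub> inv\<^bsub>A\<^esub> g"
    unfolding P_def by blast
  define m where "m = map fst es"
  have nonzero: "prod_list (map snd es) \<noteq> 0"
  proof
    assume "prod_list (map snd es) = 0"
    then have "0 \<in> snd ` set es" by (simp add: prod_list_zero_iff)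
    then obtain es' where "syllables es'" "val es' = val es" "length es' < length es"
      by (rule val_remove_zero[OF es])
    then show False using min[of es'] \<phi>_eq g unfolding P_def by fastforce
  qed
  define c where "c = length m + 2"
  have F: "cyc_ind m \<in> trace_fun c" by (rule cyc_ind_trace_fun) (simp add: c_def)
  \<comment> \<open>A square anywhere in the cyclic class of \<open>m\<close> could be merged,
    giving a shorter list spelling a conjugate.\<close>
  have sq: "square_zero (cyc_ind m)"
    unfolding square_zero_def
  proof (intro allI)
    fix p a q
    have "\<not> ceq m (p @ a # a # q)"
    proof
      assume "ceq m (p @ a # a # q)"
      then obtain es1 g1 where 1: "syllables es1" "g1 \<in> carrier A" "map fst es1 = p @ a # a # q"
        "g1 \<otimes>\<^bsub>A\<^esub> val es1 \<otimes>\<^bsub>A\<^esub> inv\<^bsub>A\<^esub> g1 = \<phi> (gen v)"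
        unfolding m_def \<phi>_eq using conj_val_ceq[OF es g] by blast
      obtain es2 where 2: "syllables es2" "val es2 = val es1" "length es2 < length es1"
        by (rule val_merge_square[OF 1(1,3)])
      have "length es1 = length es"
        using ceq_length[OF \<open>ceq m (p @ a # a # q)\<close>] 1(3) unfolding m_def by (metis length_map)
      moreover have "P es2"
        unfolding P_def using 1 2 by (intro conjI bexI[of _ g1]) simp_all
      ultimately show False using min[of es2] 2(3) by simp
    qed
    then show "cyc_ind m (p @ a # a # q) = 0" by (simp add: cyc_ind_def)
  qed
  have short: "cyc_ind m w = 0" if "length w < length es" for w
    using that ceq_length[of m w] by (auto simp: cyc_ind_def m_def)
  have central: "coef c (cyc_ind m) (x \<otimes>\<^bsub>A\<^esub> y) = coef c (cyc_ind m) (y \<otimes>\<^bsub>A\<^esub> x)"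
    if "x \<in> carrier A" "y \<in> carrier A" for x y
  proof (rule coef_class_function[OF F _ that])
    have "cyc_step (v # u) (u @ [v])" for u v
      unfolding cyc_step_def by (intro disjI2 exI[of _ "[v]"] exI[of _ u]) simp
    then show "cyc_ind m (v # u) = cyc_ind m (u @ [v])" for u v
      by (rule cyc_ind_step)
  qed
  note ves = val_closed[OF es]
  have "coef c (cyc_ind m) (\<phi> (gen v)) = coef c (cyc_ind m) (gen v)"
    by (rule A.unit_inner_class_function[OF \<phi> coef_polyf[OF order_refl F] central gv])
  moreover have "coef c (cyc_ind m) (\<phi> (gen v)) = coef c (cyc_ind m) (val es)"
    using central[OF A.m_closed[OF g ves] A.inv_closed[OF g]] g ves
    by (simp add: \<phi>_eq A.m_assoc[symmetric])
  moreover have "coef c (cyc_ind m) (val es) = real_of_int (prod_list (map snd es))"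
    using rho_val_top[OF es F sq short] ves by (simp add: coef_def m_def cyc_ind_def ceq_def)
  moreover have "coef c (cyc_ind m) (gen v) = cyc_ind m [] + cyc_ind m [v]"
    using gv by (simp add: coef_def rho_gen[OF v F] fun_apply snoc_op_def)
  ultimately have top: "real_of_int (prod_list (map snd es)) = cyc_ind m [] + cyc_ind m [v]"
    by simp
  show ?thesis
  proof (cases es)
    case Nil
    then have "\<phi> (gen v) = \<one>\<^bsub>A\<^esub>" using g by (simp add: \<phi>_eq)
    moreover have "\<phi> (\<one>\<^bsub>A\<^esub>) = \<one>\<^bsub>A\<^esub>"
      using A.auto_mult[OF aut, of "\<one>\<^bsub>A\<^esub>" "\<one>\<^bsub>A\<^esub>"] A.auto_closed[OF aut, of "\<one>\<^bsub>A\<^esub>"] by simp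
    ultimately have "gen v = \<one>\<^bsub>A\<^esub>"
      using inj_onD[OF autoD(3)[OF aut], of "gen v" "\<one>\<^bsub>A\<^esub>"] gv by simp
    then show ?thesis using gen_nontrivial[OF v] by simp
  next
    case (Cons s es')
    then have "cyc_ind m [] = 0" using short by simp
    then have "cyc_ind m [v] \<noteq> 0" using top nonzero by auto
    then have "ceq m [v]" by (simp add: cyc_ind_def split: if_splits)
    then have "mset m = {#v#}" using ceq_mset by fastforce
    then have "m = [v]" by simp
    then obtain e where e: "es = [(v, e)]" by (auto simp: m_def map_eq_Cons_conv)
    have "e = 1" using top \<open>cyc_ind m [] = 0\<close> \<open>ceq m [v]\<close> by (simp add: e cyc_ind_def)
    then have "val es = gen v" using gv by (simp add: e A.int_pow_1)
    then show ?thesis using g \<phi>_eq by (intro bexI[of _ g]) simp_all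
  qed
qed

text \<open>The step that adds one vertex: a conjugator for \<open>v\<close> is written
  \<open>s h\<close> with \<open>s\<close> centralizing \<open>W\<close> and \<open>h\<close> as
  short as possible. If \<open>h\<close> were nonempty, the conjugating series would have both a
  zero and a nonzero coefficient at its top monomial.\<close>

lemma centralizing_conjugator:
  assumes \<phi>: "\<And>c. \<phi> \<in> unit_inner A c" and W: "W \<subseteq> V" and v: "v \<in> V"
    and fixed: "\<And>w. w \<in> W \<Longrightarrow> \<phi> (gen w) = gen w"
  shows "\<exists>s\<in>carrier A. (\<forall>w\<in>W. s \<otimes>\<^bsub>A\<^esub> gen w = gen w \<otimes>\<^bsub>A\<^esub> s) \<and>
    \<phi> (gen v) = s \<otimes>\<^bsub>A\<^esub> gen v \<otimes>\<^bsub>A\<^esub> inv\<^bsub>A\<^esub> s"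
proof -
  note gv = gen_closed[OF v]
  define Z where "Z = {s \<in> carrier A. \<forall>w\<in>W. s \<otimes>\<^bsub>A\<^esub> gen w = gen w \<otimes>\<^bsub>A\<^esub> s}"
  define D where "D es \<longleftrightarrow> syllables es \<and> (\<exists>s\<in>Z. \<phi> (gen v) =
    (s \<otimes>\<^bsub>A\<^esub> val es) \<otimes>\<^bsub>A\<^esub> gen v \<otimes>\<^bsub>A\<^esub> inv\<^bsub>A\<^esub> (s \<otimes>\<^bsub>A\<^esub> val es))" for es
  obtain h0 where h0: "h0 \<in> carrier A" "\<phi> (gen v) = h0 \<otimes>\<^bsub>A\<^esub> gen v \<otimes>\<^bsub>A\<^esub> inv\<^bsub>A\<^esub> h0"
    using unit_inner_gen_conjugate[OF \<phi> v] by blast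
  obtain es0 where "syllables es0" "val es0 = h0" using syllables_exist[OF h0(1)] by blast
  moreover have "\<one>\<^bsub>A\<^esub> \<in> Z" using W gen_closed by (auto simp: Z_def)
  ultimately have "D es0" unfolding D_def using h0 by (intro conjI bexI[of _ "\<one>\<^bsub>A\<^esub>"]) simp_all
  then obtain es where "D es" and min: "\<And>es'. D es' \<Longrightarrow> length es \<le> length es'"
    using ex_has_least_nat[of D es0 length] by blast
  then obtain s where es: "syllables es" and s: "s \<in> Z"
    and \<phi>_eq: "\<phi> (gen v) = (s \<otimes>\<^bsub>A\<^esub> val es) \<otimes>\<^bsub>A\<^esub> gen v \<otimes>\<^bsub>A\<^esub> inv\<^bsub>A\<^esub> (s \<otimes>\<^bsub>A\<^esub> val es)"
    unfolding D_def by blast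
  have sc: "s \<in> carrier A" using s by (simp add: Z_def)
  define m where "m = map fst es"
  define h where "h = val es"
  have hc: "h \<in> carrier A" unfolding h_def by (rule val_closed[OF es])
  have same_val: "length es \<le> length es'" if "syllables es'" "val es' = val es" for es'
    using min[of es'] that s \<phi>_eq unfolding D_def by fastforce
  have nonzero: "prod_list (map snd es) \<noteq> 0"
  proof
    assume "prod_list (map snd es) = 0"
    then have "0 \<in> snd ` set es" by (simp add: prod_list_zero_iff)
    then obtain es' where "syllables es'" "val es' = val es" "length es' < length es"
      by (rule val_remove_zero[OF es])
    then show False using same_val by fastforce
  qed
  have sqf: "square_free m"
    unfolding square_free_def
  proof (intro allI notI)
    fix p a q assume teq: "teq m (p @ a # a # q)"
    then obtain es1 where 1: "syllables es1" "map fst es1 = p @ a # a # q" "val es1 = val es"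
      using val_teq[OF es] unfolding m_def by blast
    obtain es2 where "syllables es2" "val es2 = val es1" "length es2 < length es1"
      by (rule val_merge_square[OF 1(1,2)])
    moreover have "length es1 = length es"
      using teq_length[OF teq] 1(2) unfolding m_def by (metis length_map)
    ultimately show False using same_val[of es2] 1(3) by simp
  qed
  \<comment> \<open>A final syllable commuting with \<open>v\<close> could be dropped without
    changing the conjugate of \<open>v\<close>.\<close>
  have right: "b \<noteq> v \<and> (b, v) \<notin> E" if teq: "teq m (r @ [b])" for r b
  proof (rule ccontr)
    assume b: "\<not> (b \<noteq> v \<and> (b, v) \<notin> E)"
    obtain es' where es': "syllables es'" "map fst es' = r @ [b]" "val es' = val es"
      using val_teq[OF es] teq unfolding m_def by blast
    then obtain es1 e where es1: "es' = es1 @ [(b, e)]"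
      by (auto simp: map_eq_append_conv map_eq_Cons_conv)
    have bV: "b \<in> V" and S: "syllables es1" using es'(1) es1 by auto
    define y where "y = gen b [^]\<^bsub>A\<^esub> e"
    have y: "y \<in> carrier A" unfolding y_def using gen_closed[OF bV] by simp
    have "gen b \<otimes>\<^bsub>A\<^esub> gen v = gen v \<otimes>\<^bsub>A\<^esub> gen b" using b gen_commute by auto
    then have yv: "y \<otimes>\<^bsub>A\<^esub> gen v = gen v \<otimes>\<^bsub>A\<^esub> y"
      unfolding y_def by (rule A.int_pow_commute[OF gen_closed[OF bV] gv])
    define k where "k = s \<otimes>\<^bsub>A\<^esub> val es1"
    have k: "k \<in> carrier A" unfolding k_def using sc val_closed[OF S] by simp
    have "s \<otimes>\<^bsub>A\<^esub> val es = k \<otimes>\<^bsub>A\<^esub> y"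
      using es'(3) es1 S bV sc val_closed[OF S] gen_closed[OF bV]
      by (simp add: val_append k_def y_def A.m_assoc flip: es'(3))
    moreover have "(k \<otimes>\<^bsub>A\<^esub> y) \<otimes>\<^bsub>A\<^esub> gen v \<otimes>\<^bsub>A\<^esub> inv\<^bsub>A\<^esub> (k \<otimes>\<^bsub>A\<^esub> y) = k \<otimes>\<^bsub>A\<^esub> gen v \<otimes>\<^bsub>A\<^esub> inv\<^bsub>A\<^esub> k"
    proof -
      have "(k \<otimes>\<^bsub>A\<^esub> y) \<otimes>\<^bsub>A\<^esub> gen v \<otimes>\<^bsub>A\<^esub> inv\<^bsub>A\<^esub> (k \<otimes>\<^bsub>A\<^esub> y)
          = k \<otimes>\<^bsub>A\<^esub> (y \<otimes>\<^bsub>A\<^esub> gen v) \<otimes>\<^bsub>A\<^esub> (inv\<^bsub>A\<^esub> y \<otimes>\<^bsub>A\<^esub> inv\<^bsub>A\<^esub> k)"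
        using k y gv by (simp add: A.inv_mult_group A.m_assoc)
      then show ?thesis
        unfolding yv using k y gv by (simp add: A.m_assoc A.mult_inv_cancel)
    qed
    ultimately have "D es1"
      unfolding D_def using S s \<phi>_eq by (intro conjI bexI[of _ s]) (simp_all add: k_def)
    moreover have "length es = Suc (length es1)"
      using teq_length[OF teq] es'(2) es1 unfolding m_def by (metis length_map length_append_singleton)
    ultimately show False using min[of es1] by simp
  qed
  have "es = []"
  proof (rule ccontr)
    assume "es \<noteq> []"
    then obtain a e es1 where es1: "es = (a, e) # es1" by (cases es) auto
    have aV: "a \<in> V" and S: "syllables es1" using es es1 by auto
    \<comment> \<open>Otherwise the first syllable would centralize \<open>W\<close> and could be
      moved into \<open>s\<close>, shortening \<open>es\<close>.\<close>
    have "\<exists>w\<in>W. a \<noteq> w \<and> (a, w) \<notin> E"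
    proof (rule ccontr)
      assume star: "\<not> (\<exists>w\<in>W. a \<noteq> w \<and> (a, w) \<notin> E)"
      define y where "y = gen a [^]\<^bsub>A\<^esub> e"
      have y: "y \<in> carrier A" unfolding y_def using gen_closed[OF aV] by simp
      have yw: "y \<otimes>\<^bsub>A\<^esub> gen w = gen w \<otimes>\<^bsub>A\<^esub> y" if w: "w \<in> W" for w
        unfolding y_def
      proof (rule A.int_pow_commute[OF gen_closed[OF aV]])
        show "gen w \<in> carrier A" using w W gen_closed by blast
        show "gen a \<otimes>\<^bsub>A\<^esub> gen w = gen w \<otimes>\<^bsub>A\<^esub> gen a"
          using star w gen_commute by (cases "a = w") auto
      qed
      have "s \<otimes>\<^bsub>A\<^esub> y \<in> Z"
        unfolding Z_def
      proof (intro CollectI conjI ballI)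
        fix w assume w: "w \<in> W"
        have gw: "gen w \<in> carrier A" using w W gen_closed by blast
        have "s \<otimes>\<^bsub>A\<^esub> y \<otimes>\<^bsub>A\<^esub> gen w = s \<otimes>\<^bsub>A\<^esub> gen w \<otimes>\<^bsub>A\<^esub> y"
          using sc y gw by (simp add: A.m_assoc yw[OF w])
        also have "\<dots> = gen w \<otimes>\<^bsub>A\<^esub> (s \<otimes>\<^bsub>A\<^esub> y)"
          using s w sc y gw by (simp add: Z_def A.m_assoc)
        finally show "s \<otimes>\<^bsub>A\<^esub> y \<otimes>\<^bsub>A\<^esub> gen w = gen w \<otimes>\<^bsub>A\<^esub> (s \<otimes>\<^bsub>A\<^esub> y)" .
      qed (use sc y in simp)
      moreover have "s \<otimes>\<^bsub>A\<^esub> val es = s \<otimes>\<^bsub>A\<^esub> y \<otimes>\<^bsub>A\<^esub> val es1"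
        using sc y val_closed[OF S] by (simp add: es1 y_def A.m_assoc)
      ultimately have "D es1"
        unfolding D_def using S \<phi>_eq by (intro conjI bexI[of _ "s \<otimes>\<^bsub>A\<^esub> y"]) simp_all
      then show False using min[of es1] es1 by simp
    qed
    then obtain w where w: "w \<in> W" "a \<noteq> w" "(a, w) \<notin> E" by blast
    have wV: "w \<in> V" using w W by blast
    \<comment> \<open>Removing \<open>s\<close> leaves an automorphism that still fixes
      \<open>w\<close> and sends \<open>v\<close> to its conjugate by \<open>h\<close>.\<close>
    obtain \<psi> where \<psi>: "\<And>c. \<psi> \<in> unit_inner A c"
      and \<psi>_eq: "\<And>x. x \<in> carrier A \<Longrightarrow> \<psi> x = inv\<^bsub>A\<^esub> s \<otimes>\<^bsub>A\<^esub> \<phi> x \<otimes>\<^bsub>A\<^esub> inv\<^bsub>A\<^esub> (inv\<^bsub>A\<^esub> s)"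
      using A.conjugation_unit_inner_mult[OF A.inv_closed[OF sc] \<phi>] by blast
    have \<psi>w: "\<psi> (gen w) = gen w"
    proof -
      note gw = gen_closed[OF wV]
      have "\<psi> (gen w) = inv\<^bsub>A\<^esub> s \<otimes>\<^bsub>A\<^esub> (gen w \<otimes>\<^bsub>A\<^esub> s)"
        using sc gw by (simp add: \<psi>_eq fixed[OF w(1)] A.m_assoc)
      also have "\<dots> = inv\<^bsub>A\<^esub> s \<otimes>\<^bsub>A\<^esub> (s \<otimes>\<^bsub>A\<^esub> gen w)"
        using s w(1) by (simp add: Z_def)
      also have "\<dots> = gen w" using sc gw by (simp add: A.m_assoc[symmetric])
      finally show ?thesis .
    qed
    have \<psi>v: "\<psi> (gen v) = h \<otimes>\<^bsub>A\<^esub> (gen v \<otimes>\<^bsub>A\<^esub> inv\<^bsub>A\<^esub> h)"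
      using sc hc gv
      by (simp add: \<psi>_eq \<phi>_eq h_def[symmetric] A.inv_mult_group A.m_assoc A.mult_inv_cancel)
    \<comment> \<open>Comparing coefficients of \<open>m\<close> followed by one more letter
      requires \<open>length m + 1 < c\<close>.\<close>
    define c where "c = length m + 2"
    obtain T where T: "trace_op c T"
      and T_eq: "\<And>x F. x \<in> carrier A \<Longrightarrow> F \<in> trace_fun c \<Longrightarrow> rho c (\<psi> x) (T F) = T (rho c x F)"
      using unit_inner_trace_op[OF \<psi>[of c]] by blast
    note T_trace_fun = trace_op_trace_fun[OF T order_refl]
    have T_w: "T (snoc_op w F) = snoc_op w (T F)" if F: "F \<in> trace_fun c" for F
      using T_eq[OF gen_closed[OF wV] F] rho_gen[OF wV F] rho_gen[OF wV T_trace_fun[OF F]]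
      by (simp add: \<psi>w linear_add[OF trace_op_linear[OF T]])
    \<comment> \<open>With \<open>u\<close> the conjugating series behind \<open>T\<close>, this is
      the operator of \<open>h^-1 u\<close>, which commutes with \<open>v\<close>.\<close>
    define Y where "Y = (\<lambda>F. rho c (inv\<^bsub>A\<^esub> h) (T F))"
    have Y: "trace_op c Y"
      unfolding Y_def by (rule trace_op_comp[OF trace_op_rho T])
    note Y_trace_fun = trace_op_trace_fun[OF Y order_refl]
    have Y_v: "Y (snoc_op v F) = snoc_op v (Y F)" if F: "F \<in> trace_fun c" for F
    proof -
      have "rho c h (rho c (gen v) (Y F)) = T (rho c (gen v) F)"
        using T_eq[OF gv F] hc gv T_trace_fun[OF F] by (simp add: \<psi>v rho_mult rho_trace_fun Y_def)
      then have "rho c (inv\<^bsub>A\<^esub> h) (rho c h (rho c (gen v) (Y F))) = Y (rho c (gen v) F)"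
        by (simp add: Y_def)
      then have "rho c (gen v) (Y F) = Y (rho c (gen v) F)"
        using rho_inv(1)[OF hc rho_trace_fun[OF Y_trace_fun[OF F]]] by simp
      then show ?thesis
        using rho_gen[OF v F] rho_gen[OF v Y_trace_fun[OF F]]
        by (simp add: linear_add[OF trace_op_linear[OF Y]])
    qed
    have m_trace_fun: "trace_ind m \<in> trace_fun c" by (rule trace_ind_trace_fun) (simp add: c_def)
    \<comment> \<open>The value at \<open>u\<close> is the coefficient of the series of
      \<open>Y\<close> at the remainder \<open>t\<close> with \<open>m = u t\<close>. For empty
      \<open>t\<close> it is 1; otherwise \<open>t\<close> ends in a letter not commuting with
      \<open>v\<close>, and the coefficient vanishes.\<close>
    have "Y (trace_ind m) u = trace_ind m u" for u
    proof -
      have Yu: "Y (trace_ind m) u = Y (prefix_op u (trace_ind m)) []"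
        unfolding trace_op_prefix[OF Y] by (simp add: prefix_op_def)
      show ?thesis
      proof (cases "\<exists>t. teq m (u @ t)")
        case False
        then have "prefix_op u (trace_ind m) = 0"
          by (simp add: prefix_op_def trace_ind_def fun_eq_iff zero_fun_apply)
        then have "Y (trace_ind m) u = 0"
          unfolding Yu by (simp add: linear_0[OF trace_op_linear[OF Y]]) (simp add: zero_fun_apply)
        moreover have "\<not> teq m u" using False by (metis append_Nil2)
        ultimately show ?thesis by (simp add: trace_ind_def)
      next
        case True
        then obtain t where t: "teq m (u @ t)" ..
        have "teq m (u @ t') \<longleftrightarrow> teq t t'" for t'
          using t teq_sym teq_trans teq_prepend_iff by blast
        then have prefix: "prefix_op u (trace_ind m) = trace_ind t"
          by (simp add: prefix_op_def trace_ind_def)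
        have len: "length m = length u + length t" using teq_length[OF t] by simp
        show ?thesis
        proof (cases t rule: rev_cases)
          case Nil
          have "trace_ind ([] :: 'v list) \<in> trace_fun (Suc 0)" by (rule trace_ind_trace_fun) simp
          then have "Y (trace_ind []) - trace_ind [] \<in> trace_fun 0"
            using trace_op_diff[OF Y, of 0] by (simp add: c_def)
          then have "Y (trace_ind []) = trace_ind []" by (simp add: trace_fun_0)
          then show ?thesis
            using t Nil unfolding Yu prefix by (simp add: trace_ind_def)
        next
          case (snoc t' b)
          have "teq m ((u @ t') @ [b])" using t snoc by simp
          from right[OF this] have b: "b \<noteq> v" "(b, v) \<notin> E" by auto
          have "square_free t"
            by (rule square_free_suffix[OF square_free_teq[OF sqf t]])
          then have "Y (trace_ind t) [] = 0"
            using len snoc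
            by (intro trace_op_commuting_coefficient[OF Y Y_v _ _ _ b]) (simp_all add: c_def)
          moreover have "\<not> teq m u" using teq_length[of m u] len snoc by auto
          ultimately show ?thesis
            unfolding Yu prefix by (simp add: trace_ind_def)
        qed
      qed
    qed
    then have "Y (trace_ind m) = trace_ind m" by blast
    then have "T (trace_ind m) = rho c h (trace_ind m)"
      using rho_inv(2)[OF hc T_trace_fun[OF m_trace_fun]] by (simp add: Y_def)
    moreover have "rho c h (trace_ind m) [] = real_of_int (prod_list (map snd es)) * trace_ind m (map fst es)"
      unfolding h_def
    proof (rule rho_val_top[OF es m_trace_fun])
      show "square_zero (trace_ind m)"
        using sqf by (simp add: square_zero_def square_free_def trace_ind_def)
      show "trace_ind m u = 0" if "length u < length es" for u
        using that teq_length[of m u] by (auto simp: trace_ind_def m_def)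
    qed
    \<comment> \<open>The first letter \<open>a\<close> of \<open>m\<close> does not commute with
      \<open>w\<close>, whereas the evaluation through \<open>h\<close> gives the nonzero product of
      exponents.\<close>
    moreover have "T (trace_ind m) [] = 0"
      by (rule trace_op_commuting_coefficient[OF T T_w sqf _ _ w(2,3)])
        (simp_all add: c_def m_def es1)
    ultimately show False using nonzero by (simp add: trace_ind_def m_def)
  qed
  then show ?thesis
    using s sc \<phi>_eq by (intro bexI[of _ s]) (simp_all add: Z_def)
qed

text \<open>After normalizing by the conjugator \<open>g\<close> found for \<open>W\<close>, the new
  conjugator \<open>s\<close> for \<open>v\<close> centralizes \<open>W\<close>, so
  \<open>g s\<close> works for \<open>W\<close> and \<open>v\<close> together.\<close>

lemma simultaneous_conjugator:
  assumes \<phi>: "\<And>c. \<phi> \<in> unit_inner A c" and "finite W" "W \<subseteq> V"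
  shows "\<exists>g\<in>carrier A. \<forall>w\<in>W. \<phi> (gen w) = g \<otimes>\<^bsub>A\<^esub> gen w \<otimes>\<^bsub>A\<^esub> inv\<^bsub>A\<^esub> g"
  using assms(2,3)
proof (induction W rule: finite_induct)
  case empty
  then show ?case by (intro bexI[of _ "\<one>\<^bsub>A\<^esub>"]) simp_all
next
  case (insert v W)
  then have v: "v \<in> V" and W: "W \<subseteq> V" by auto
  obtain g where g: "g \<in> carrier A"
    and gW: "\<And>w. w \<in> W \<Longrightarrow> \<phi> (gen w) = g \<otimes>\<^bsub>A\<^esub> gen w \<otimes>\<^bsub>A\<^esub> inv\<^bsub>A\<^esub> g"
    using insert.IH[OF W] by blast
  obtain \<psi> where \<psi>: "\<And>c. \<psi> \<in> unit_inner A c"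
    and \<psi>_eq: "\<And>x. x \<in> carrier A \<Longrightarrow> \<psi> x = inv\<^bsub>A\<^esub> g \<otimes>\<^bsub>A\<^esub> \<phi> x \<otimes>\<^bsub>A\<^esub> inv\<^bsub>A\<^esub> (inv\<^bsub>A\<^esub> g)"
    using A.conjugation_unit_inner_mult[OF A.inv_closed[OF g] \<phi>] by blast
  have aut: "\<phi> \<in> auto A" by (rule A.IA_auto[OF A.unit_inner_IA[OF \<phi>]])
  have \<phi>_psi: "\<phi> x = g \<otimes>\<^bsub>A\<^esub> \<psi> x \<otimes>\<^bsub>A\<^esub> inv\<^bsub>A\<^esub> g" if x: "x \<in> carrier A" for x
  proof -
    note \<phi>x = A.auto_closed[OF aut x]
    show ?thesis
      using g \<phi>x by (simp add: \<psi>_eq[OF x] A.m_assoc A.mult_inv_cancel)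
  qed
  have "\<psi> (gen w) = gen w" if w: "w \<in> W" for w
  proof -
    have gw: "gen w \<in> carrier A" using w W gen_closed by blast
    show ?thesis
      using g gw by (simp add: \<psi>_eq[OF gw] gW[OF w] A.m_assoc A.mult_inv_cancel)
  qed
  from centralizing_conjugator[OF \<psi> W v this]
  obtain s where s: "s \<in> carrier A" "\<And>w. w \<in> W \<Longrightarrow> s \<otimes>\<^bsub>A\<^esub> gen w = gen w \<otimes>\<^bsub>A\<^esub> s"
    "\<psi> (gen v) = s \<otimes>\<^bsub>A\<^esub> gen v \<otimes>\<^bsub>A\<^esub> inv\<^bsub>A\<^esub> s"
    by blast
  have "\<phi> (gen w) = (g \<otimes>\<^bsub>A\<^esub> s) \<otimes>\<^bsub>A\<^esub> gen w \<otimes>\<^bsub>A\<^esub> inv\<^bsub>A\<^esub> (g \<otimes>\<^bsub>A\<^esub> s)" if w: "w \<in> insert v W" for w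
  proof -
    have gw: "gen w \<in> carrier A" using w insert.prems gen_closed by blast
    have "\<psi> (gen w) = s \<otimes>\<^bsub>A\<^esub> gen w \<otimes>\<^bsub>A\<^esub> inv\<^bsub>A\<^esub> s"
    proof (cases "w = v")
      case False
      then have "w \<in> W" using w by simp
      then have "s \<otimes>\<^bsub>A\<^esub> gen w \<otimes>\<^bsub>A\<^esub> inv\<^bsub>A\<^esub> s = gen w"
        using s(1,2) gw by (simp add: A.m_assoc)
      then show ?thesis using \<open>w \<in> W\<close> \<open>\<And>w. w \<in> W \<Longrightarrow> \<psi> (gen w) = gen w\<close> by simp
    qed (use s(3) in simp)
    then show ?thesis
      using \<phi>_psi[OF gw] g s(1) gw by (simp add: A.inv_mult_group A.m_assoc)
  qed
  then show ?case using g s(1) by (intro bexI[of _ "g \<otimes>\<^bsub>A\<^esub> s"]) auto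
qed

lemma unit_inner_Inn:
  assumes \<phi>: "\<And>c. \<phi> \<in> unit_inner A c"
  shows "\<phi> \<in> Inn A"
proof -
  have aut: "\<phi> \<in> auto A" by (rule A.IA_auto[OF A.unit_inner_IA[OF \<phi>]])
  obtain g where g: "g \<in> carrier A" and gV: "\<And>v. v \<in> V \<Longrightarrow> \<phi> (gen v) = g \<otimes>\<^bsub>A\<^esub> gen v \<otimes>\<^bsub>A\<^esub> inv\<^bsub>A\<^esub> g"
    using simultaneous_conjugator[OF \<phi> finite_V order_refl] by blast
  interpret \<phi>: group_hom A A \<phi>
    by unfold_locales (rule autoD(1)[OF aut])
  interpret \<gamma>: group_hom A A "conjugation A g"
    by unfold_locales (rule autoD(1)[OF A.conjugation_auto[OF g]])
  have gen: "\<phi> (gen v) = conjugation A g (gen v)" if "v \<in> V" for v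
    using gV[OF that] gen_closed[OF that] by (simp add: conjugation_def)
  have "\<phi> (cls u) = conjugation A g (cls u)" if "u \<in> words V" for u
    using that
  proof (induction u)
    case Nil
    then show ?case by (simp add: cls_Nil)
  next
    case (Cons a u)
    obtain v b where a: "a = (v, b)" by force
    have v: "v \<in> V" and u: "u \<in> words V" using Cons.prems a by auto
    have "\<phi> (cls [a]) = conjugation A g (cls [a])"
      using gen[OF v] gen_closed[OF v] a by (cases b) (simp_all add: cls_inverse[OF v])
    moreover have "cls (a # u) = cls [a] \<otimes>\<^bsub>A\<^esub> cls u"
      using cls_mult[of "[a]" u] v u a by simp
    moreover have "cls [a] \<in> carrier A" "cls u \<in> carrier A"
      using v u a by (simp_all add: cls_closed)
    ultimately show ?case using Cons.IH[OF u] by simp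
  qed
  then have "\<phi> x = conjugation A g x" if "x \<in> carrier A" for x
    using carrier_cls[OF that] by metis
  then have "\<phi> = conjugation A g"
    using autoD(2)[OF aut] autoD(2)[OF A.conjugation_auto[OF g]] by (intro extensionalityI)
  then show ?thesis using g by (simp add: Inn_def)
qed

end

theorem theorem4p9:
  fixes \<Gamma> :: "'v pair_pre_digraph"
  assumes "pair_graph \<Gamma>"
  shows "residually_torsion_free_nilpotent (Torelli_Out (RAAG \<Gamma>))"
proof -
  interpret \<Gamma>: pair_graph \<Gamma> by fact
  interpret raag "parcs \<Gamma>" "pverts \<Gamma>"
  proof unfold_locales
    show "(b, a) \<in> parcs \<Gamma>" if "(a, b) \<in> parcs \<Gamma>" for a b
      using that \<Gamma>.pair_sym_arcs by (auto simp: symmetric_def sym_def)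
    show "(a, a) \<notin> parcs \<Gamma>" for a
      using \<Gamma>.pair_no_loops[of "(a, a)"] by auto
    show "finite (pverts \<Gamma>)" by (rule \<Gamma>.pair_finite_verts)
    show "parcs \<Gamma> \<subseteq> pverts \<Gamma> \<times> pverts \<Gamma>"
      using \<Gamma>.in_arcsD1 \<Gamma>.in_arcsD2 by auto
  qed
  have "RAAG \<Gamma> = A" by (simp add: RAAG_def A_def)
  then show ?thesis
    using A.residually_torsion_free_nilpotent_Torelli_Out unit_inner_Inn by simp
qed

end
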